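(* Let $1\le p<\infty$, let $g\in H(\mathbb{D})$, and suppose that $S_g\colon H^p\to H^p$ is bounded but not compact. Then $S_g\colon H^p\to H^p$ fixes an isomorphic copy of $\ell^p$, and it also fixes an isomorphic copy of $\ell^2$. In particular, $S_g$ is not strictly singular; that is, for every $g\in H(\mathbb{D})$ such that $S_g\colon H^p\to H^p$ is bounded, $S_g$ is strictly singular if and only if it is compact.
   Context: $\mathbb{D}$ is the open unit disk in $\mathbb{C}$, $H(\mathbb{D})$ is the space of analytic functions on $\mathbb{D}$, and $m$ is the normalized Lebesgue measure on $\partial\mathbb{D}$. For $0<p<\infty$, the Hardy space $H^p$ consists of all $f\in H(\mathbb{D})$ with $\|f\|_{H^p}=\left(\lim_{r\to1^-}\int_{\partial\mathbb{D}}|f(r\xi)|^p\,dm(\xi)\right)^{1/p}<\infty$. For $g\in H(\mathbb{D})$, the Volterra type operator $S_g$ is defined by $(S_gf)(z)=\int_0^z f'(\omega)g(\omega)\,d\omega$ for $z\in\mathbb{D}$, $f\in H(\mathbb{D})$. A bounded operator $T\colon X\to Y$ between Banach spaces is strictly singular if its restriction to any infinite-dimensional closed subspace of $X$ is not an isomorphism onto its image. A bounded operator $T\colon X\to Y$ fixes a(n isomorphic) copy of a Banach space $E$ if there is a closed subspace $M\subset X$, linearly isomorphic to $E$, such that the restriction $T|_M$ is an isomorphism from $M$ onto $T(M)$. *)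

theory Defs
  imports "HOL-Complex_Analysis.Complex_Analysis" "HOL-Library.Function_Algebras"
begin

text \<open>
  A complex normed space is represented by a carrier set \<open>X\<close> of complex-valued functions,
  with pointwise operations, together with a norm \<open>N\<close> whose values matter only on \<open>X\<close>.
\<close>

definition scale_fun :: "complex \<Rightarrow> ('i \<Rightarrow> complex) \<Rightarrow> 'i \<Rightarrow> complex" where
  "scale_fun c f = (\<lambda>x. c * f x)"

global_interpretation cfun: vector_space "scale_fun :: complex \<Rightarrow> ('i \<Rightarrow> complex) \<Rightarrow> 'i \<Rightarrow> complex"
  by unfold_locales (auto simp: scale_fun_def fun_eq_iff algebra_simps)

definition norm_topology :: "('i \<Rightarrow> complex) set \<Rightarrow> (('i \<Rightarrow> complex) \<Rightarrow> real) \<Rightarrow> ('i \<Rightarrow> complex) topology" where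
  "norm_topology X N = Metric_space.mtopology X (\<lambda>f h. N (f - h))"

definition closed_subspace :: "('i \<Rightarrow> complex) set \<Rightarrow> (('i \<Rightarrow> complex) \<Rightarrow> real) \<Rightarrow> ('i \<Rightarrow> complex) set \<Rightarrow> bool" where
  "closed_subspace X N M \<longleftrightarrow> M \<subseteq> X \<and> cfun.subspace M \<and> closedin (norm_topology X N) M"

definition infinite_dimensional :: "('i \<Rightarrow> complex) set \<Rightarrow> bool" where
  "infinite_dimensional M \<longleftrightarrow> \<not> (\<exists>B. finite B \<and> M \<subseteq> cfun.span B)"

definition bounded_op ::
  "('i \<Rightarrow> complex) set \<Rightarrow> (('i \<Rightarrow> complex) \<Rightarrow> real) \<Rightarrow>
   ('j \<Rightarrow> complex) set \<Rightarrow> (('j \<Rightarrow> complex) \<Rightarrow> real) \<Rightarrow>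
   (('i \<Rightarrow> complex) \<Rightarrow> ('j \<Rightarrow> complex)) \<Rightarrow> bool" where
  "bounded_op X NX Y NY T \<longleftrightarrow>
     (\<forall>f\<in>X. T f \<in> Y) \<and>
     (\<forall>f\<in>X. \<forall>h\<in>X. T (f + h) = T f + T h) \<and>
     (\<forall>c. \<forall>f\<in>X. T (scale_fun c f) = scale_fun c (T f)) \<and>
     (\<exists>C. \<forall>f\<in>X. NY (T f) \<le> C * NX f)"

definition compact_op ::
  "('i \<Rightarrow> complex) set \<Rightarrow> (('i \<Rightarrow> complex) \<Rightarrow> real) \<Rightarrow>
   ('j \<Rightarrow> complex) set \<Rightarrow> (('j \<Rightarrow> complex) \<Rightarrow> real) \<Rightarrow>
   (('i \<Rightarrow> complex) \<Rightarrow> ('j \<Rightarrow> complex)) \<Rightarrow> bool" where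
  "compact_op X NX Y NY T \<longleftrightarrow>
     bounded_op X NX Y NY T \<and>
     compactin (norm_topology Y NY) (norm_topology Y NY closure_of (T ` {f \<in> X. NX f \<le> 1}))"

definition isomorphism ::
  "('i \<Rightarrow> complex) set \<Rightarrow> (('i \<Rightarrow> complex) \<Rightarrow> real) \<Rightarrow>
   ('j \<Rightarrow> complex) set \<Rightarrow> (('j \<Rightarrow> complex) \<Rightarrow> real) \<Rightarrow>
   (('i \<Rightarrow> complex) \<Rightarrow> ('j \<Rightarrow> complex)) \<Rightarrow> bool" where
  "isomorphism X NX Y NY T \<longleftrightarrow>
     bij_betw T X Y \<and> bounded_op X NX Y NY T \<and> bounded_op Y NY X NX (inv_into X T)"

definition strictly_singular ::
  "('i \<Rightarrow> complex) set \<Rightarrow> (('i \<Rightarrow> complex) \<Rightarrow> real) \<Rightarrow>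
   ('j \<Rightarrow> complex) set \<Rightarrow> (('j \<Rightarrow> complex) \<Rightarrow> real) \<Rightarrow>
   (('i \<Rightarrow> complex) \<Rightarrow> ('j \<Rightarrow> complex)) \<Rightarrow> bool" where
  "strictly_singular X NX Y NY T \<longleftrightarrow>
     bounded_op X NX Y NY T \<and>
     (\<forall>M. closed_subspace X NX M \<and> infinite_dimensional M \<longrightarrow> \<not> isomorphism M NX (T ` M) NY T)"

definition fixes_copy ::
  "('i \<Rightarrow> complex) set \<Rightarrow> (('i \<Rightarrow> complex) \<Rightarrow> real) \<Rightarrow>
   ('j \<Rightarrow> complex) set \<Rightarrow> (('j \<Rightarrow> complex) \<Rightarrow> real) \<Rightarrow>
   (('i \<Rightarrow> complex) \<Rightarrow> ('j \<Rightarrow> complex)) \<Rightarrow>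
   ('k \<Rightarrow> complex) set \<Rightarrow> (('k \<Rightarrow> complex) \<Rightarrow> real) \<Rightarrow> bool" where
  "fixes_copy X NX Y NY T E NE \<longleftrightarrow>
     bounded_op X NX Y NY T \<and>
     (\<exists>M. closed_subspace X NX M \<and> (\<exists>J. isomorphism E NE M NX J) \<and> isomorphism M NX (T ` M) NY T)"

definition lp_space :: "real \<Rightarrow> (nat \<Rightarrow> complex) set" where
  "lp_space p = {x. summable (\<lambda>n. norm (x n) powr p)}"

definition lp_norm :: "real \<Rightarrow> (nat \<Rightarrow> complex) \<Rightarrow> real" where
  "lp_norm p x = (\<Sum>n. norm (x n) powr p) powr (1 / p)"

definition circle_measure :: "complex measure" where
  "circle_measure = distr (uniform_measure lborel {0..2 * pi}) (restrict_space borel (sphere 0 1)) cis"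

definition hardy_mean :: "real \<Rightarrow> (complex \<Rightarrow> complex) \<Rightarrow> real \<Rightarrow> real" where
  "hardy_mean p f r = (LINT \<xi>|circle_measure. norm (f (of_real r * \<xi>)) powr p)"

text \<open>
  A function on the open unit disk is represented by its extension by zero, so that equality
  in \<open>hardy_space p\<close> is equality on the disk.
\<close>

definition hardy_space :: "real \<Rightarrow> (complex \<Rightarrow> complex) set" where
  "hardy_space p =
     {f. f holomorphic_on ball 0 1 \<and> (\<forall>z. z \<notin> ball 0 1 \<longrightarrow> f z = 0) \<and>
         (\<exists>L. (hardy_mean p f \<longlongrightarrow> L) (at_left 1))}"

definition hardy_norm :: "real \<Rightarrow> (complex \<Rightarrow> complex) \<Rightarrow> real" where
  "hardy_norm p f = (Lim (at_left 1) (hardy_mean p f)) powr (1 / p)"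

definition volterra_op :: "(complex \<Rightarrow> complex) \<Rightarrow> (complex \<Rightarrow> complex) \<Rightarrow> complex \<Rightarrow> complex" where
  "volterra_op g f z =
     (if z \<in> ball 0 1 then contour_integral (linepath 0 z) (\<lambda>w. deriv f w * g w) else 0)"

end

theory Submission
  imports Defs
begin

text \<open>
  If \<open>g\<close> vanishes on the disk, then \<open>S\<^sub>g = 0\<close> is both compact and strictly singular. Otherwise
  two sequences \<open>f\<^sub>k\<close> in \<open>H\<^sup>p\<close> are exhibited for which \<open>\<parallel>\<Sum>x\<^sub>k f\<^sub>k\<parallel> \<le> C \<parallel>x\<parallel>\<close> and
  \<open>c \<parallel>x\<parallel> \<le> \<parallel>\<Sum>x\<^sub>k S\<^sub>g f\<^sub>k\<parallel>\<close> for all finitely supported \<open>x\<close>, the norm of \<open>x\<close> being that of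
  \<open>\<ell>\<^sup>p\<close> or \<open>\<ell>\<^sup>2\<close>; such a sequence spans a copy of the sequence space that is fixed by \<open>S\<^sub>g\<close>.

  For \<open>\<ell>\<^sup>p\<close>, the \<open>f\<^sub>k\<close> are normalized kernels peaking at points \<open>a\<^sub>k\<close> that approach the circle
  very fast and at which \<open>\<bar>g\<bar>\<close> stays away from \<open>0\<close>; both \<open>f\<^sub>k\<close> and \<open>S\<^sub>g f\<^sub>k\<close> are almost disjointly
  supported on every circle. Since \<open>(S\<^sub>g f)' = f' g\<close>, the derivative at \<open>a\<^sub>k\<close> bounds
  \<open>\<parallel>S\<^sub>g f\<^sub>k\<parallel>\<close> from below, and no boundary values of \<open>g\<close> are needed.

  For \<open>\<ell>\<^sup>2\<close>, the \<open>f\<^sub>k\<close> are monomials with very lacunary exponents. The upper bound comes from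
  even moments of lacunary polynomials, the lower bound from pairing with bounded Rudin--Shapiro
  polynomials, as in Paley's inequality.
\<close>

section \<open>Integration on the unit circle\<close>

text \<open>Every estimate is made on a circle of radius \<open>r < 1\<close>, where all functions
  are continuous; since means of order \<open>p \<ge> 1\<close> increase with \<open>r\<close>,
  bounds uniform in \<open>r\<close> are bounds for the Hardy norm. Boundedness of
  \<open>S\<^sub>g\<close> enters quantitatively: the derivative test at a peak also gives an upper
  bound for \<open>\<bar>g\<bar>\<close> on the disk, which controls the images off their peaks and
  the Taylor coefficients of \<open>g\<close>. The monomials need two kinds of gaps. Ratios above
  \<open>m\<close>, with \<open>2 * m \<ge> p\<close>, separate the blocks in the
  \<open>m\<close>-th power of a polynomial. Ratios growing like \<open>k * 4 ^ k\<close> handle the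
  images: \<open>S\<^sub>g\<close> moves the \<open>i\<close>-th coefficient of \<open>g\<close> to
  frequency \<open>N + i\<close> with the factor \<open>N / (N + i)\<close>, which is negligible far
  beyond \<open>N\<close>, even against test polynomials whose coefficient sums grow like
  \<open>2 ^ k\<close>. The test polynomials are bounded because means of order one are dominated by
  those of order \<open>p\<close>, so that one pairing serves every \<open>p\<close>, including
  \<open>p = 1\<close>.\<close>

lemma measurable_cis_sphere: "cis \<in> measurable borel (restrict_space borel (sphere 0 1))"
  by (intro measurable_restrict_space2 borel_measurable_continuous_onI continuous_on_cis) (auto intro!: continuous_intros)

lemma circle_measure_space [simp]: "space circle_measure = sphere 0 1"
  by (simp add: circle_measure_def space_restrict_space)

lemma circle_measure_sets [simp]: "sets circle_measure = sets (restrict_space borel (sphere 0 1))"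
  by (simp add: circle_measure_def)

lemma measurable_circle_measure [simp]:
  "borel_measurable circle_measure = borel_measurable (restrict_space borel (sphere 0 1))"
  by (intro measurable_cong_sets) auto

text \<open>The measure is the image under \<open>cis\<close> of the density
  \<open>1 / (2 * pi)\<close> on the interval; the endpoints share an image but are null.\<close>

lemma circle_measure_integral_lebesgue:
  fixes \<phi> :: "complex \<Rightarrow> 'a::{banach, second_countable_topology}"
  assumes "\<phi> \<in> borel_measurable circle_measure"
  shows "(LINT \<xi>|circle_measure. \<phi> \<xi>) = (1 / (2 * pi)) *\<^sub>R (LINT t:{0..2*pi}|lborel. \<phi> (cis t))"
proof -
  have 1: "(\<lambda>t. \<phi> (cis t)) \<in> borel_measurable lborel"
    using measurable_comp[OF measurable_cis_sphere] assms by (simp add: comp_def)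
  have e: "uniform_measure lborel {0..2*pi} =
      density lborel (\<lambda>x. ennreal (indicator {0..2*pi} x / (2*pi)))"
    unfolding uniform_measure_def
    by (intro arg_cong[of _ _ "density lborel"] ext)
       (auto simp: indicator_def divide_ennreal ennreal_1[symmetric] simp del: ennreal_1)
  have "(LINT \<xi>|circle_measure. \<phi> \<xi>) = (LINT t|uniform_measure lborel {0..2*pi}. \<phi> (cis t))"
    unfolding circle_measure_def
    using assms measurable_cis_sphere by (intro integral_distr) auto
  also have "\<dots> = (LINT t|lborel. (indicator {0..2*pi} t / (2*pi)) *\<^sub>R \<phi> (cis t))"
    unfolding e using 1 by (subst integral_density) (auto intro!: AE_I2)
  also have "\<dots> = (LINT t|lborel. (1/(2*pi)) *\<^sub>R (indicator {0..2*pi} t *\<^sub>R \<phi> (cis t)))"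
    by (simp add: field_simps)
  also have "\<dots> = (1/(2*pi)) *\<^sub>R (LINT t|lborel. indicator {0..2*pi} t *\<^sub>R \<phi> (cis t))"
    by (rule integral_scaleR_right)
  finally show ?thesis by (simp add: set_lebesgue_integral_def)
qed

lemma circle_measure_space_1: "emeasure circle_measure (space circle_measure) = 1"
proof -
  have "emeasure circle_measure (space circle_measure) = emeasure (uniform_measure lborel {0..2*pi}) UNIV"
    unfolding circle_measure_def
    using measurable_cis_sphere
    by (subst emeasure_distr)
       (auto simp: space_restrict_space sets_restrict_space vimage_def intro!: image_eqI[where x=UNIV] arg_cong[of _ _ "emeasure _"])
  also have "\<dots> = 1"
    using emeasure_uniform_measure_1[of lborel "{0..2*pi}"] by simp
  finally show ?thesis .
qed

global_interpretation circle: finite_measure circle_measure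
  by standard (use circle_measure_space_1 in simp)

lemma measure_circle_measure [simp]: "measure circle_measure (sphere 0 1) = 1"
  using circle_measure_space_1 by (simp add: measure_def)

lemma continuous_circle_measurable:
  fixes \<phi> :: "complex \<Rightarrow> 'a::{topological_space}"
  assumes "continuous_on (sphere 0 1) \<phi>"
  shows "\<phi> \<in> borel_measurable circle_measure"
  using borel_measurable_continuous_on_restrict[OF assms] by simp

lemma continuous_circle_integrable:
  fixes \<phi> :: "complex \<Rightarrow> 'a::{banach, second_countable_topology}"
  assumes "continuous_on (sphere 0 1) \<phi>"
  shows "integrable circle_measure \<phi>"
proof -
  have "compact (\<phi> ` sphere 0 1)"
    using assms by (intro compact_continuous_image) auto
  then obtain B where "\<And>x. x \<in> sphere 0 1 \<Longrightarrow> norm (\<phi> x) \<le> B"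
    by (metis bounded_iff compact_imp_bounded imageI)
  then show ?thesis
    using continuous_circle_measurable[OF assms]
    by (intro circle.integrable_const_bound[where B=B]) auto
qed

lemma circle_integral_eq:
  fixes \<phi> :: "complex \<Rightarrow> 'a::euclidean_space"
  assumes "continuous_on (sphere 0 1) \<phi>"
  shows "(LINT \<xi>|circle_measure. \<phi> \<xi>) = (1 / (2 * pi)) *\<^sub>R integral {0..2*pi} (\<lambda>t. \<phi> (cis t))"
proof -
  have c: "continuous_on {0..2*pi} (\<lambda>t. \<phi> (cis t))"
    by (rule continuous_on_compose2[OF assms]) (auto intro!: continuous_intros)
  have "set_integrable lborel {0..2*pi} (\<lambda>t. \<phi> (cis t))"
    unfolding set_integrable_def using c by (intro borel_integrable_compact) auto
  then show ?thesis
    using continuous_circle_measurable[OF assms]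
    by (simp add: circle_measure_integral_lebesgue set_borel_integral_eq_integral)
qed

text \<open>With \<open>w = r * \<xi>\<close> one has \<open>dw = \<i> * w * dt\<close>, so dividing
  the integrand by \<open>w\<close> turns normalized arc length into a contour integral. All uses of
  Cauchy's theorem pass through this.\<close>

lemma circle_integral_contour:
  assumes c: "continuous_on (sphere 0 1) (\<lambda>\<xi>. \<phi> (of_real r * \<xi>))" and "r > 0"
  shows "(LINT \<xi>|circle_measure. \<phi> (of_real r * \<xi>)) =
     contour_integral (circlepath 0 r) (\<lambda>w. \<phi> w / w) / (2 * of_real pi * \<i>)"
proof -
  let ?\<psi> = "\<lambda>\<xi>. \<phi> (of_real r * \<xi>)"
  have "contour_integral (circlepath 0 r) (\<lambda>w. \<phi> w / w) =
      integral {0..1} (\<lambda>t. 2 * of_real pi * \<i> * ?\<psi> (cis (2 * pi * t)))"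
    unfolding contour_integral_integral
  proof (intro integral_cong)
    fix t :: real assume "t \<in> {0..1}"
    then have "vector_derivative (circlepath 0 r) (at t) = 2 * of_real pi * \<i> * of_real r * cis (2 * pi * t)"
      by (simp add: vector_derivative_circlepath cis_conv_exp mult_ac)
    moreover have "circlepath 0 r t = of_real r * cis (2 * pi * t)"
      by (simp add: circlepath cis_conv_exp mult_ac)
    ultimately show "\<phi> (circlepath 0 r t) / circlepath 0 r t * vector_derivative (circlepath 0 r) (at t) =
        2 * of_real pi * \<i> * ?\<psi> (cis (2 * pi * t))"
      using assms by simp
  qed
  also have "\<dots> = 2 * of_real pi * \<i> * integral {0..1} (\<lambda>t. ?\<psi> (cis (2 * pi * t)))"
    by simp
  also have "integral {0..1} (\<lambda>t. ?\<psi> (cis (2 * pi * t))) =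
      (1 / (2 * pi)) *\<^sub>R integral {0..2*pi} (\<lambda>t. ?\<psi> (cis t))"
  proof -
    have "continuous_on {0..2*pi} (\<lambda>t. ?\<psi> (cis t))"
      by (rule continuous_on_compose2[OF c]) (auto intro!: continuous_intros)
    then have "((\<lambda>t. ?\<psi> (cis t)) has_integral integral {0..2*pi} (\<lambda>t. ?\<psi> (cis t))) (cbox 0 (2*pi))"
      by (auto intro!: integrable_integral integrable_continuous_real)
    from has_integral_affinity[OF this, of "2*pi" 0]
    have "((\<lambda>t. ?\<psi> (cis (2*pi*t))) has_integral (1 / (2 * pi)) *\<^sub>R integral {0..2*pi} (\<lambda>t. ?\<psi> (cis t)))
        ((\<lambda>x. (1/(2*pi)) *\<^sub>R x + -((1/(2*pi)) *\<^sub>R 0)) ` cbox 0 (2*pi))"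
      by (simp add: scaleR_conv_of_real)
    moreover have "(\<lambda>x. (1/(2*pi)) *\<^sub>R x + -((1/(2*pi)) *\<^sub>R 0)) ` cbox 0 (2*pi) = {0..1}"
      by (simp add: image_divide_atLeastAtMost)
    ultimately show ?thesis by (simp add: integral_unique)
  qed
  finally show ?thesis
    by (simp add: circle_integral_eq[OF c] scaleR_conv_of_real)
qed

text \<open>The shifted interval of angles sticks out beyond \<open>2 * pi\<close>; periodicity of
  \<open>cis\<close> moves the overhang back to \<open>{0..s}\<close>.\<close>

lemma circle_integral_rotate:
  fixes \<phi> :: "complex \<Rightarrow> 'a::euclidean_space"
  assumes c: "continuous_on (sphere 0 1) \<phi>" and "norm \<omega> = 1"
  shows "(LINT \<xi>|circle_measure. \<phi> (\<omega> * \<xi>)) = (LINT \<xi>|circle_measure. \<phi> \<xi>)"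
proof -
  obtain s where s: "\<omega> = cis s" "0 \<le> s" "s < 2*pi"
    using Arg2pi[of \<omega>] assms(2) by (intro that[of "Arg2pi \<omega>"]) (auto simp: cis_conv_exp is_Arg_def)
  have cc: "continuous_on A (\<lambda>t. \<phi> (cis (t + u)))" for A u
    by (rule continuous_on_compose2[OF c]) (auto intro!: continuous_intros)
  have c': "continuous_on A (\<lambda>t. \<phi> (cis t))" for A
    using cc[of A 0] by simp
  have "(LINT \<xi>|circle_measure. \<phi> (\<omega> * \<xi>)) = (1 / (2 * pi)) *\<^sub>R integral {0..2*pi} (\<lambda>t. \<phi> (cis (t + s)))"
    by (subst circle_integral_eq)
       (auto simp: s cis_mult add.commute norm_mult intro!: continuous_intros continuous_on_compose2[OF c])
  also have "integral {0..2*pi} (\<lambda>t. \<phi> (cis (t + s))) = integral {s..2*pi+s} (\<lambda>t. \<phi> (cis t))"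
    using integral_shift_real_ivl[of s s "2*pi+s" "\<lambda>t. \<phi> (cis t)"] by simp
  also have "\<dots> = integral {s..2*pi} (\<lambda>t. \<phi> (cis t)) + integral {2*pi..2*pi+s} (\<lambda>t. \<phi> (cis t))"
    using s by (intro Henstock_Kurzweil_Integration.integral_combine[symmetric] integrable_continuous_real c') auto
  also have "integral {2*pi..2*pi+s} (\<lambda>t. \<phi> (cis t)) = integral {0..s} (\<lambda>t. \<phi> (cis (t + 2*pi)))"
    using integral_shift_real_ivl[of "2*pi" "2*pi" "2*pi+s" "\<lambda>t. \<phi> (cis t)"] by simp
  also have "\<dots> = integral {0..s} (\<lambda>t. \<phi> (cis t))"
    by (simp add: cis_mult[symmetric])
  also have "integral {s..2*pi} (\<lambda>t. \<phi> (cis t)) + integral {0..s} (\<lambda>t. \<phi> (cis t)) = integral {0..2*pi} (\<lambda>t. \<phi> (cis t))"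
    using s by (subst add.commute, intro Henstock_Kurzweil_Integration.integral_combine integrable_continuous_real c') auto
  finally show ?thesis by (simp add: circle_integral_eq[OF c])
qed

text \<open>For \<open>k \<noteq> 0\<close> the contour integrand has the primitive
  \<open>w powi k / k\<close> on the punctured plane.\<close>

lemma circle_integral_powi: "(LINT \<xi>|circle_measure. \<xi> powi k) = (if k = 0 then 1 else 0)"
proof (cases "k = 0")
  case False
  have eq: "(LINT \<xi>|circle_measure. \<xi> powi k) = contour_integral (circlepath 0 1) (\<lambda>w. w powi k / w) / (2 * of_real pi * \<i>)"
    using circle_integral_contour[where \<phi>="\<lambda>w. w powi k" and r=1] by (fastforce intro!: continuous_intros)
  have "((\<lambda>w. w powi k / w) has_contour_integral 0) (circlepath 0 1)"
  proof (rule Cauchy_theorem_primitive[where S="-{0}" and f="\<lambda>w. w powi k / of_int k"])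
    show "((\<lambda>w. w powi k / of_int k) has_field_derivative x powi k / x) (at x within - {0})" if "x \<in> -{0}" for x
      using that False
      by (auto intro!: derivative_eq_intros simp: power_int_diff field_simps)
  qed auto
  then show ?thesis using eq False by (simp add: contour_integral_unique)
qed auto

section \<open>Means of order p\<close>

text \<open>Young's inequality for the exponents \<open>p\<close> and \<open>p / (p - 1)\<close>,
  cleared of denominators so that \<open>p = 1\<close> is covered. It says that
  \<open>u powr p\<close> lies above its tangent at \<open>v\<close>, and it stands in for Hoelder's
  inequality below.\<close>

lemma young_powr:
  fixes u v p :: real
  assumes "1 \<le> p" "0 \<le> u" "0 \<le> v"
  shows "p * (u * v powr (p - 1)) \<le> u powr p + (p - 1) * v powr p"
proof (cases "u = 0 \<or> v = 0")
  case True then show ?thesis using assms by auto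
next
  case False
  then have pos: "u > 0" "v > 0" using assms by auto
  have "(u powr p) powr (1/p) * (v powr p) powr (1 - 1/p) \<le> (1/p) * u powr p + (1 - 1/p) * v powr p"
    using assms pos by (intro Youngs_inequality_0) (auto simp: divide_simps)
  also have "(u powr p) powr (1/p) * (v powr p) powr (1 - 1/p) = u * v powr (p - 1)"
    using assms pos by (simp add: powr_powr right_diff_distrib)
  finally show ?thesis using assms by (simp add: field_simps)
qed

text \<open>Both values are compared with the tangent at the mean \<open>?m\<close>; averaged, the
  linear terms recombine to \<open>p * ?m powr p\<close>.\<close>

lemma powr_convex_ge_0:
  fixes a b \<alpha> \<beta> p :: real
  assumes "1 \<le> p" "0 \<le> a" "0 \<le> b" "0 \<le> \<alpha>" "0 \<le> \<beta>" "\<alpha> + \<beta> = 1"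
  shows "(\<alpha> * a + \<beta> * b) powr p \<le> \<alpha> * a powr p + \<beta> * b powr p"
proof -
  let ?m = "\<alpha> * a + \<beta> * b"
  have m0: "?m \<ge> 0" using assms by simp
  show ?thesis
  proof (cases "?m = 0")
    case True
    then show ?thesis using assms by simp
  next
    case False
    then have m: "?m > 0" using m0 by linarith
    have eq: "?m * ?m powr (p-1) = ?m powr p" using m by (simp add: powr_diff)
    have "p * (a * ?m powr (p-1)) \<le> a powr p + (p-1) * ?m powr p"
         "p * (b * ?m powr (p-1)) \<le> b powr p + (p-1) * ?m powr p"
      using assms m0 by (intro young_powr; simp)+
    then have "\<alpha> * (p * (a * ?m powr (p-1))) + \<beta> * (p * (b * ?m powr (p-1)))
        \<le> \<alpha> * (a powr p + (p-1) * ?m powr p) + \<beta> * (b powr p + (p-1) * ?m powr p)"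
      using assms by (intro add_mono mult_left_mono) auto
    also have "\<dots> = \<alpha> * a powr p + \<beta> * b powr p + (\<alpha> + \<beta>) * ((p-1) * ?m powr p)"
      by (simp add: algebra_simps)
    also have "\<alpha> * (p * (a * ?m powr (p-1))) + \<beta> * (p * (b * ?m powr (p-1))) = p * (?m * ?m powr (p-1))"
      by (simp add: algebra_simps)
    finally have "p * ?m powr p \<le> \<alpha> * a powr p + \<beta> * b powr p + (p - 1) * ?m powr p"
      using assms eq by simp
    then show ?thesis by (simp add: algebra_simps)
  qed
qed

definition Lnorm :: "real \<Rightarrow> 'a measure \<Rightarrow> ('a \<Rightarrow> complex) \<Rightarrow> real" where
  "Lnorm p M f = (LINT x|M. norm (f x) powr p) powr (1/p)"

lemma Lnorm_nonneg [simp]: "Lnorm p M f \<ge> 0"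
  by (simp add: Lnorm_def)

lemma Lnorm_powr: "p > 0 \<Longrightarrow> Lnorm p M f powr p = (LINT x|M. norm (f x) powr p)"
  by (simp add: Lnorm_def powr_powr)

lemma powr_integrable_add:
  fixes f g :: "'a \<Rightarrow> complex"
  assumes "1 \<le> p" and [measurable]: "f \<in> borel_measurable M" "g \<in> borel_measurable M"
    and "integrable M (\<lambda>x. norm (f x) powr p)" "integrable M (\<lambda>x. norm (g x) powr p)"
  shows "integrable M (\<lambda>x. norm (f x + g x) powr p)"
proof (rule Bochner_Integration.integrable_bound)
  show "integrable M (\<lambda>x. 2 powr p * (1/2 * norm (f x) powr p + 1/2 * norm (g x) powr p))"
    using assms by simp
  show "AE x in M. norm (norm (f x + g x) powr p) \<le> norm (2 powr p * (1/2 * norm (f x) powr p + 1/2 * norm (g x) powr p))"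
  proof (rule AE_I2)
    fix x
    have "norm (f x + g x) powr p \<le> (2 * (1/2 * norm (f x) + 1/2 * norm (g x))) powr p"
      using assms norm_triangle_ineq[of "f x" "g x"] by (intro powr_mono2) auto
    also have "\<dots> = 2 powr p * (1/2 * norm (f x) + 1/2 * norm (g x)) powr p"
      by (rule powr_mult)
    also have "\<dots> \<le> 2 powr p * (1/2 * norm (f x) powr p + 1/2 * norm (g x) powr p)"
      using assms by (intro mult_left_mono powr_convex_ge_0) auto
    finally show "norm (norm (f x + g x) powr p) \<le> norm (2 powr p * (1/2 * norm (f x) powr p + 1/2 * norm (g x) powr p))"
      by simp
  qed
qed measurable

text \<open>Minkowski's inequality by convexity: \<open>f / a\<close> and \<open>g / b\<close> have
  norm at most one and are averaged with the weights \<open>a / (a + b)\<close> and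
  \<open>b / (a + b)\<close>.\<close>

lemma Lnorm_triangle:
  fixes f g :: "'a \<Rightarrow> complex"
  assumes p: "1 \<le> p" and [measurable]: "f \<in> borel_measurable M" "g \<in> borel_measurable M"
    and fi: "integrable M (\<lambda>x. norm (f x) powr p)" and gi: "integrable M (\<lambda>x. norm (g x) powr p)"
  shows "Lnorm p M (\<lambda>x. f x + g x) \<le> Lnorm p M f + Lnorm p M g"
proof (rule field_le_epsilon)
  fix e :: real assume e: "e > 0"
  \<comment> \<open>The extra \<open>e / 2\<close> keeps the normalizing constants positive when a
    norm vanishes.\<close>
  define a where "a = Lnorm p M f + e/2"
  define b where "b = Lnorm p M g + e/2"
  have pos: "a > 0" "b > 0" "p > 0"
    using e p unfolding a_def b_def by (auto intro: add_nonneg_pos)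
  have le: "(LINT x|M. norm (f x) powr p) \<le> a powr p" "(LINT x|M. norm (g x) powr p) \<le> b powr p"
    unfolding a_def b_def using pos e by (auto simp: Lnorm_powr[symmetric] intro!: powr_mono2)
  have "(LINT x|M. norm (f x + g x) powr p) \<le>
     (LINT x|M. (a+b) powr p * (a/(a+b) * (norm (f x) powr p / a powr p) + b/(a+b) * (norm (g x) powr p / b powr p)))"
  proof (rule integral_mono)
    show "integrable M (\<lambda>x. norm (f x + g x) powr p)"
      using assms by (intro powr_integrable_add) auto
    show "integrable M (\<lambda>x. (a+b) powr p * (a/(a+b) * (norm (f x) powr p / a powr p) + b/(a+b) * (norm (g x) powr p / b powr p)))"
      using fi gi by simp
    fix x
    have eq: "(a+b) * (a/(a+b) * (norm (f x)/a) + b/(a+b) * (norm (g x)/b)) = norm (f x) + norm (g x)"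
    proof -
      have "a + b \<noteq> 0" using pos by simp
      then show ?thesis using pos by (simp add: distrib_left mult.assoc[symmetric])
    qed
    have "norm (f x + g x) powr p \<le> ((a+b) * (a/(a+b) * (norm (f x)/a) + b/(a+b) * (norm (g x)/b))) powr p"
      unfolding eq using pos by (intro powr_mono2 norm_triangle_ineq) auto
    also have "\<dots> = (a+b) powr p * (a/(a+b) * (norm (f x)/a) + b/(a+b) * (norm (g x)/b)) powr p"
      using pos by (subst powr_mult) auto
    also have "\<dots> \<le> (a+b) powr p * (a/(a+b) * (norm (f x)/a) powr p + b/(a+b) * (norm (g x)/b) powr p)"
      using pos p by (intro mult_left_mono powr_convex_ge_0) (auto simp: add_divide_distrib[symmetric])
    finally show "norm (f x + g x) powr p \<le> (a+b) powr p * (a/(a+b) * (norm (f x) powr p / a powr p) + b/(a+b) * (norm (g x) powr p / b powr p))"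
      using pos by (simp add: powr_divide)
  qed
  also have "\<dots> = (a+b) powr p * (a/(a+b) * ((LINT x|M. norm (f x) powr p) / a powr p) + b/(a+b) * ((LINT x|M. norm (g x) powr p) / b powr p))"
    using fi gi by simp
  also have "\<dots> \<le> (a+b) powr p * (a/(a+b) * 1 + b/(a+b) * 1)"
    using pos le by (intro mult_left_mono add_mono) auto
  also have "\<dots> = (a+b) powr p"
    using pos by (simp add: add_divide_distrib[symmetric])
  finally have "(LINT x|M. norm (f x + g x) powr p) powr (1/p) \<le> ((a+b) powr p) powr (1/p)"
    using pos by (intro powr_mono2) auto
  then show "Lnorm p M (\<lambda>x. f x + g x) \<le> Lnorm p M f + Lnorm p M g + e"
    using pos by (simp add: Lnorm_def[of p M "\<lambda>x. f x + g x"] powr_powr a_def b_def)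
qed

lemma Lnorm_cmult: "0 < p \<Longrightarrow> Lnorm p M (\<lambda>x. c * f x) = norm c * Lnorm p M f"
  by (simp add: Lnorm_def norm_mult powr_mult powr_powr)

text \<open>The tangent inequality at the weighted mean \<open>s\<close> is integrated against
  \<open>w\<close>. The weight is not normalized, which leaves the power \<open>p - 1\<close> of its
  mass in the bound.\<close>

lemma weighted_jensen_powr:
  fixes F :: "'a \<Rightarrow> complex" and w :: "'a \<Rightarrow> real"
  assumes p: "1 \<le> p" and "\<And>x. x \<in> space M \<Longrightarrow> 0 \<le> w x"
    and wi: "integrable M w" and Fwi: "integrable M (\<lambda>x. norm (F x) * w x)"
    and Fpi: "integrable M (\<lambda>x. norm (F x) powr p * w x)"
    and W: "(LINT x|M. w x) > 0"
  shows "(LINT x|M. norm (F x) * w x) powr p \<le>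
     (LINT x|M. w x) powr (p - 1) * (LINT x|M. norm (F x) powr p * w x)"
proof -
  define I where "I = (LINT x|M. norm (F x) * w x)"
  define W where "W = (LINT x|M. w x)"
  define J where "J = (LINT x|M. norm (F x) powr p * w x)"
  define s where "s = I / W"
  have I0: "I \<ge> 0" and J0: "J \<ge> 0" and Wpos: "W > 0"
    unfolding I_def J_def W_def using assms by (auto intro!: integral_nonneg_AE)
  show ?thesis
  proof (cases "I = 0")
    case True
    then show ?thesis using J0 p unfolding I_def J_def by simp
  next
    case False
    then have s: "s > 0" using I0 Wpos by (simp add: s_def)
    have "(LINT x|M. (p * s powr (p-1)) * (norm (F x) * w x)) \<le> (LINT x|M. norm (F x) powr p * w x + ((p-1) * s powr p) * w x)"
    proof (rule integral_mono)
      show "integrable M (\<lambda>x. (p * s powr (p-1)) * (norm (F x) * w x))" using Fwi by simp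
      show "integrable M (\<lambda>x. norm (F x) powr p * w x + ((p-1) * s powr p) * w x)" using Fpi wi by simp
      fix x assume "x \<in> space M"
      then have "p * (norm (F x) * s powr (p-1)) * w x \<le> (norm (F x) powr p + (p-1) * s powr p) * w x"
        using assms s by (intro mult_right_mono young_powr) auto
      then show "(p * s powr (p-1)) * (norm (F x) * w x) \<le> norm (F x) powr p * w x + ((p-1) * s powr p) * w x"
        by (simp add: algebra_simps)
    qed
    also have "\<dots> = J + ((p-1) * s powr p) * W"
      unfolding J_def W_def using Fpi wi by simp
    also have "(LINT x|M. (p * s powr (p-1)) * (norm (F x) * w x)) = p * s powr (p-1) * I"
      unfolding I_def by simp
    also have "p * s powr (p-1) * I = p * (s powr p * W)"
    proof -
      have "s powr (p-1) * I = s powr (p-1) * s * W" using Wpos by (simp add: s_def)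
      also have "s powr (p-1) * s = s powr p" using s by (simp add: powr_diff)
      finally show ?thesis by simp
    qed
    finally have "s powr p * W \<le> J" by (simp add: algebra_simps)
    then have "W powr (p-1) * (s powr p * W) \<le> W powr (p-1) * J"
      by (intro mult_left_mono) auto
    moreover have "W powr (p-1) * (s powr p * W) = I powr p"
      using s Wpos I0 by (simp add: s_def powr_diff powr_divide)
    ultimately show ?thesis unfolding I_def J_def W_def by simp
  qed
qed

lemma continuous_on_norm_powr:
  fixes f :: "'a::topological_space \<Rightarrow> 'b::real_normed_vector"
  assumes "continuous_on S f" "p > 0"
  shows "continuous_on S (\<lambda>x. norm (f x) powr p)"
  using assms by (intro continuous_on_powr' continuous_intros) auto

lemma circle_mean_tendsto:
  fixes f :: "nat \<Rightarrow> complex \<Rightarrow> complex"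
  assumes p: "p > 0" and c: "\<And>n. continuous_on (sphere 0 1) (f n)"
    and u: "uniform_limit (sphere 0 1) f l sequentially"
  shows "(\<lambda>n. LINT \<xi>|circle_measure. norm (f n \<xi>) powr p) \<longlonglongrightarrow> (LINT \<xi>|circle_measure. norm (l \<xi>) powr p)"
proof -
  have cl: "continuous_on (sphere 0 1) l"
    using c by (intro uniform_limit_theorem[OF _ u]) auto
  then have "compact (l ` sphere 0 1)"
    by (intro compact_continuous_image) auto
  then obtain B where B: "\<And>x. x \<in> sphere 0 1 \<Longrightarrow> norm (l x) \<le> B"
    by (metis bounded_iff compact_imp_bounded imageI)
  have "eventually (\<lambda>n. \<forall>x\<in>sphere 0 1. dist (f n x) (l x) < 1) sequentially"
    using u by (auto simp: uniform_limit_iff)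
  then obtain N where N: "\<And>n x. n \<ge> N \<Longrightarrow> x \<in> sphere 0 1 \<Longrightarrow> dist (f n x) (l x) < 1"
    unfolding eventually_sequentially by blast
  \<comment> \<open>From index \<open>N\<close> on, \<open>f n\<close> is within 1 of
    \<open>l\<close>, so the constant \<open>(B + 1) powr p\<close> dominates the shifted
    sequence.\<close>
  have "(\<lambda>n. LINT \<xi>|circle_measure. norm (f (n + N) \<xi>) powr p) \<longlonglongrightarrow> (LINT \<xi>|circle_measure. norm (l \<xi>) powr p)"
  proof (rule integral_dominated_convergence[where w="\<lambda>_. (B+1) powr p"])
    show "AE x in circle_measure. (\<lambda>n. norm (f (n + N) x) powr p) \<longlonglongrightarrow> norm (l x) powr p"
    proof (rule AE_I2)
      fix x assume "x \<in> space circle_measure"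
      then have "(\<lambda>n. f n x) \<longlonglongrightarrow> l x" using u by (auto intro: tendsto_uniform_limitI)
      then have "(\<lambda>n. f (n + N) x) \<longlonglongrightarrow> l x" by (rule LIMSEQ_ignore_initial_segment)
      then show "(\<lambda>n. norm (f (n + N) x) powr p) \<longlonglongrightarrow> norm (l x) powr p"
        using p by (intro tendsto_powr' tendsto_norm) auto
    qed
    show "AE x in circle_measure. norm (norm (f (n + N) x) powr p) \<le> (B + 1) powr p" for n
    proof (rule AE_I2)
      fix x assume x: "x \<in> space circle_measure"
      then have "norm (f (n+N) x) \<le> B + 1"
        using B[of x] N[of "n+N" x] norm_triangle_ineq2[of "f (n+N) x" "l x"] by (auto simp: dist_norm)
      then show "norm (norm (f (n + N) x) powr p) \<le> (B + 1) powr p"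
        using p by (auto intro!: powr_mono2)
    qed
    show "(\<lambda>x. norm (l x) powr p) \<in> borel_measurable circle_measure"
      using cl p by (intro continuous_circle_measurable continuous_on_norm_powr)
    show "(\<lambda>x. norm (f (n + N) x) powr p) \<in> borel_measurable circle_measure" for n
      using c p by (intro continuous_circle_measurable continuous_on_norm_powr)
  qed auto
  then show ?thesis by (rule LIMSEQ_offset)
qed

section \<open>Hardy spaces\<close>

definition slice_norm :: "real \<Rightarrow> (complex \<Rightarrow> complex) \<Rightarrow> real \<Rightarrow> real" where
  "slice_norm p f r = Lnorm p circle_measure (\<lambda>\<xi>. f (of_real r * \<xi>))"

lemma slice_norm_eq: "slice_norm p f r = hardy_mean p f r powr (1/p)"
  by (simp add: slice_norm_def Lnorm_def hardy_mean_def)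

lemma slice_norm_powr: "p > 0 \<Longrightarrow> slice_norm p f r powr p = hardy_mean p f r"
  by (simp add: slice_norm_def Lnorm_powr hardy_mean_def)

lemma slice_norm_nonneg [simp]: "0 \<le> slice_norm p f r"
  by (simp add: slice_norm_def)

lemma hardy_mean_nonneg [simp]: "0 \<le> hardy_mean p f r"
  by (simp add: hardy_mean_def)

lemma continuous_on_slice:
  fixes f :: "complex \<Rightarrow> complex"
  assumes "continuous_on (ball 0 1) f" "0 \<le> r" "r < 1"
  shows "continuous_on (sphere 0 1) (\<lambda>\<xi>. f (of_real r * \<xi>))"
  by (rule continuous_on_compose2[OF assms(1)]) (use assms in \<open>auto intro!: continuous_intros simp: norm_mult\<close>)

text \<open>Pairing \<open>f (z \<xi>)\<close> with the dual function of \<open>\<xi> \<mapsto> f (s \<xi>)\<close> gives an analytic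
  function of \<open>z\<close>, to which the maximum principle applies.\<close>

lemma hardy_mean_mono_poly:
  fixes b :: "nat \<Rightarrow> complex" and n :: nat
  defines "f \<equiv> \<lambda>z. \<Sum>k<n. b k * z ^ k"
  assumes p: "1 \<le> p" and sr: "0 \<le> s" "s < r"
  shows "hardy_mean p f s \<le> hardy_mean p f r"
proof -
  have cf: "continuous_on A (\<lambda>\<xi>. f (z * \<xi>))" for A z
    unfolding f_def by (intro continuous_intros)
  \<comment> \<open>The norming function of the slice. As \<open>0 powr x = 0\<close>, it vanishes
    at zeros of the slice, and for \<open>p = 1\<close> it may be discontinuous there; hence it is
    treated below as bounded and measurable only.\<close>
  define h where "h = (\<lambda>\<xi>. cnj (f (of_real s * \<xi>)) * of_real (norm (f (of_real s * \<xi>)) powr (p - 2)))"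
  have fh: "f (of_real s * \<xi>) * h \<xi> = of_real (norm (f (of_real s * \<xi>)) powr p)" for \<xi>
  proof (cases "f (of_real s * \<xi>) = 0")
    case False
    have "f (of_real s * \<xi>) * h \<xi> = of_real ((norm (f (of_real s * \<xi>)))\<^sup>2 * norm (f (of_real s * \<xi>)) powr (p - 2))"
      by (simp add: h_def mult.assoc[symmetric] flip: complex_norm_square)
    also have "(norm (f (of_real s * \<xi>)))\<^sup>2 * norm (f (of_real s * \<xi>)) powr (p - 2) = norm (f (of_real s * \<xi>)) powr p"
      using False by (simp add: powr_diff powr_numeral)
    finally show ?thesis .
  qed (simp add: h_def)
  have normh: "norm (h \<xi>) = norm (f (of_real s * \<xi>)) powr (p - 1)" for \<xi>
  proof (cases "f (of_real s * \<xi>) = 0")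
    case False
    have "norm (h \<xi>) = norm (f (of_real s * \<xi>)) powr 1 * norm (f (of_real s * \<xi>)) powr (p - 2)"
      using False by (simp add: h_def norm_mult)
    then show ?thesis unfolding powr_add[symmetric] by simp
  qed (simp add: h_def)
  have hm: "h \<in> borel_measurable circle_measure"
  proof -
    have [measurable]: "(\<lambda>\<xi>. f (of_real s * \<xi>)) \<in> borel_measurable circle_measure"
      by (intro continuous_circle_measurable cf)
    have [measurable]: "(\<lambda>\<xi>. cnj (f (of_real s * \<xi>))) \<in> borel_measurable circle_measure"
      by (intro continuous_circle_measurable continuous_on_cnj cf)
    show ?thesis unfolding h_def by measurable
  qed
  obtain B where B: "\<And>\<xi>. \<xi> \<in> sphere 0 1 \<Longrightarrow> norm (f (of_real s * \<xi>)) \<le> B"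
    using compact_continuous_image[OF cf, of "sphere 0 1" "of_real s"]
    by (metis bounded_iff compact_imp_bounded compact_sphere imageI)
  have hb: "norm (h \<xi>) \<le> B powr (p - 1)" if "\<xi> \<in> sphere 0 1" for \<xi>
    unfolding normh using that B p by (intro powr_mono2) auto
  have hi: "integrable circle_measure (\<lambda>\<xi>. \<phi> \<xi> * h \<xi>)" if "continuous_on (sphere 0 1) \<phi>" for \<phi>
  proof (rule Bochner_Integration.integrable_bound)
    show "integrable circle_measure (\<lambda>\<xi>. B powr (p - 1) * norm (\<phi> \<xi>))"
      using that by (intro continuous_circle_integrable continuous_intros)
    show "(\<lambda>\<xi>. \<phi> \<xi> * h \<xi>) \<in> borel_measurable circle_measure"
      using continuous_circle_measurable[OF that] hm by measurable
    show "AE x in circle_measure. norm (\<phi> x * h x) \<le> norm (B powr (p - 1) * norm (\<phi> x))"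
      using hb by (intro AE_I2) (simp add: norm_mult mult.commute mult_left_mono)
  qed
  define c where "c k = (LINT \<xi>|circle_measure. \<xi> ^ k * h \<xi>)" for k
  define G where "G z = (\<Sum>k<n. b k * c k * z ^ k)" for z
  have G: "G z = (LINT \<xi>|circle_measure. f (z * \<xi>) * h \<xi>)" for z
  proof -
    have "(LINT \<xi>|circle_measure. f (z * \<xi>) * h \<xi>) = (LINT \<xi>|circle_measure. (\<Sum>k<n. (b k * z ^ k) * (\<xi> ^ k * h \<xi>)))"
      by (simp add: f_def power_mult_distrib sum_distrib_left sum_distrib_right mult_ac)
    also have "\<dots> = (\<Sum>k<n. (b k * z ^ k) * c k)"
      unfolding c_def
      by (subst Bochner_Integration.integral_sum) (auto intro!: hi continuous_intros)
    finally show ?thesis by (simp add: G_def mult_ac)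
  qed
  have fp: "integrable circle_measure (\<lambda>\<xi>. norm (f (z * \<xi>)) powr p)" for z
    using p by (intro continuous_circle_integrable continuous_on_norm_powr cf) auto
  \<comment> \<open>Young's inequality separates the two factors, and by rotation invariance the
    mean of \<open>f (z * \<xi>)\<close> depends on \<open>norm z\<close> only, so the bound is the
    same on the whole circle of radius \<open>r\<close>.\<close>
  have bound: "norm (G z) \<le> (hardy_mean p f r + (p - 1) * hardy_mean p f s) / p" if z: "norm z = r" for z
  proof -
    obtain \<omega> where \<omega>: "norm \<omega> = 1" "z = of_real r * \<omega>"
      using z sr by (intro that[of "z / of_real r"]) (auto simp: norm_divide)
    have "norm (G z) \<le> (LINT \<xi>|circle_measure. norm (f (z * \<xi>) * h \<xi>))"
      unfolding G by (rule integral_norm_bound)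
    also have "\<dots> \<le> (LINT \<xi>|circle_measure. (norm (f (z * \<xi>)) powr p + (p - 1) * norm (f (of_real s * \<xi>)) powr p) / p)"
    proof (rule integral_mono)
      show "integrable circle_measure (\<lambda>\<xi>. norm (f (z * \<xi>) * h \<xi>))"
        by (intro integrable_norm hi cf)
      show "integrable circle_measure (\<lambda>\<xi>. (norm (f (z * \<xi>)) powr p + (p - 1) * norm (f (of_real s * \<xi>)) powr p) / p)"
        using fp by simp
      fix \<xi>
      show "norm (f (z * \<xi>) * h \<xi>) \<le> (norm (f (z * \<xi>)) powr p + (p - 1) * norm (f (of_real s * \<xi>)) powr p) / p"
        using young_powr[OF p, of "norm (f (z * \<xi>))" "norm (f (of_real s * \<xi>))"] p
        by (simp add: norm_mult normh field_simps)
    qed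
    also have "\<dots> = ((LINT \<xi>|circle_measure. norm (f (z * \<xi>)) powr p) + (p - 1) * hardy_mean p f s) / p"
      using fp by (simp add: hardy_mean_def)
    also have "(LINT \<xi>|circle_measure. norm (f (z * \<xi>)) powr p) = (LINT \<xi>|circle_measure. norm (f (of_real r * (\<omega> * \<xi>))) powr p)"
      by (simp add: \<omega> mult_ac)
    also have "\<dots> = hardy_mean p f r"
      unfolding hardy_mean_def using p \<omega>
      by (intro circle_integral_rotate[where \<phi>="\<lambda>\<xi>. norm (f (of_real r * \<xi>)) powr p"] continuous_on_norm_powr cf) auto
    finally show ?thesis .
  qed
  have "norm (G (of_real s)) \<le> (hardy_mean p f r + (p - 1) * hardy_mean p f s) / p"
  proof (rule maximum_modulus_frontier[where S="ball 0 r" and f=G])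
    show "G holomorphic_on interior (ball 0 r)" unfolding G_def by (intro holomorphic_intros)
    show "continuous_on (closure (ball 0 r)) G" unfolding G_def by (intro continuous_intros)
    show "norm (G z) \<le> (hardy_mean p f r + (p - 1) * hardy_mean p f s) / p" if "z \<in> frontier (ball 0 r)" for z
      using that sr by (intro bound) (auto simp: frontier_ball)
  qed (use sr in auto)
  \<comment> \<open>At \<open>z = s\<close> the pairing is the mean itself. It thus appears on both
    sides, and its multiple \<open>(p - 1) / p\<close> is absorbed.\<close>
  also have "G (of_real s) = of_real (hardy_mean p f s)"
    unfolding G fh hardy_mean_def by simp
  finally have "hardy_mean p f s \<le> (hardy_mean p f r + (p - 1) * hardy_mean p f s) / p" by simp
  then show ?thesis using p by (simp add: field_simps)
qed

lemma taylor_uniform_limit: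
  assumes f: "f holomorphic_on ball 0 1" and r: "r < 1"
  shows "uniform_limit (cball 0 r) (\<lambda>n z. \<Sum>k<n. (deriv ^^ k) f 0 / fact k * z ^ k) f sequentially"
proof -
  let ?a = "\<lambda>k. (deriv ^^ k) f 0 / fact k"
  have s: "(\<lambda>k. ?a k * z ^ k) sums f z" if "z \<in> ball 0 1" for z
    using holomorphic_power_series[OF f that] by simp
  have "conv_radius ?a \<ge> 1"
  proof (rule conv_radius_geI_ex)
    fix q :: real assume "0 < q" "ereal q < 1"
    then show "\<exists>z. norm z = q \<and> summable (\<lambda>n. ?a n * z ^ n)"
      using s[of "of_real q"] by (intro exI[of _ "of_real q"]) (auto simp: sums_iff)
  qed
  moreover have "ereal r < 1" using r by (simp add: one_ereal_def)
  ultimately have "ereal r < conv_radius ?a" by order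
  from powser_uniform_limit[OF this, of 0]
  have "uniform_limit (cball 0 r) (\<lambda>n z. \<Sum>k<n. ?a k * z ^ k) (\<lambda>z. \<Sum>k. ?a k * z ^ k) sequentially"
    by simp
  then show ?thesis
    by (rule uniform_limit_cong'[THEN iffD1, rotated 2]) (use s r in \<open>auto simp: sums_iff\<close>)
qed

lemma hardy_mean_tendsto:
  assumes p: "p > 0" and r: "0 \<le> r" "r < 1"
    and c: "\<And>n. continuous_on (ball 0 1) (f n)"
    and u: "uniform_limit (cball 0 r) f l sequentially"
  shows "(\<lambda>n. hardy_mean p (f n) r) \<longlonglongrightarrow> hardy_mean p l r"
  unfolding hardy_mean_def
proof (rule circle_mean_tendsto[OF p])
  show "continuous_on (sphere 0 1) (\<lambda>\<xi>. f n (of_real r * \<xi>))" for n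
    by (intro continuous_on_slice c r)
  show "uniform_limit (sphere 0 1) (\<lambda>n \<xi>. f n (of_real r * \<xi>)) (\<lambda>\<xi>. l (of_real r * \<xi>)) sequentially"
    by (rule uniform_limit_compose'[OF u]) (use r in \<open>auto simp: norm_mult\<close>)
qed

lemma hardy_mean_mono:
  assumes f: "f holomorphic_on ball 0 1" and p: "1 \<le> p" and "0 \<le> s" "s \<le> r" "r < 1"
  shows "hardy_mean p f s \<le> hardy_mean p f r"
proof (cases "s = r")
  case False
  let ?P = "\<lambda>n z. \<Sum>k<n. (deriv ^^ k) f 0 / fact k * z ^ k"
  have "hardy_mean p (?P n) s \<le> hardy_mean p (?P n) r" for n
    using False assms by (intro hardy_mean_mono_poly) auto
  moreover
  have "(\<lambda>n. hardy_mean p (?P n) t) \<longlonglongrightarrow> hardy_mean p f t" if "0 \<le> t" "t < 1" for t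
    using that p by (intro hardy_mean_tendsto taylor_uniform_limit f continuous_intros) auto
  ultimately show ?thesis
    using assms
    by (intro LIMSEQ_le[of "\<lambda>n. hardy_mean p (?P n) s" _ "\<lambda>n. hardy_mean p (?P n) r"] exI[of _ 0]) auto
qed simp

lemma hardy_mean_tendsto_Sup:
  assumes f: "f holomorphic_on ball 0 1" and p: "1 \<le> p"
    and K: "\<And>r. 0 \<le> r \<Longrightarrow> r < 1 \<Longrightarrow> hardy_mean p f r \<le> K"
  shows "(hardy_mean p f \<longlongrightarrow> (SUP r\<in>{0..<1}. hardy_mean p f r)) (at_left 1)"
proof (rule increasing_tendsto)
  let ?S = "SUP r\<in>{0..<1}. hardy_mean p f r"
  have bdd: "bdd_above (hardy_mean p f ` {0..<1})" using K by (intro bdd_aboveI2) auto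
  have ev: "eventually (\<lambda>r. r \<in> {t<..<1}) (at_left (1::real))" if "t < 1" for t
    by (intro eventually_at_leftI[of t]) (use that in auto)
  show "eventually (\<lambda>r. hardy_mean p f r \<le> ?S) (at_left 1)"
    using ev[of 0] by (rule eventually_mono) (auto intro!: cSUP_upper bdd)
  fix x assume "x < ?S"
  then obtain t where t: "0 \<le> t" "t < 1" "x < hardy_mean p f t"
    using bdd by (auto simp: less_cSUP_iff)
  show "eventually (\<lambda>r. x < hardy_mean p f r) (at_left 1)"
    using ev[OF t(2)]
  proof (rule eventually_mono)
    fix r assume "r \<in> {t<..<1}"
    then show "x < hardy_mean p f r" using t hardy_mean_mono[OF f p, of t r] by auto
  qed
qed

lemma hardy_spaceD:
  assumes "f \<in> hardy_space p"
  shows "f holomorphic_on ball 0 1" "\<And>z. norm z \<ge> 1 \<Longrightarrow> f z = 0"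
  using assms by (auto simp: hardy_space_def)

lemma hardy_mean_tendsto_norm:
  assumes "f \<in> hardy_space p" "p > 0"
  shows "(hardy_mean p f \<longlongrightarrow> hardy_norm p f powr p) (at_left 1)"
proof -
  obtain L where L: "(hardy_mean p f \<longlongrightarrow> L) (at_left 1)"
    using assms by (auto simp: hardy_space_def)
  moreover from this have "Lim (at_left 1) (hardy_mean p f) = L"
    by (intro tendsto_Lim) auto
  moreover have "L \<ge> 0" by (rule tendsto_lowerbound[OF L]) auto
  ultimately show ?thesis using assms by (simp add: hardy_norm_def powr_powr)
qed

lemma hardy_norm_nonneg [simp]: "0 \<le> hardy_norm p f"
  by (simp add: hardy_norm_def)

lemma slice_norm_tendsto:
  assumes "f \<in> hardy_space p" "p > 0"
  shows "(slice_norm p f \<longlongrightarrow> hardy_norm p f) (at_left 1)"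
proof -
  have "((\<lambda>r. hardy_mean p f r powr (1/p)) \<longlongrightarrow> (hardy_norm p f powr p) powr (1/p)) (at_left 1)"
    using assms by (intro tendsto_powr' hardy_mean_tendsto_norm tendsto_const) auto
  then show ?thesis using assms by (simp add: slice_norm_eq[abs_def] powr_powr)
qed

lemma hardy_mean_le_norm:
  assumes f: "f \<in> hardy_space p" and p: "1 \<le> p" and r: "0 \<le> r" "r < 1"
  shows "hardy_mean p f r \<le> hardy_norm p f powr p"
proof (rule tendsto_lowerbound[OF hardy_mean_tendsto_norm[OF f]])
  have "eventually (\<lambda>t. t \<in> {r<..<1}) (at_left (1::real))"
    using r by (intro eventually_at_leftI) auto
  then show "eventually (\<lambda>t. hardy_mean p f r \<le> hardy_mean p f t) (at_left 1)"
    by (rule eventually_mono) (use r p in \<open>auto intro!: hardy_mean_mono hardy_spaceD[OF f]\<close>)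
qed (use p in auto)

lemma slice_norm_le:
  assumes "f \<in> hardy_space p" "1 \<le> p" "0 \<le> r" "r < 1"
  shows "slice_norm p f r \<le> hardy_norm p f"
proof -
  have "slice_norm p f r \<le> (hardy_norm p f powr p) powr (1/p)"
    unfolding slice_norm_eq using assms by (intro powr_mono2 hardy_mean_le_norm) auto
  then show ?thesis using assms by (simp add: powr_powr)
qed

text \<open>The means increase with the radius, so boundedness already forces the limit in the
  definition of \<open>hardy_space\<close> to exist. Membership and norm estimates are all derived
  from bounds on single circles by this rule.\<close>

lemma hardy_spaceI:
  assumes f: "f holomorphic_on ball 0 1" "\<And>z. norm z \<ge> 1 \<Longrightarrow> f z = 0" and p: "1 \<le> p"
    and K: "\<And>r. 0 \<le> r \<Longrightarrow> r < 1 \<Longrightarrow> slice_norm p f r \<le> K"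
  shows "f \<in> hardy_space p" "hardy_norm p f \<le> K"
proof -
  have "hardy_mean p f r \<le> K powr p" if "0 \<le> r" "r < 1" for r
    using K[OF that] p by (subst slice_norm_powr[symmetric]) (auto intro!: powr_mono2)
  from hardy_mean_tendsto_Sup[OF f(1) p this]
  show 1: "f \<in> hardy_space p" using f by (auto simp: hardy_space_def)
  show "hardy_norm p f \<le> K"
  proof (rule tendsto_upperbound[OF slice_norm_tendsto[OF 1]])
    have "eventually (\<lambda>t. t \<in> {0<..<1}) (at_left (1::real))"
      by (intro eventually_at_leftI) auto
    then show "eventually (\<lambda>t. slice_norm p f t \<le> K) (at_left 1)"
      by (rule eventually_mono) (use K in auto)
  qed (use p in auto)
qed

lemma slice_norm_add:
  assumes "continuous_on (ball 0 1) f" "continuous_on (ball 0 1) h" "1 \<le> p" "0 \<le> r" "r < 1"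
  shows "slice_norm p (f + h) r \<le> slice_norm p f r + slice_norm p h r"
proof -
  note c = continuous_on_slice[OF assms(1,4,5)] continuous_on_slice[OF assms(2,4,5)]
  show ?thesis unfolding slice_norm_def plus_fun_def
    using assms(3) c
    by (intro Lnorm_triangle continuous_circle_measurable continuous_circle_integrable continuous_on_norm_powr) auto
qed

lemma slice_norm_scale: "0 < p \<Longrightarrow> slice_norm p (scale_fun c f) r = norm c * slice_norm p f r"
  unfolding slice_norm_def scale_fun_def by (rule Lnorm_cmult)

lemma hardy_norm_diff_commute: "hardy_norm p (f - h) = hardy_norm p (h - f)"
  by (simp add: hardy_norm_def hardy_mean_def[abs_def] norm_minus_commute)

lemma hardy_space_continuous: "f \<in> hardy_space p \<Longrightarrow> continuous_on (ball 0 1) f"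
  by (intro holomorphic_on_imp_continuous_on hardy_spaceD)

lemma hardy_space_add:
  assumes f: "f \<in> hardy_space p" and h: "h \<in> hardy_space p" and p: "1 \<le> p"
  shows "f + h \<in> hardy_space p" "hardy_norm p (f + h) \<le> hardy_norm p f + hardy_norm p h"
proof -
  have 1: "(f + h) holomorphic_on ball 0 1"
    unfolding plus_fun_def by (intro holomorphic_intros hardy_spaceD(1)[OF f] hardy_spaceD(1)[OF h])
  have 2: "(f + h) z = 0" if "norm z \<ge> 1" for z
    using that by (simp add: hardy_spaceD(2)[OF f] hardy_spaceD(2)[OF h])
  have 3: "slice_norm p (f + h) r \<le> hardy_norm p f + hardy_norm p h" if "0 \<le> r" "r < 1" for r
    using slice_norm_add[OF hardy_space_continuous[OF f] hardy_space_continuous[OF h] p that]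
      slice_norm_le[OF f p that] slice_norm_le[OF h p that] by linarith
  show "f + h \<in> hardy_space p" "hardy_norm p (f + h) \<le> hardy_norm p f + hardy_norm p h"
    using hardy_spaceI[OF 1 2 p 3] by auto
qed

lemma hardy_space_scale:
  assumes f: "f \<in> hardy_space p" and p: "1 \<le> p"
  shows "scale_fun c f \<in> hardy_space p" "hardy_norm p (scale_fun c f) = norm c * hardy_norm p f"
proof -
  have 1: "scale_fun c f holomorphic_on ball 0 1"
    unfolding scale_fun_def by (intro holomorphic_intros hardy_spaceD(1)[OF f])
  have 2: "scale_fun c f z = 0" if "norm z \<ge> 1" for z
    using that by (simp add: scale_fun_def hardy_spaceD(2)[OF f])
  have 3: "slice_norm p (scale_fun c f) r \<le> norm c * hardy_norm p f" if "0 \<le> r" "r < 1" for r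
    using slice_norm_le[OF f p that] p by (simp add: slice_norm_scale mult_left_mono)
  show in1: "scale_fun c f \<in> hardy_space p"
    using hardy_spaceI[OF 1 2 p 3] by auto
  have "((\<lambda>r. norm c * slice_norm p f r) \<longlongrightarrow> norm c * hardy_norm p f) (at_left 1)"
    using p by (intro tendsto_mult tendsto_const slice_norm_tendsto[OF f]) auto
  moreover have "slice_norm p (scale_fun c f) = (\<lambda>r. norm c * slice_norm p f r)"
    using p by (intro ext slice_norm_scale) auto
  then have "((\<lambda>r. norm c * slice_norm p f r) \<longlongrightarrow> hardy_norm p (scale_fun c f)) (at_left 1)"
    using slice_norm_tendsto[OF in1] p by simp
  ultimately show "hardy_norm p (scale_fun c f) = norm c * hardy_norm p f"
    by (metis tendsto_unique trivial_limit_at_left_real)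
qed

lemma hardy_space_zero: "1 \<le> p \<Longrightarrow> 0 \<in> hardy_space p" "1 \<le> p \<Longrightarrow> hardy_norm p 0 = 0"
proof -
  assume p: "1 \<le> p"
  have "slice_norm p 0 r \<le> 0" for r using p by (simp add: slice_norm_def Lnorm_def)
  from hardy_spaceI[OF _ _ p this] show "0 \<in> hardy_space p" "hardy_norm p 0 = 0"
    using hardy_norm_nonneg[of p 0] by (auto simp: zero_fun_def simp del: hardy_norm_nonneg)
qed

lemma subspace_hardy_space: "1 \<le> p \<Longrightarrow> cfun.subspace (hardy_space p)"
  by (intro cfun.subspaceI hardy_space_zero hardy_space_add hardy_space_scale)

section \<open>Cauchy and Poisson integrals, point evaluations and completeness\<close>

lemma cauchy_circle_integral:
  assumes c: "continuous_on (cball 0 r) f" and h: "f holomorphic_on ball 0 r" and r: "0 < r" "norm a < r"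
  shows "(LINT \<xi>|circle_measure. f (of_real r * \<xi>) * (of_real r * \<xi>) / (of_real r * \<xi> - a) ^ Suc k) =
    (deriv ^^ k) f a / fact k"
proof -
  let ?\<phi> = "\<lambda>w. f w * w / (w - a) ^ Suc k"
  have ne: "of_real r * \<xi> \<noteq> a" if "norm \<xi> = 1" for \<xi>
    using that r by (auto simp: norm_mult)
  have c': "continuous_on (sphere 0 1) (\<lambda>\<xi>. ?\<phi> (of_real r * \<xi>))"
    by (intro continuous_intros continuous_on_compose2[OF c]) (use r ne in \<open>auto simp: norm_mult\<close>)
  have "contour_integral (circlepath 0 r) (\<lambda>w. ?\<phi> w / w) =
      contour_integral (circlepath 0 r) (\<lambda>w. f w / (w - a) ^ Suc k)"
    using r by (intro contour_integral_cong) auto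
  also have "\<dots> = (2 * pi * \<i>) / (fact k) * (deriv ^^ k) f a"
    using r by (intro contour_integral_unique Cauchy_has_contour_integral_higher_derivative_circlepath[OF c h]) auto
  finally show ?thesis
    using circle_integral_contour[OF c' r(1)] by simp
qed

text \<open>On the circle, \<open>(1 - cnj b * \<xi>) * (\<xi> - b) = \<xi> * norm (\<xi> - b) ^
  2\<close>. The integral is therefore Cauchy's formula at \<open>b\<close> for the function
  \<open>1 / (1 - cnj b * z)\<close>.\<close>

lemma poisson_circle_integral:
  assumes b: "norm b < 1"
  shows "(LINT \<xi>|circle_measure. 1 / norm (\<xi> - b) ^ 2) = 1 / (1 - norm b ^ 2)"
proof -
  let ?f = "\<lambda>z. 1 / (1 - cnj b * z)"
  have ne: "1 - cnj b * z \<noteq> 0" if "norm z \<le> 1" for z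
  proof
    assume "1 - cnj b * z = 0"
    then have "norm (cnj b * z) = 1" by (metis eq_iff_diff_eq_0 norm_one)
    moreover have "norm (cnj b * z) < 1"
      using that b mult_left_mono[of "norm z" 1 "norm b"] by (simp add: norm_mult)
    ultimately show False by simp
  qed
  have c: "continuous_on (cball 0 1) ?f" by (intro continuous_intros) (use ne in auto)
  have h: "?f holomorphic_on ball 0 1" by (intro holomorphic_intros) (use ne in auto)
  have eq: "?f (of_real 1 * \<xi>) * (of_real 1 * \<xi>) / (of_real 1 * \<xi> - b) ^ Suc 0 = of_real (1 / norm (\<xi> - b) ^ 2)"
    if "norm \<xi> = 1" for \<xi>
  proof -
    have "\<xi> * cnj \<xi> = 1" using that by (metis complex_norm_square of_real_1 power_one)
    then have "(1 - cnj b * \<xi>) * (\<xi> - b) = \<xi> * ((\<xi> - b) * cnj (\<xi> - b))"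
      by (simp add: algebra_simps)
    also have "\<dots> = \<xi> * of_real (norm (\<xi> - b) ^ 2)"
      by (simp only: complex_norm_square)
    finally show ?thesis using that by (auto simp: divide_simps)
  qed
  have "(LINT \<xi>|circle_measure. complex_of_real (1 / norm (\<xi> - b) ^ 2)) =
      (LINT \<xi>|circle_measure. ?f (of_real 1 * \<xi>) * (of_real 1 * \<xi>) / (of_real 1 * \<xi> - b) ^ Suc 0)"
    by (intro Bochner_Integration.integral_cong) (use eq in auto)
  also have "\<dots> = 1 / (1 - cnj b * b)"
    by (subst cauchy_circle_integral[OF c h]) (use b in auto)
  also have "\<dots> = of_real (1 / (1 - norm b ^ 2))"
    by (simp add: mult.commute flip: complex_norm_square)
  finally show ?thesis by (simp only: integral_complex_of_real of_real_eq_iff)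
qed

lemma slice_mean_le:
  assumes "continuous_on (ball 0 1) f" and p: "1 \<le> p" and "0 \<le> r" "r < 1"
  shows "(LINT \<xi>|circle_measure. norm (f (of_real r * \<xi>))) \<le> slice_norm p f r"
proof -
  note c = continuous_on_slice[OF assms(1,3,4)]
  let ?I = "LINT \<xi>|circle_measure. norm (f (of_real r * \<xi>))"
  have "(LINT \<xi>|circle_measure. norm (f (of_real r * \<xi>)) * 1) powr p \<le>
     (LINT \<xi>|circle_measure. 1) powr (p - 1) * (LINT \<xi>|circle_measure. norm (f (of_real r * \<xi>)) powr p * 1)"
    using p c by (intro weighted_jensen_powr)
      (auto intro!: continuous_circle_integrable continuous_on_norm_powr continuous_intros)
  then have "?I powr p \<le> hardy_mean p f r" by (simp add: hardy_mean_def)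
  then have "(?I powr p) powr (1/p) \<le> hardy_mean p f r powr (1/p)"
    using p by (intro powr_mono2) auto
  then show ?thesis using p by (simp add: powr_powr slice_norm_eq)
qed

lemma cauchy_circle_integral_disk:
  assumes "f holomorphic_on ball 0 1" "0 < r" "r < 1" "norm a < r"
  shows "(LINT \<xi>|circle_measure. f (of_real r * \<xi>) * (of_real r * \<xi>) / (of_real r * \<xi> - a) ^ Suc k) =
    (deriv ^^ k) f a / fact k"
  by (rule cauchy_circle_integral)
     (use assms in \<open>auto intro!: holomorphic_on_imp_continuous_on intro: holomorphic_on_subset\<close>)

text \<open>Serves definiteness and completeness of the norm, where any bound that is locally
  uniform in \<open>a\<close> will do; hence the crude Cauchy estimate on the circle halfway between
  \<open>a\<close> and the boundary.\<close>

lemma hardy_point_bound: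
  assumes f: "f \<in> hardy_space p" and p: "1 \<le> p" and a: "norm a < 1"
  shows "norm (f a) \<le> 2 / (1 - norm a) * hardy_norm p f"
proof -
  define r where "r = (1 + norm a) / 2"
  have r: "0 < r" "r < 1" "norm a < r" and r4: "r - norm a = (1 - norm a) / 2"
    using a norm_ge_zero[of a] unfolding r_def by (auto simp: field_simps add_pos_nonneg)
  note cf = hardy_space_continuous[OF f]
  have lb: "r - norm a \<le> norm (of_real r * \<xi> - a)" if "norm \<xi> = 1" for \<xi>
    using norm_triangle_ineq2[of "of_real r * \<xi>" a] r that by (simp add: norm_mult)
  have c: "continuous_on (sphere 0 1) (\<lambda>\<xi>. f (of_real r * \<xi>))"
    using continuous_on_slice[OF cf] r by auto
  have c2: "continuous_on (sphere 0 1) (\<lambda>\<xi>. f (of_real r * \<xi>) * (of_real r * \<xi>) / (of_real r * \<xi> - a))"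
    using r by (intro continuous_intros c) (auto dest!: lb)
  have "norm (f a) = norm (LINT \<xi>|circle_measure. f (of_real r * \<xi>) * (of_real r * \<xi>) / (of_real r * \<xi> - a))"
    using cauchy_circle_integral_disk[OF hardy_spaceD(1)[OF f] r(1-3), of 0] by simp
  also have "\<dots> \<le> (LINT \<xi>|circle_measure. norm (f (of_real r * \<xi>) * (of_real r * \<xi>) / (of_real r * \<xi> - a)))"
    by (rule integral_norm_bound)
  also have "\<dots> \<le> (LINT \<xi>|circle_measure. 1 / (r - norm a) * norm (f (of_real r * \<xi>)))"
  proof (rule integral_mono)
    show "integrable circle_measure (\<lambda>\<xi>. norm (f (of_real r * \<xi>) * (of_real r * \<xi>) / (of_real r * \<xi> - a)))"
      by (intro continuous_circle_integrable continuous_intros c2)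
    show "integrable circle_measure (\<lambda>\<xi>. 1 / (r - norm a) * norm (f (of_real r * \<xi>)))"
      by (intro continuous_circle_integrable continuous_intros c)
    fix \<xi> assume "\<xi> \<in> space circle_measure"
    then have n: "norm \<xi> = 1" by simp
    have "norm (f (of_real r * \<xi>)) * r / norm (of_real r * \<xi> - a) \<le> norm (f (of_real r * \<xi>)) * 1 / (r - norm a)"
      using r lb[OF n] by (intro frac_le mult_left_mono) auto
    then show "norm (f (of_real r * \<xi>) * (of_real r * \<xi>) / (of_real r * \<xi> - a)) \<le> 1 / (r - norm a) * norm (f (of_real r * \<xi>))"
      using n r by (simp add: norm_mult norm_divide)
  qed
  also have "\<dots> = 1 / (r - norm a) * (LINT \<xi>|circle_measure. norm (f (of_real r * \<xi>)))"
    by simp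
  also have "\<dots> \<le> 1 / (r - norm a) * hardy_norm p f"
    using r slice_mean_le[OF cf p, of r] slice_norm_le[OF f p, of r] by (intro mult_left_mono) auto
  finally show ?thesis by (simp add: r4)
qed

text \<open>The exponent \<open>1 + 1/p\<close> has to be sharp: in
  \<open>volterra_peak_lower\<close> it cancels against the growth of the derivative of a peak. It
  comes from Jensen's inequality for the Poisson-type weight \<open>w\<close>, whose mass is at most
  \<open>D\<close> and contributes \<open>D powr (p - 1)\<close>, while its supremum is at most
  \<open>D ^ 2\<close>.\<close>

lemma hardy_deriv_bound:
  assumes f: "f \<in> hardy_space p" and p: "1 \<le> p" and a: "norm a < 1"
  shows "norm (deriv f a) \<le> (2 / (1 - norm a)) powr (1 + 1/p) * hardy_norm p f"
proof -
  define r where "r = (1 + norm a) / 2"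
  have r: "0 < r" "r < 1" "norm a < r" and r4: "r - norm a = (1 - norm a) / 2"
    using a norm_ge_zero[of a] unfolding r_def by (auto simp: field_simps add_pos_nonneg)
  define D where "D = 1 / (r - norm a)"
  have D: "D > 0" "D = 2 / (1 - norm a)" using r by (auto simp: D_def r4)
  note cf = hardy_space_continuous[OF f]
  have lb: "r - norm a \<le> norm (of_real r * \<xi> - a)" if "norm \<xi> = 1" for \<xi>
    using norm_triangle_ineq2[of "of_real r * \<xi>" a] r that by (simp add: norm_mult)
  define w where "w \<xi> = r / norm (of_real r * \<xi> - a) ^ 2" for \<xi>
  have c: "continuous_on (sphere 0 1) (\<lambda>\<xi>. f (of_real r * \<xi>))"
    using continuous_on_slice[OF cf] r by auto
  have cw: "continuous_on (sphere 0 1) w"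
    unfolding w_def using r by (intro continuous_intros) (auto dest!: lb)
  have w0: "w \<xi> \<ge> 0" for \<xi> using r by (simp add: w_def)
  have wD: "w \<xi> \<le> D ^ 2" if "norm \<xi> = 1" for \<xi>
  proof -
    have "w \<xi> \<le> 1 / (r - norm a) ^ 2"
      unfolding w_def using r lb[OF that] by (intro frac_le power_mono) auto
    then show ?thesis by (simp add: D_def power_divide)
  qed
  have Wi: "(LINT \<xi>|circle_measure. w \<xi>) = r / (r\<^sup>2 - norm a ^ 2)"
  proof -
    have "w \<xi> = 1 / r * (1 / norm (\<xi> - a / of_real r) ^ 2)" for \<xi>
    proof -
      have "of_real r * \<xi> - a = of_real r * (\<xi> - a / of_real r)" using r by (simp add: field_simps)
      then have "norm (of_real r * \<xi> - a) = r * norm (\<xi> - a / of_real r)"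
        using r by (metis abs_of_pos norm_mult norm_of_real)
      then show ?thesis using r by (simp add: w_def power_mult_distrib power2_eq_square)
    qed
    then have "(LINT \<xi>|circle_measure. w \<xi>) = 1 / r * (LINT \<xi>|circle_measure. 1 / norm (\<xi> - a / of_real r) ^ 2)"
      by (simp only: integral_mult_right_zero)
    also have "\<dots> = 1 / r * (1 / (1 - norm (a / of_real r) ^ 2))"
      using r by (subst poisson_circle_integral) (auto simp: norm_divide)
    also have "\<dots> = r / (r\<^sup>2 - norm a ^ 2)"
      using r by (simp add: norm_divide field_simps power2_eq_square)
    finally show ?thesis .
  qed
  have fac: "r\<^sup>2 - norm a ^ 2 = (r - norm a) * (r + norm a)"
    by (simp add: power2_eq_square algebra_simps)
  have Wpos: "(LINT \<xi>|circle_measure. w \<xi>) > 0"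
    unfolding Wi fac using r by (auto intro!: divide_pos_pos mult_pos_pos add_pos_nonneg)
  have WD: "(LINT \<xi>|circle_measure. w \<xi>) \<le> D"
  proof -
    have "r / ((r - norm a) * (r + norm a)) \<le> (r + norm a) / ((r - norm a) * (r + norm a))"
      using r by (intro divide_right_mono) auto
    also have "\<dots> = D" using r add_pos_nonneg[of r "norm a"] unfolding D_def by simp
    finally show ?thesis unfolding Wi fac .
  qed
  have "norm (deriv f a) = norm (LINT \<xi>|circle_measure. f (of_real r * \<xi>) * (of_real r * \<xi>) / (of_real r * \<xi> - a) ^ 2)"
    using cauchy_circle_integral_disk[OF hardy_spaceD(1)[OF f] r(1-3), of 1] by (simp add: power2_eq_square)
  also have "\<dots> \<le> (LINT \<xi>|circle_measure. norm (f (of_real r * \<xi>) * (of_real r * \<xi>) / (of_real r * \<xi> - a) ^ 2))"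
    by (rule integral_norm_bound)
  also have "\<dots> = (LINT \<xi>|circle_measure. norm (f (of_real r * \<xi>)) * w \<xi>)"
    using r by (intro Bochner_Integration.integral_cong) (auto simp: w_def norm_mult norm_divide norm_power)
  finally have 1: "norm (deriv f a) \<le> (LINT \<xi>|circle_measure. norm (f (of_real r * \<xi>)) * w \<xi>)" .
  have "norm (deriv f a) powr p \<le> (LINT \<xi>|circle_measure. norm (f (of_real r * \<xi>)) * w \<xi>) powr p"
    using 1 p by (intro powr_mono2) auto
  also have "\<dots> \<le> (LINT \<xi>|circle_measure. w \<xi>) powr (p - 1) *
      (LINT \<xi>|circle_measure. norm (f (of_real r * \<xi>)) powr p * w \<xi>)"
    using p c cw w0 Wpos by (intro weighted_jensen_powr continuous_circle_integrable continuous_intros continuous_on_norm_powr) auto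
  also have "\<dots> \<le> D powr (p - 1) * (LINT \<xi>|circle_measure. D ^ 2 * norm (f (of_real r * \<xi>)) powr p)"
  proof (rule mult_mono)
    show "(LINT \<xi>|circle_measure. w \<xi>) powr (p - 1) \<le> D powr (p - 1)"
      using WD Wpos p by (intro powr_mono2) auto
    show "(LINT \<xi>|circle_measure. norm (f (of_real r * \<xi>)) powr p * w \<xi>)
        \<le> (LINT \<xi>|circle_measure. D ^ 2 * norm (f (of_real r * \<xi>)) powr p)"
    proof (rule integral_mono)
      show "integrable circle_measure (\<lambda>\<xi>. norm (f (of_real r * \<xi>)) powr p * w \<xi>)"
        "integrable circle_measure (\<lambda>\<xi>. D ^ 2 * norm (f (of_real r * \<xi>)) powr p)"
        using p by (intro continuous_circle_integrable continuous_intros continuous_on_norm_powr c cw; simp)+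
      show "norm (f (of_real r * \<xi>)) powr p * w \<xi> \<le> D ^ 2 * norm (f (of_real r * \<xi>)) powr p" if "\<xi> \<in> space circle_measure" for \<xi>
        using wD[of \<xi>] that by (simp add: mult.commute mult_right_mono)
    qed
  qed (use w0 in \<open>auto intro!: integral_nonneg_AE\<close>)
  also have "\<dots> = D powr (p + 1) * hardy_mean p f r"
    using D by (simp add: hardy_mean_def powr_diff powr_add powr_numeral power2_eq_square)
  also have "\<dots> \<le> D powr (p + 1) * hardy_norm p f powr p"
    using hardy_mean_le_norm[OF f p, of r] r by (intro mult_left_mono) auto
  finally have "(norm (deriv f a) powr p) powr (1/p) \<le> (D powr (p + 1) * hardy_norm p f powr p) powr (1/p)"
    using p by (intro powr_mono2) auto
  then show ?thesis using p D(1) unfolding D(2)[symmetric]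
    by (simp add: powr_mult powr_powr add_divide_distrib)
qed

lemma hardy_norm_eq_0:
  assumes f: "f \<in> hardy_space p" and p: "1 \<le> p" and "hardy_norm p f = 0"
  shows "f = 0"
proof
  fix z
  show "f z = 0 z"
    using hardy_point_bound[OF f p, of z] hardy_spaceD(2)[OF f, of z] assms(3)
    by (cases "norm z < 1") auto
qed

lemma hardy_space_diff: "\<lbrakk>f \<in> hardy_space p; h \<in> hardy_space p; 1 \<le> p\<rbrakk> \<Longrightarrow> f - h \<in> hardy_space p"
  by (intro cfun.subspace_diff subspace_hardy_space)

lemma slice_norm_tendsto_uniform:
  assumes p: "p > 0" and r: "0 \<le> r" "r < 1"
    and c: "\<And>n. continuous_on (ball 0 1) (f n)"
    and u: "uniform_limit (cball 0 r) f l sequentially"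
  shows "(\<lambda>n. slice_norm p (f n) r) \<longlonglongrightarrow> slice_norm p l r"
  unfolding slice_norm_eq
  using p by (intro tendsto_powr' hardy_mean_tendsto[OF p r c u] tendsto_const) auto

text \<open>Point evaluations make a Cauchy sequence uniformly Cauchy on smaller disks. Slice norms
  are continuous under uniform convergence on a circle, so the Cauchy bound survives with the limit
  in place of \<open>u n\<close>.\<close>

lemma hardy_space_complete:
  assumes p: "1 \<le> p" and u: "\<And>n. u n \<in> hardy_space p"
    and cauchy: "\<And>e. e > 0 \<Longrightarrow> \<exists>N. \<forall>m\<ge>N. \<forall>n\<ge>N. hardy_norm p (u m - u n) < e"
  shows "\<exists>l\<in>hardy_space p. (\<lambda>n. hardy_norm p (u n - l)) \<longlonglongrightarrow> 0"
proof -
  have ud: "u m - u n \<in> hardy_space p" for m n using u p by (intro hardy_space_diff)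
  have pt: "norm (u m z - u n z) \<le> 2 / (1 - r) * hardy_norm p (u m - u n)"
    if "z \<in> cball 0 r" "r < 1" for z r m n
  proof -
    have "norm (u m z - u n z) \<le> 2 / (1 - norm z) * hardy_norm p (u m - u n)"
      using hardy_point_bound[OF ud p, of z m n] that by auto
    also have "\<dots> \<le> 2 / (1 - r) * hardy_norm p (u m - u n)"
      using that by (intro mult_right_mono divide_left_mono mult_pos_pos) auto
    finally show ?thesis .
  qed
  have uc: "uniformly_Cauchy_on (cball (0::complex) r) u" if r: "r < 1" for r
  proof (rule uniformly_Cauchy_onI)
    fix e :: real assume e: "e > 0"
    then obtain N where N: "\<And>m n. m \<ge> N \<Longrightarrow> n \<ge> N \<Longrightarrow> hardy_norm p (u m - u n) < e * (1 - r) / 2"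
      using cauchy[of "e * (1 - r) / 2"] r by auto
    show "\<exists>M. \<forall>x\<in>cball (0::complex) r. \<forall>m\<ge>M. \<forall>n\<ge>M. dist (u m x) (u n x) < e"
    proof (intro exI[of _ N] ballI allI impI)
      fix x :: complex and m n assume x: "x \<in> cball 0 r" and mn: "N \<le> m" "N \<le> n"
      have "norm (u m x - u n x) \<le> 2 / (1 - r) * hardy_norm p (u m - u n)" by (rule pt[OF x r])
      also have "\<dots> < 2 / (1 - r) * (e * (1 - r) / 2)"
        using N[OF mn] r by (intro mult_strict_left_mono) auto
      also have "\<dots> = e" using r by simp
      finally show "dist (u m x) (u n x) < e" by (simp add: dist_norm)
    qed
  qed
  define l where "l z = lim (\<lambda>n. u n z)" for z
  have ul: "uniform_limit (cball 0 r) u l sequentially" if "r < 1" for r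
  proof -
    from uc[OF that] have "uniformly_convergent_on (cball 0 r) u"
      by (rule Cauchy_uniformly_convergent)
    then show ?thesis unfolding l_def by (simp add: uniformly_convergent_uniform_limit_iff)
  qed
  have hol: "l holomorphic_on ball 0 1"
  proof (rule holomorphic_uniform_sequence[of _ u])
    fix x :: complex assume x: "x \<in> ball 0 1"
    then have "cball x ((1 - norm x) / 2) \<subseteq> cball 0 ((1 + norm x) / 2)"
      by (subst cball_subset_cball_iff) (auto simp: dist_norm field_simps)
    moreover have "cball 0 ((1 + norm x) / 2) \<subseteq> ball (0::complex) 1"
      using x by (subst cball_subset_ball_iff) auto
    ultimately show "\<exists>d>0. cball x d \<subseteq> ball 0 1 \<and> uniform_limit (cball x d) u l sequentially"
      using x ul[of "(1 + norm x) / 2"]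
      by (intro exI[of _ "(1 - norm x) / 2"]) (auto intro: uniform_limit_on_subset)
  qed (auto intro: hardy_spaceD u)
  have l0: "l z = 0" if "norm z \<ge> 1" for z
    using hardy_spaceD(2)[OF u that] by (simp add: l_def)
  have key: "u m - l \<in> hardy_space p \<and> hardy_norm p (u m - l) \<le> e"
    if m: "\<And>n. n \<ge> N \<Longrightarrow> hardy_norm p (u m - u n) \<le> e" for m N e
  proof -
    have 1: "(u m - l) holomorphic_on ball 0 1"
      unfolding fun_diff_def by (intro holomorphic_intros hol hardy_spaceD(1)[OF u])
    have 2: "(u m - l) z = 0" if "norm z \<ge> 1" for z
      using that l0 hardy_spaceD(2)[OF u that] by simp
    have 3: "slice_norm p (u m - l) r \<le> e" if r: "0 \<le> r" "r < 1" for r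
    proof (rule LIMSEQ_le_const2)
      have "uniform_limit (cball 0 r) (\<lambda>n. u m - u n) (u m - l) sequentially"
        unfolding fun_diff_def by (intro uniform_limit_intros ul r)
      then show "(\<lambda>n. slice_norm p (u m - u n) r) \<longlonglongrightarrow> slice_norm p (u m - l) r"
        using p r by (intro slice_norm_tendsto_uniform hardy_space_continuous[OF ud]) auto
      show "\<exists>N. \<forall>n\<ge>N. slice_norm p (u m - u n) r \<le> e"
        using m slice_norm_le[OF ud p r] by (intro exI[of _ N]) (meson order_trans)
    qed
    show ?thesis using hardy_spaceI[OF 1 2 p 3] by auto
  qed
  have ev: "\<exists>N. \<forall>m\<ge>N. u m - l \<in> hardy_space p \<and> hardy_norm p (u m - l) \<le> e" if e: "e > 0" for e
  proof -
    obtain N where "\<And>m n. m \<ge> N \<Longrightarrow> n \<ge> N \<Longrightarrow> hardy_norm p (u m - u n) < e"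
      using cauchy[OF e] by auto
    then show ?thesis by (intro exI[of _ N] allI impI key[of N]) (auto intro: less_imp_le)
  qed
  obtain N where "u N - l \<in> hardy_space p" using ev[of 1] by auto
  from hardy_space_diff[OF u this p] have "u N - (u N - l) \<in> hardy_space p" .
  then have "l \<in> hardy_space p" by simp
  moreover have "(\<lambda>n. hardy_norm p (u n - l)) \<longlonglongrightarrow> 0"
  proof (rule LIMSEQ_I)
    fix e :: real assume "e > 0"
    then obtain N where "\<And>m. m \<ge> N \<Longrightarrow> hardy_norm p (u m - l) \<le> e/2"
      using ev[of "e/2"] by auto
    then show "\<exists>no. \<forall>n\<ge>no. norm (hardy_norm p (u n - l) - 0) < e"
      using \<open>e > 0\<close> by (intro exI[of _ N]) (force intro: le_less_trans)
  qed
  ultimately show ?thesis by auto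
qed

section \<open>Operators fixing a copy of a sequence space\<close>

lemma bounded_op_add: "bounded_op X NX Y NY T \<Longrightarrow> f \<in> X \<Longrightarrow> h \<in> X \<Longrightarrow> T (f + h) = T f + T h"
  and bounded_op_scale: "bounded_op X NX Y NY T \<Longrightarrow> f \<in> X \<Longrightarrow> T (scale_fun c f) = scale_fun c (T f)"
  and bounded_op_in: "bounded_op X NX Y NY T \<Longrightarrow> f \<in> X \<Longrightarrow> T f \<in> Y"
  by (auto simp: bounded_op_def)

lemma bounded_op_diff:
  assumes T: "bounded_op X NX Y NY T" and X: "cfun.subspace X" and "f \<in> X" "h \<in> X"
  shows "T (f - h) = T f - T h"
proof -
  have "T (f + scale_fun (-1) h) = T f + T (scale_fun (-1) h)"
    by (rule bounded_op_add[OF T assms(3) cfun.subspace_scale[OF X assms(4)]])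
  also have "T (scale_fun (-1) h) = scale_fun (-1) (T h)"
    by (rule bounded_op_scale[OF T assms(4)])
  finally have "T (f + scale_fun (-1) h) = T f + scale_fun (-1) (T h)" .
  moreover have "f + scale_fun (-1) h = f - h" "T f + scale_fun (-1) (T h) = T f - T h"
    by (auto simp: scale_fun_def fun_eq_iff)
  ultimately show ?thesis by (simp only:)
qed

lemma bounded_op_zero:
  assumes "bounded_op X NX Y NY T" "cfun.subspace X"
  shows "T 0 = 0"
  using bounded_op_diff[OF assms, of 0 0] assms(2) by (simp add: cfun.subspace_0)

lemma bounded_op_sum:
  fixes n :: nat
  assumes T: "bounded_op X NX Y NY T" and X: "cfun.subspace X" and f: "\<And>k. k < n \<Longrightarrow> f k \<in> X"
  shows "T (\<Sum>k<n. scale_fun (x k) (f k)) = (\<Sum>k<n. scale_fun (x k) (T (f k)))"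
  using f
proof (induction n)
  case 0 show ?case unfolding lessThan_0 sum.empty by (rule bounded_op_zero[OF T X])
next
  case (Suc n)
  have "(\<Sum>k<n. scale_fun (x k) (f k)) \<in> X"
    using Suc.prems by (intro cfun.subspace_sum[OF X] cfun.subspace_scale[OF X]) auto
  then show ?case
    unfolding sum.lessThan_Suc using Suc
    by (subst bounded_op_add[OF T]) (auto simp: bounded_op_scale[OF T] cfun.subspace_scale[OF X])
qed

lemma bounded_op_bound:
  assumes "bounded_op X NX Y NY T" "\<And>f. f \<in> X \<Longrightarrow> 0 \<le> NX f"
  obtains K where "K > 0" "\<And>f. f \<in> X \<Longrightarrow> NY (T f) \<le> K * NX f"
proof -
  obtain C where C: "\<And>f. f \<in> X \<Longrightarrow> NY (T f) \<le> C * NX f"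
    using assms unfolding bounded_op_def by blast
  show thesis
  proof (rule that[of "\<bar>C\<bar> + 1"])
    fix f assume f: "f \<in> X"
    have "C * NX f \<le> (\<bar>C\<bar> + 1) * NX f" using assms(2)[OF f] by (intro mult_right_mono) auto
    then show "NY (T f) \<le> (\<bar>C\<bar> + 1) * NX f" using C[OF f] by simp
  qed auto
qed

text \<open>One lower bound gives both injectivity and boundedness of the inverse.\<close>

lemma isomorphismI:
  assumes T: "bounded_op X NX Y NY T" and X: "cfun.subspace X" and im: "T ` X = Y"
    and lower: "\<And>f. f \<in> X \<Longrightarrow> NX f \<le> K * NY (T f)"
    and definite: "\<And>f. f \<in> X \<Longrightarrow> NX f \<le> 0 \<Longrightarrow> f = 0" and "NY 0 = 0"
  shows "isomorphism X NX Y NY T"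
proof -
  have inj: "inj_on T X"
  proof (rule inj_onI)
    fix f h assume fh: "f \<in> X" "h \<in> X" "T f = T h"
    then have "NX (f - h) \<le> K * NY (T (f - h))"
      by (intro lower cfun.subspace_diff[OF X])
    then have "NX (f - h) \<le> 0" using fh assms(6) by (simp add: bounded_op_diff[OF T X])
    then have "f - h = 0" using fh by (intro definite cfun.subspace_diff[OF X])
    then show "f = h" by simp
  qed
  let ?I = "inv_into X T"
  have I: "?I (T f) = f" if "f \<in> X" for f using inj that by simp
  have "bounded_op Y NY X NX ?I"
    unfolding bounded_op_def
  proof (intro conjI ballI allI exI[of _ K])
    fix f assume "f \<in> Y"
    then obtain f' where f': "f' \<in> X" "f = T f'" using im by auto
    show "?I f \<in> X" using f' I by simp
    show "NX (?I f) \<le> K * NY f" using f' I lower by simp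
    show "?I (scale_fun c f) = scale_fun c (?I f)" for c
      using f' I by (simp add: bounded_op_scale[OF T, symmetric] cfun.subspace_scale[OF X])
    fix h assume "h \<in> Y"
    then obtain h' where h': "h' \<in> X" "h = T h'" using im by auto
    show "?I (f + h) = ?I f + ?I h"
      using f' h' I by (simp add: bounded_op_add[OF T, symmetric] cfun.subspace_add[OF X])
  qed
  then show ?thesis using inj im T by (auto simp: isomorphism_def bij_betw_def)
qed

section \<open>Sequence spaces and their completeness\<close>

lemma lp_norm_nonneg [simp]: "0 \<le> lp_norm q x"
  by (simp add: lp_norm_def)

lemma lp_partial_sum_le:
  assumes "q > 0" "x \<in> lp_space q"
  shows "(\<Sum>k<n. norm (x k) powr q) powr (1/q) \<le> lp_norm q x"
  using assms unfolding lp_norm_def lp_space_def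
  by (intro powr_mono2 sum_le_suminf sum_nonneg) auto

lemma lp_partial_sum_tendsto:
  assumes "q > 0" "x \<in> lp_space q"
  shows "(\<lambda>n. (\<Sum>k<n. norm (x k) powr q) powr (1/q)) \<longlonglongrightarrow> lp_norm q x"
  using assms unfolding lp_norm_def lp_space_def
  by (intro tendsto_powr' summable_LIMSEQ tendsto_const) (auto intro!: eventuallyI sum_nonneg)

lemma lp_spaceI:
  assumes q: "q > 0" and K: "\<And>n. (\<Sum>k<n. norm (x k) powr q) \<le> K powr q" and "K \<ge> 0"
  shows "x \<in> lp_space q" "lp_norm q x \<le> K"
proof -
  have s: "summable (\<lambda>n. norm (x n) powr q)"
    using K[of "Suc _"] by (intro bounded_imp_summable[where B="K powr q"]) (auto simp only: lessThan_Suc_atMost powr_ge_zero)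
  then show 1: "x \<in> lp_space q" by (simp add: lp_space_def)
  have "(\<Sum>n. norm (x n) powr q) \<le> K powr q"
    using K s by (intro suminf_le_const)
  then have "lp_norm q x \<le> (K powr q) powr (1/q)"
    unfolding lp_norm_def using q s by (intro powr_mono2 suminf_nonneg) auto
  then show "lp_norm q x \<le> K" using assms by (simp add: powr_powr)
qed

lemma lp_coord_le:
  assumes "q > 0" "x \<in> lp_space q"
  shows "norm (x k) \<le> lp_norm q x"
proof -
  have "norm (x k) powr q \<le> (\<Sum>j<Suc k. norm (x j) powr q)"
    by (rule member_le_sum) auto
  then have "(norm (x k) powr q) powr (1/q) \<le> (\<Sum>j<Suc k. norm (x j) powr q) powr (1/q)"
    using assms by (intro powr_mono2) auto
  then show ?thesis using assms lp_partial_sum_le[OF assms, of "Suc k"] by (simp add: powr_powr)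
qed

lemma subspace_lp_space:
  assumes q: "1 \<le> q"
  shows "cfun.subspace (lp_space q)"
proof (rule cfun.subspaceI)
  show "0 \<in> lp_space q" using q by (simp add: lp_space_def)
  show "scale_fun c x \<in> lp_space q" if "x \<in> lp_space q" for c x
    using that by (auto simp: lp_space_def scale_fun_def norm_mult powr_mult intro: summable_mult)
  fix x y assume xy: "x \<in> lp_space q" "y \<in> lp_space q"
  show "x + y \<in> lp_space q" unfolding lp_space_def mem_Collect_eq
  proof (rule summable_comparison_test')
    show "summable (\<lambda>n. 2 powr q * (1/2 * norm (x n) powr q + 1/2 * norm (y n) powr q))"
      using xy by (intro summable_mult summable_add) (auto simp: lp_space_def)
    fix n :: nat
    have "norm ((x + y) n) powr q \<le> (2 * (1/2 * norm (x n) + 1/2 * norm (y n))) powr q"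
      using q norm_triangle_ineq[of "x n" "y n"] by (intro powr_mono2) auto
    also have "\<dots> = 2 powr q * (1/2 * norm (x n) + 1/2 * norm (y n)) powr q"
      by (rule powr_mult)
    also have "\<dots> \<le> 2 powr q * (1/2 * norm (x n) powr q + 1/2 * norm (y n) powr q)"
      using q by (intro mult_left_mono powr_convex_ge_0) auto
    finally show "norm (norm ((x + y) n) powr q) \<le> 2 powr q * (1/2 * norm (x n) powr q + 1/2 * norm (y n) powr q)"
      by simp
  qed
qed

text \<open>The coordinates converge, and the Cauchy bound passes to the limit in each finite
  partial sum, which is all that \<open>lp_spaceI\<close> asks for.\<close>

lemma lp_space_complete:
  assumes q: "1 \<le> q" and u: "\<And>n. u n \<in> lp_space q"
    and cauchy: "\<And>e. e > 0 \<Longrightarrow> \<exists>N. \<forall>m\<ge>N. \<forall>n\<ge>N. lp_norm q (u m - u n) < e"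
  shows "\<exists>x\<in>lp_space q. (\<lambda>n. lp_norm q (u n - x)) \<longlonglongrightarrow> 0"
proof -
  note sub = subspace_lp_space[OF q]
  have ud: "u m - u n \<in> lp_space q" for m n by (intro cfun.subspace_diff[OF sub] u)
  have "Cauchy (\<lambda>n. u n k)" for k
  proof (rule metric_CauchyI)
    fix e :: real assume "e > 0"
    then obtain N where N: "\<And>m n. m \<ge> N \<Longrightarrow> n \<ge> N \<Longrightarrow> lp_norm q (u m - u n) < e" using cauchy by blast
    show "\<exists>M. \<forall>m\<ge>M. \<forall>n\<ge>M. dist (u m k) (u n k) < e"
    proof (intro exI[of _ N] allI impI)
      fix m n assume "m \<ge> N" "n \<ge> N"
      then show "dist (u m k) (u n k) < e"
        using N[of m n] lp_coord_le[OF _ ud[of m n], of k] q by (simp add: dist_norm)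
    qed
  qed
  then have "\<forall>k. \<exists>l. (\<lambda>n. u n k) \<longlonglongrightarrow> l" by (auto simp: Cauchy_convergent_iff convergent_def)
  then obtain x where x: "\<And>k. (\<lambda>n. u n k) \<longlonglongrightarrow> x k" by metis
  have key: "u m - x \<in> lp_space q \<and> lp_norm q (u m - x) \<le> e"
    if m: "\<And>n. n \<ge> N \<Longrightarrow> lp_norm q (u m - u n) \<le> e" and "e \<ge> 0" for m N e
  proof -
    have "(\<Sum>k<n. norm ((u m - x) k) powr q) \<le> e powr q" for n
    proof (rule LIMSEQ_le_const2)
      show "(\<lambda>i. \<Sum>k<n. norm (u m k - u i k) powr q) \<longlonglongrightarrow> (\<Sum>k<n. norm ((u m - x) k) powr q)"
        unfolding fun_diff_def using q x
        by (intro tendsto_sum tendsto_powr' tendsto_norm tendsto_diff tendsto_const) auto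
      show "\<exists>N. \<forall>i\<ge>N. (\<Sum>k<n. norm (u m k - u i k) powr q) \<le> e powr q"
      proof (intro exI[of _ N] allI impI)
        fix i assume "i \<ge> N"
        then have "((\<Sum>k<n. norm ((u m - u i) k) powr q) powr (1/q)) powr q \<le> e powr q"
          using lp_partial_sum_le[OF _ ud[of m i], of n] m[of i] q by (intro powr_mono2) auto
        then show "(\<Sum>k<n. norm (u m k - u i k) powr q) \<le> e powr q"
          using q by (simp add: powr_powr sum_nonneg)
      qed
    qed
    from lp_spaceI[OF _ this] show ?thesis using q that(2) by (simp del: minus_apply)
  qed
  have ev: "\<exists>N. \<forall>m\<ge>N. u m - x \<in> lp_space q \<and> lp_norm q (u m - x) \<le> e" if e: "e > 0" for e
  proof -
    obtain N where "\<And>m n. m \<ge> N \<Longrightarrow> n \<ge> N \<Longrightarrow> lp_norm q (u m - u n) < e"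
      using cauchy[OF e] by blast
    then show ?thesis using e by (intro exI[of _ N] allI impI key[of N]) (auto intro: less_imp_le)
  qed
  obtain N where "u N - x \<in> lp_space q" using ev[of 1] by auto
  from cfun.subspace_diff[OF sub u this] have "u N - (u N - x) \<in> lp_space q" .
  then have "x \<in> lp_space q" by simp
  moreover have "(\<lambda>n. lp_norm q (u n - x)) \<longlonglongrightarrow> 0"
  proof (rule LIMSEQ_I)
    fix e :: real assume "e > 0"
    then obtain N where "\<And>m. m \<ge> N \<Longrightarrow> lp_norm q (u m - x) \<le> e/2"
      using ev[of "e/2"] by auto
    then show "\<exists>no. \<forall>n\<ge>no. norm (lp_norm q (u n - x) - 0) < e"
      using \<open>e > 0\<close> by (intro exI[of _ N]) (force intro: le_less_trans)
  qed
  ultimately show ?thesis by auto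
qed

text \<open>\<open>Metric_space\<close> demands nonnegativity and symmetry for arbitrary arguments,
  so these two conditions are stated for all functions, while the triangle inequality and
  homogeneity are confined to \<open>X\<close>.\<close>

locale banach_fun_space =
  fixes X :: "('i \<Rightarrow> complex) set" and N :: "('i \<Rightarrow> complex) \<Rightarrow> real"
  assumes sub: "cfun.subspace X"
    and nonneg': "0 \<le> N f"
    and diff_commute: "N (f - h) = N (h - f)"
    and N_zero: "N 0 = 0"
    and definite: "f \<in> X \<Longrightarrow> N f = 0 \<Longrightarrow> f = 0"
    and N_add: "f \<in> X \<Longrightarrow> h \<in> X \<Longrightarrow> N (f + h) \<le> N f + N h"
    and N_scale: "f \<in> X \<Longrightarrow> N (scale_fun c f) = norm c * N f"
    and complete: "(\<And>n. u n \<in> X) \<Longrightarrow> (\<And>e. e > 0 \<Longrightarrow> \<exists>M. \<forall>m\<ge>M. \<forall>n\<ge>M. N (u m - u n) < e) \<Longrightarrow>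
        \<exists>l\<in>X. (\<lambda>n. N (u n - l)) \<longlonglongrightarrow> 0"
begin

sublocale Metric_space X "\<lambda>f h. N (f - h)"
proof
  show "0 \<le> N (x - y)" for x y by (rule nonneg')
  show "N (x - y) = N (y - x)" for x y by (rule diff_commute)
  show "N (x - y) = 0 \<longleftrightarrow> x = y" if "x \<in> X" "y \<in> X" for x y
    using definite[OF cfun.subspace_diff[OF sub that]] N_zero by auto
  show "N (x - z) \<le> N (x - y) + N (y - z)" if "x \<in> X" "y \<in> X" "z \<in> X" for x y z
    using N_add[OF cfun.subspace_diff[OF sub that(1,2)] cfun.subspace_diff[OF sub that(2,3)]] by simp
qed

lemma mtopology_eq: "norm_topology X N = mtopology"
  by (simp add: norm_topology_def)

lemma limit_unique:
  assumes "\<And>n. u n \<in> X" "l \<in> X" "l' \<in> X" "(\<lambda>n. N (u n - l)) \<longlonglongrightarrow> 0" "(\<lambda>n. N (u n - l')) \<longlonglongrightarrow> 0"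
  shows "l = l'"
proof -
  have "(\<lambda>n. N (u n - l) + N (u n - l')) \<longlonglongrightarrow> 0 + 0" using assms by (intro tendsto_add)
  moreover have "N (l - l') \<le> N (u n - l) + N (u n - l')" for n
    using triangle''[of l "u n" l'] assms by simp
  ultimately have "N (l - l') \<le> 0 + 0"
    by (intro LIMSEQ_le_const) auto
  then have "N (l - l') = 0" using nonneg'[of "l - l'"] by simp
  then show ?thesis using assms by simp
qed

lemma limitin_iff: "limitin mtopology u l sequentially \<longleftrightarrow> l \<in> X \<and> eventually (\<lambda>n. u n \<in> X) sequentially \<and> (\<lambda>n. N (u n - l)) \<longlonglongrightarrow> 0"
proof -
  have "(\<lambda>n. N (u n - l)) \<longlonglongrightarrow> 0 \<longleftrightarrow> (\<forall>e>0. eventually (\<lambda>n. N (u n - l) < e) sequentially)"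
    using nonneg' by (auto simp: tendsto_iff)
  then show ?thesis
    unfolding limitin_metric
    by (auto simp: eventually_conj_iff intro: gt_ex dest: spec[of _ 1])
qed

end

section \<open>Sequences equivalent to the unit vectors before and after the operator\<close>

definition psum :: "(nat \<Rightarrow> 'i \<Rightarrow> complex) \<Rightarrow> (nat \<Rightarrow> complex) \<Rightarrow> nat \<Rightarrow> 'i \<Rightarrow> complex" where
  "psum f x n = (\<Sum>k<n. scale_fun (x k) (f k))"

lemma psum_add: "psum f (x + y) n = psum f x n + psum f y n"
  by (simp add: psum_def cfun.scale_left_distrib sum.distrib)

lemma psum_diff: "psum f (x - y) n = psum f x n - psum f y n"
  by (simp add: psum_def cfun.scale_left_diff_distrib sum_subtractf)

lemma psum_scale: "psum f (scale_fun c x) n = scale_fun c (psum f x n)"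
  unfolding psum_def cfun.scale_sum_right by (simp add: scale_fun_def mult.assoc)

lemma psum_delta: "psum f (\<lambda>k. if k = j then 1 else 0) n = (if j < n then f j else 0)"
proof -
  have "psum f (\<lambda>k. if k = j then 1 else 0) n = (\<Sum>k<n. if k = j then f k else 0)"
    unfolding psum_def by (intro sum.cong) auto
  then show ?thesis by simp
qed

text \<open>Both estimates concern finite sums, so they can be verified with finitely many functions
  on a single circle. The lower one is stated behind \<open>T\<close>; as \<open>T\<close> is
  bounded, it also bounds \<open>psum f x n\<close> itself from below. Thus the same data give the
  copy of the sequence space and the inverse of \<open>T\<close> on its image.\<close>

locale lp_embedding = banach_fun_space X N for X :: "('i \<Rightarrow> complex) set" and N +
  fixes T :: "('i \<Rightarrow> complex) \<Rightarrow> ('i \<Rightarrow> complex)" and f :: "nat \<Rightarrow> 'i \<Rightarrow> complex" and q C c :: real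
  assumes T: "bounded_op X N X N T" and q: "1 \<le> q" and C: "C > 0" and c: "c > 0"
    and f: "\<And>k. f k \<in> X"
    and upper: "\<And>x n. N (psum f x n) \<le> C * (\<Sum>k<n. norm (x k) powr q) powr (1/q)"
    and lower: "\<And>x n. c * (\<Sum>k<n. norm (x k) powr q) powr (1/q) \<le> N (T (psum f x n))"
begin

lemma psum_in: "psum f x n \<in> X"
  unfolding psum_def by (intro cfun.subspace_sum[OF sub] cfun.subspace_scale[OF sub] f)

lemma psum_cauchy:
  assumes x: "x \<in> lp_space q" and e: "e > 0"
  shows "\<exists>M. \<forall>m\<ge>M. \<forall>n\<ge>M. N (psum f x m - psum f x n) < e"
proof -
  let ?P = "\<lambda>n. \<Sum>k<n. norm (x k) powr q"
  have le: "N (psum f x m - psum f x n) \<le> C * \<bar>?P m - ?P n\<bar> powr (1/q)" if "n \<le> m" for m n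
  proof -
    \<comment> \<open>The tail of \<open>x\<close>, which presents the block of indices from
      \<open>n\<close> to \<open>m\<close> as a partial sum starting at 0, as \<open>upper\<close>
      requires.\<close>
    define y where "y k = (if k < n then 0 else x k)" for k
    have "psum f x m = psum f x n + psum f y m"
    proof -
      have "psum f x m = (\<Sum>k<n. scale_fun (x k) (f k)) + (\<Sum>k=n..<m. scale_fun (x k) (f k))"
        unfolding psum_def using that sum.atLeastLessThan_concat[of 0 n m "\<lambda>k. scale_fun (x k) (f k)"] by (simp add: atLeast0LessThan)
      also have "(\<Sum>k=n..<m. scale_fun (x k) (f k)) = psum f y m"
        unfolding psum_def by (intro sum.mono_neutral_cong_left) (auto simp: y_def)
      finally show ?thesis by (simp only: psum_def)
    qed
    then have "N (psum f x m - psum f x n) = N (psum f y m)" by simp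
    also have "\<dots> \<le> C * (\<Sum>k<m. norm (y k) powr q) powr (1/q)" by (rule upper)
    also have "(\<Sum>k<m. norm (y k) powr q) = (\<Sum>k=n..<m. norm (x k) powr q)"
      by (intro sum.mono_neutral_cong_right) (auto simp: y_def)
    also have "\<dots> = ?P m - ?P n"
      using that sum.atLeastLessThan_concat[of 0 n m "\<lambda>k. norm (x k) powr q"] by (simp add: atLeast0LessThan)
    also have "C * (?P m - ?P n) powr (1/q) \<le> C * \<bar>?P m - ?P n\<bar> powr (1/q)"
      using \<open>(\<Sum>k=n..<m. norm (x k) powr q) = ?P m - ?P n\<close> sum_nonneg[of "{n..<m}" "\<lambda>k. norm (x k) powr q"] by simp
    finally show ?thesis .
  qed
  have "Cauchy ?P" using x by (auto simp: lp_space_def summable_iff_convergent intro!: convergent_Cauchy)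
  moreover have "(e/C) powr q > 0" using e C by simp
  ultimately obtain M where M: "\<And>m n. m \<ge> M \<Longrightarrow> n \<ge> M \<Longrightarrow> \<bar>?P m - ?P n\<bar> < (e/C) powr q"
    unfolding Cauchy_def dist_real_def by blast
  have lt: "N (psum f x m - psum f x n) < e" if "m \<ge> M" "n \<ge> M" "n \<le> m" for m n
  proof -
    have "\<bar>?P m - ?P n\<bar> powr (1/q) < ((e/C) powr q) powr (1/q)"
      using M[OF that(1,2)] q by (intro powr_less_mono2) auto
    also have "\<dots> = e/C" using q e C by (simp add: powr_powr)
    finally have "C * \<bar>?P m - ?P n\<bar> powr (1/q) < e" using C by (simp add: field_simps)
    then show ?thesis using le[OF that(3)] by linarith
  qed
  show ?thesis
  proof (intro exI[of _ M] allI impI)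
    fix m n assume "M \<le> m" "M \<le> n"
    then show "N (psum f x m - psum f x n) < e"
      using lt[of m n] lt[of n m] diff_commute[of "psum f x m"] by (cases "n \<le> m") auto
  qed
qed

text \<open>The choice matters only on \<open>lp_space q\<close>, where the partial sums have a
  limit and \<open>limit_unique\<close> makes it the only one.\<close>

definition J :: "(nat \<Rightarrow> complex) \<Rightarrow> ('i \<Rightarrow> complex)" where
  "J x = (SOME l. l \<in> X \<and> (\<lambda>n. N (psum f x n - l)) \<longlonglongrightarrow> 0)"

lemma J:
  assumes "x \<in> lp_space q"
  shows "J x \<in> X" "(\<lambda>n. N (psum f x n - J x)) \<longlonglongrightarrow> 0"
proof -
  have "\<exists>l. l \<in> X \<and> (\<lambda>n. N (psum f x n - l)) \<longlonglongrightarrow> 0"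
    using complete[of "psum f x"] psum_in psum_cauchy[OF assms] by blast
  from someI_ex[OF this] show "J x \<in> X" "(\<lambda>n. N (psum f x n - J x)) \<longlonglongrightarrow> 0"
    unfolding J_def by auto
qed

lemma J_eqI:
  assumes "x \<in> lp_space q" "l \<in> X" "(\<lambda>n. N (psum f x n - l)) \<longlonglongrightarrow> 0"
  shows "J x = l"
  using limit_unique[OF psum_in[of x] J(1)[OF assms(1)] assms(2) J(2)[OF assms(1)] assms(3)] .

lemma J_add:
  assumes x: "x \<in> lp_space q" and y: "y \<in> lp_space q"
  shows "J (x + y) = J x + J y"
proof (rule J_eqI)
  show "x + y \<in> lp_space q" using subspace_lp_space[OF q] x y by (rule cfun.subspace_add)
  show "J x + J y \<in> X" using x y by (intro cfun.subspace_add[OF sub] J)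
  have *: "(\<lambda>n. N (psum f x n - J x) + N (psum f y n - J y)) \<longlonglongrightarrow> 0"
    using tendsto_add[OF J(2)[OF x] J(2)[OF y]] by simp
  show "(\<lambda>n. N (psum f (x + y) n - (J x + J y))) \<longlonglongrightarrow> 0"
  proof (rule tendsto_sandwich[OF _ _ tendsto_const *])
    have "N (psum f (x + y) n - (J x + J y)) \<le> N (psum f x n - J x) + N (psum f y n - J y)" for n
      using N_add[of "psum f x n - J x" "psum f y n - J y"] x y
      by (simp add: psum_add psum_in J cfun.subspace_diff[OF sub] algebra_simps)
    then show "\<forall>\<^sub>F n in sequentially. N (psum f (x + y) n - (J x + J y)) \<le> N (psum f x n - J x) + N (psum f y n - J y)"
      by simp
  qed (simp add: nonneg')
qed

lemma J_scale:
  assumes x: "x \<in> lp_space q"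
  shows "J (scale_fun a x) = scale_fun a (J x)"
proof (rule J_eqI)
  show "scale_fun a x \<in> lp_space q" using subspace_lp_space[OF q] x by (rule cfun.subspace_scale)
  show "scale_fun a (J x) \<in> X" using x by (intro cfun.subspace_scale[OF sub] J)
  have "N (psum f (scale_fun a x) n - scale_fun a (J x)) = norm a * N (psum f x n - J x)" for n
    unfolding psum_scale cfun.scale_right_diff_distrib[symmetric]
    using x by (intro N_scale cfun.subspace_diff[OF sub] psum_in J)
  then show "(\<lambda>n. N (psum f (scale_fun a x) n - scale_fun a (J x))) \<longlonglongrightarrow> 0"
    using tendsto_mult[OF tendsto_const J(2)[OF x], of "norm a"] by simp
qed

lemma J_upper:
  assumes x: "x \<in> lp_space q"
  shows "N (J x) \<le> C * lp_norm q x"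
proof -
  have "(\<lambda>n. N (psum f x n - J x) + C * lp_norm q x) \<longlonglongrightarrow> 0 + C * lp_norm q x"
    by (intro tendsto_add J x tendsto_const)
  moreover have "N (J x) \<le> N (psum f x n - J x) + C * lp_norm q x" for n
  proof -
    have "N (J x) \<le> N (J x - psum f x n) + N (psum f x n)"
      using N_add[OF cfun.subspace_diff[OF sub J(1)[OF x] psum_in] psum_in, of x n x n]
      by (simp only: diff_add_cancel)
    also have "N (psum f x n) \<le> C * lp_norm q x"
      using upper[of x n] lp_partial_sum_le[OF _ x, of n] q C
      by (auto intro: order_trans[OF _ mult_left_mono])
    finally show ?thesis by (simp only: diff_commute[of "J x"] add_left_mono)
  qed
  ultimately have "N (J x) \<le> 0 + C * lp_norm q x" by (intro LIMSEQ_le_const) auto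
  then show ?thesis by simp
qed

text \<open>Boundedness of \<open>T\<close> lets the finite lower bound pass to the limit: the
  images of \<open>psum f x n\<close> and \<open>J x\<close> differ by at most
  \<open>K * N (psum f x n - J x)\<close>.\<close>

lemma J_lower:
  assumes x: "x \<in> lp_space q"
  shows "c * lp_norm q x \<le> N (T (J x))"
proof -
  obtain K where K: "K > 0" "\<And>f. f \<in> X \<Longrightarrow> N (T f) \<le> K * N f"
    using bounded_op_bound[OF T] nonneg' by blast
  have 1: "(\<lambda>n. c * (\<Sum>k<n. norm (x k) powr q) powr (1/q)) \<longlonglongrightarrow> c * lp_norm q x"
    using q by (intro tendsto_mult tendsto_const lp_partial_sum_tendsto x) auto
  have 2: "(\<lambda>n. K * N (psum f x n - J x) + N (T (J x))) \<longlonglongrightarrow> K * 0 + N (T (J x))"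
    by (intro tendsto_add tendsto_mult J x tendsto_const)
  have 3: "c * (\<Sum>k<n. norm (x k) powr q) powr (1/q) \<le> K * N (psum f x n - J x) + N (T (J x))" for n
  proof -
    have i: "psum f x n - J x \<in> X" by (intro cfun.subspace_diff[OF sub] psum_in J x)
    have "c * (\<Sum>k<n. norm (x k) powr q) powr (1/q) \<le> N (T (psum f x n))" by (rule lower)
    also have "\<dots> = N (T (psum f x n - J x) + T (J x))"
      using bounded_op_diff[OF T sub psum_in J(1)[OF x], of x n] by simp
    also have "\<dots> \<le> N (T (psum f x n - J x)) + N (T (J x))"
      by (intro N_add bounded_op_in[OF T] i J x)
    finally show ?thesis using K(2)[OF i] by simp
  qed
  have "c * lp_norm q x \<le> K * 0 + N (T (J x))"
    by (rule LIMSEQ_le[OF 1 2]) (use 3 in auto)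
  then show ?thesis by simp
qed

definition M :: "('i \<Rightarrow> complex) set" where "M = J ` lp_space q"

lemma bounded_J: "bounded_op (lp_space q) (lp_norm q) M N J"
  unfolding bounded_op_def M_def using J_add J_scale J_upper by blast

lemma M_sub_X: "M \<subseteq> X" using J by (auto simp: M_def)

lemma subspace_M: "cfun.subspace M"
proof (rule cfun.subspaceI)
  note s = subspace_lp_space[OF q]
  have "psum f 0 n = 0" for n by (simp add: psum_def)
  then have "J 0 = 0"
    by (intro J_eqI cfun.subspace_0[OF s] cfun.subspace_0[OF sub]) (simp only: diff_self N_zero tendsto_const)
  then show "0 \<in> M" unfolding M_def using cfun.subspace_0[OF s] by (metis imageI)
  show "x + y \<in> M" if "x \<in> M" "y \<in> M" for x y
    using that unfolding M_def by (auto simp: J_add[symmetric] cfun.subspace_add[OF s])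
  show "scale_fun a x \<in> M" if "x \<in> M" for x a
    using that unfolding M_def by (auto simp: J_scale[symmetric] cfun.subspace_scale[OF s])
qed

lemma J_diff:
  assumes x: "x \<in> lp_space q" and y: "y \<in> lp_space q"
  shows "J (x - y) = J x - J y"
  by (rule bounded_op_diff[OF bounded_J subspace_lp_space[OF q] x y])

lemma lower_X:
  obtains K where "K > 0" "\<And>x. x \<in> lp_space q \<Longrightarrow> lp_norm q x \<le> K * N (J x)"
proof -
  obtain K where K: "K > 0" "\<And>f. f \<in> X \<Longrightarrow> N (T f) \<le> K * N f"
    using bounded_op_bound[OF T] nonneg' by blast
  show thesis
  proof (rule that[of "K/c"])
    fix x assume x: "x \<in> lp_space q"
    have "c * lp_norm q x \<le> K * N (J x)" using J_lower[OF x] K(2)[OF J(1)[OF x]] by simp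
    then show "lp_norm q x \<le> K / c * N (J x)" using c by (simp add: field_simps)
  qed (use K c in auto)
qed

text \<open>By the lower bound the preimages of a convergent sequence are Cauchy, and completeness
  of the sequence space supplies a preimage of its limit.\<close>

lemma closedin_M: "closedin mtopology M"
  unfolding metric_closedin_iff_sequentially_closed
proof (intro conjI allI impI M_sub_X)
  fix \<sigma> l assume "range \<sigma> \<subseteq> M \<and> limitin mtopology \<sigma> l sequentially"
  then have r: "range \<sigma> \<subseteq> M" and lim: "limitin mtopology \<sigma> l sequentially" by auto
  have "\<exists>x. x \<in> lp_space q \<and> \<sigma> n = J x" for n using r by (auto simp: M_def)
  then obtain u where u: "\<And>n. u n \<in> lp_space q" "\<And>n. \<sigma> n = J (u n)" by metis
  obtain K where K: "K > 0" "\<And>x. x \<in> lp_space q \<Longrightarrow> lp_norm q x \<le> K * N (J x)" using lower_X by blast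
  have \<sigma>X: "\<sigma> n \<in> X" for n using r M_sub_X by auto
  have lX: "l \<in> X" and l0: "(\<lambda>n. N (\<sigma> n - l)) \<longlonglongrightarrow> 0"
    using lim by (auto simp: limitin_iff)
  have "\<exists>x\<in>lp_space q. (\<lambda>n. lp_norm q (u n - x)) \<longlonglongrightarrow> 0"
  proof (rule lp_space_complete[OF q u(1)])
    fix e :: real assume e: "e > 0"
    have "eventually (\<lambda>n. N (\<sigma> n - l) < e / (2 * K)) sequentially"
      using l0 e K by (intro order_tendstoD) auto
    then obtain M where M: "\<And>n. n \<ge> M \<Longrightarrow> N (\<sigma> n - l) < e / (2 * K)"
      unfolding eventually_sequentially by blast
    show "\<exists>M. \<forall>m\<ge>M. \<forall>n\<ge>M. lp_norm q (u m - u n) < e"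
    proof (intro exI[of _ M] allI impI)
      fix m n assume mn: "M \<le> m" "M \<le> n"
      have "lp_norm q (u m - u n) \<le> K * N (\<sigma> m - \<sigma> n)"
        using K(2)[OF cfun.subspace_diff[OF subspace_lp_space[OF q] u(1)[of m] u(1)[of n]]]
        by (simp add: J_diff[OF u(1) u(1)] u(2))
      also have "\<dots> \<le> K * (N (\<sigma> m - l) + N (\<sigma> n - l))"
        using K triangle'[of "\<sigma> m" l "\<sigma> n"] \<sigma>X lX by (intro mult_left_mono) auto
      also have "\<dots> < K * (e / (2 * K) + e / (2 * K))"
        using K M[OF mn(1)] M[OF mn(2)] by (intro mult_strict_left_mono) auto
      also have "\<dots> = e" using K by (simp add: field_simps)
      finally show "lp_norm q (u m - u n) < e" .
    qed
  qed
  then obtain x where x: "x \<in> lp_space q" and ux: "(\<lambda>n. lp_norm q (u n - x)) \<longlonglongrightarrow> 0" by blast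
  have "J x = l"
  proof (rule limit_unique[OF \<sigma>X J(1)[OF x] lX _ l0])
    have *: "(\<lambda>n. C * lp_norm q (u n - x)) \<longlonglongrightarrow> 0"
      using tendsto_mult[OF tendsto_const ux, of C] by simp
    show "(\<lambda>n. N (\<sigma> n - J x)) \<longlonglongrightarrow> 0"
    proof (rule tendsto_sandwich[OF _ _ tendsto_const *])
      have "N (\<sigma> n - J x) \<le> C * lp_norm q (u n - x)" for n
        using J_upper[OF cfun.subspace_diff[OF subspace_lp_space[OF q] u(1)[of n] x]] J_diff[OF u(1)[of n] x] u(2) by simp
      then show "\<forall>\<^sub>F n in sequentially. N (\<sigma> n - J x) \<le> C * lp_norm q (u n - x)" by simp
    qed (simp add: nonneg')
  qed
  then show "l \<in> M" using x by (auto simp: M_def)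
qed

lemma closed_subspace_M: "closed_subspace X N M"
  by (simp add: closed_subspace_def M_sub_X subspace_M mtopology_eq closedin_M)

lemma isomorphism_J: "isomorphism (lp_space q) (lp_norm q) M N J"
proof -
  obtain K where K: "K > 0" "\<And>x. x \<in> lp_space q \<Longrightarrow> lp_norm q x \<le> K * N (J x)" using lower_X by blast
  show ?thesis
  proof (rule isomorphismI[OF bounded_J subspace_lp_space[OF q]])
    show "x = 0" if "x \<in> lp_space q" "lp_norm q x \<le> 0" for x
    proof
      fix k
      have "norm (x k) \<le> 0" using lp_coord_le[OF _ that(1), of k] that(2) q by linarith
      then show "x k = 0 k" by simp
    qed
  qed (use K N_zero in \<open>auto simp: M_def\<close>)
qed

lemma isomorphism_T: "isomorphism M N (T ` M) N T"
proof (rule isomorphismI[OF _ subspace_M])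
  show "bounded_op M N (T ` M) N T"
    using T M_sub_X unfolding bounded_op_def by blast
  show "N h \<le> C / c * N (T h)" if h: "h \<in> M" for h
  proof -
    obtain x where x: "x \<in> lp_space q" "h = J x" using h by (auto simp: M_def)
    have "c * N h \<le> c * (C * lp_norm q x)" using J_upper[OF x(1)] x c by simp
    also have "\<dots> = C * (c * lp_norm q x)" by simp
    also have "\<dots> \<le> C * N (T h)" using J_lower[OF x(1)] x C by simp
    finally show ?thesis using c by (simp add: field_simps)
  qed
  show "h = 0" if "h \<in> M" "N h \<le> 0" for h
    using that M_sub_X nonneg'[of h] by (intro definite) auto
qed (auto simp: N_zero)

theorem fixes_lp_copy: "fixes_copy X N X N T (lp_space q) (lp_norm q)"
  unfolding fixes_copy_def using T closed_subspace_M isomorphism_J isomorphism_T by blast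

lemma delta_in_lp: "(\<lambda>k. if k = j then a else 0) \<in> lp_space q"
proof -
  have "summable (\<lambda>n. norm (if n = j then a else 0) powr q)"
    by (rule summable_finite[of "{j}"]) auto
  then show ?thesis by (simp add: lp_space_def)
qed

lemma f_in_M: "f j \<in> M"
proof -
  have "J (\<lambda>k. if k = j then 1 else 0) = f j"
  proof (rule J_eqI[OF delta_in_lp f])
    have "eventually (\<lambda>n. N (psum f (\<lambda>k. if k = j then 1 else 0) n - f j) = 0) sequentially"
      using eventually_gt_at_top[of j] by eventually_elim (simp add: psum_delta N_zero)
    then show "(\<lambda>n. N (psum f (\<lambda>k. if k = j then 1 else 0) n - f j)) \<longlonglongrightarrow> 0"
      by (rule tendsto_eventually)
  qed
  then show ?thesis using delta_in_lp by (metis M_def imageI)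
qed

lemma psum_eq_0:
  assumes "psum f x n = 0" "k < n"
  shows "x k = 0"
proof -
  have "c * (\<Sum>k<n. norm (x k) powr q) powr (1/q) \<le> 0"
    using lower[of x n] assms bounded_op_zero[OF T sub] N_zero by simp
  then have "(\<Sum>k<n. norm (x k) powr q) powr (1/q) \<le> 0" using c by (simp add: mult_le_0_iff)
  then have "(\<Sum>k<n. norm (x k) powr q) = 0" by (metis powr_eq_0_iff powr_ge_zero antisym)
  then show ?thesis using assms by (subst (asm) sum_nonneg_eq_0_iff) auto
qed

text \<open>The difference of two unit vectors has norm at least 1. This separation of the images
  yields injectivity of \<open>f\<close> and excludes compactness.\<close>

lemma dist_T_f:
  assumes "i \<noteq> j"
  shows "c \<le> N (T (f i) - T (f j))"
proof -
  define x :: "nat \<Rightarrow> complex" where "x = (\<lambda>k. if k = i then 1 else 0) - (\<lambda>k. if k = j then 1 else 0)"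
  define n where "n = Suc (max i j)"
  have n: "i < n" "j < n" by (auto simp: n_def)
  have "1 = norm (x i) powr q" using assms by (simp add: x_def)
  also have "\<dots> \<le> (\<Sum>k<n. norm (x k) powr q)" using n by (intro member_le_sum) auto
  finally have "1 powr (1/q) \<le> (\<Sum>k<n. norm (x k) powr q) powr (1/q)"
    using q by (intro powr_mono2) auto
  then have "c * 1 \<le> c * (\<Sum>k<n. norm (x k) powr q) powr (1/q)" using c by (intro mult_left_mono) auto
  also have "\<dots> \<le> N (T (psum f x n))" by (rule lower)
  also have "psum f x n = f i - f j" unfolding x_def psum_diff psum_delta using n by simp
  finally show ?thesis by (simp only: bounded_op_diff[OF T sub f f])
qed

lemma inj_f: "inj f"
proof (rule injI, rule ccontr)
  fix i j assume "f i = f j" "i \<noteq> j"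
  then show False using dist_T_f[of i j] c N_zero by simp
qed

text \<open>A finite spanning set \<open>B\<close> would leave no room for
  \<open>Suc (card B)\<close> of the functions \<open>f k\<close>, which the lower bound makes
  independent through \<open>psum_eq_0\<close>.\<close>

lemma infinite_dimensional_M: "infinite_dimensional M"
  unfolding infinite_dimensional_def
proof (rule notI, elim exE conjE)
  fix B assume B: "finite B" "M \<subseteq> cfun.span B"
  define n where "n = Suc (card B)"
  have "cfun.independent (f ` {..<n})"
  proof (rule cfun.independent_if_scalars_zero)
    fix a x assume "(\<Sum>x\<in>f ` {..<n}. scale_fun (a x) x) = 0" "x \<in> f ` {..<n}"
    then have "psum f (\<lambda>k. a (f k)) n = 0" unfolding psum_def
      by (subst (asm) sum.reindex) (auto intro: inj_on_subset[OF inj_f])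
    then show "a x = 0" using psum_eq_0 \<open>x \<in> f ` {..<n}\<close> by fastforce
  qed auto
  moreover have "f ` {..<n} \<subseteq> cfun.span B" using f_in_M B by auto
  ultimately have "card (f ` {..<n}) \<le> card B" using cfun.independent_span_bound[OF B(1)] by blast
  then show False by (simp add: card_image[OF inj_on_subset[OF inj_f]] n_def)
qed

theorem not_strictly_singular: "\<not> strictly_singular X N X N T"
  unfolding strictly_singular_def
  using closed_subspace_M infinite_dimensional_M isomorphism_T by blast

text \<open>Division by \<open>C\<close> puts all \<open>f k\<close> into the unit ball; their
  images stay at mutual distance \<open>c / C\<close>, so no subsequence converges.\<close>

theorem not_compact: "\<not> compact_op X N X N T"
proof
  assume "compact_op X N X N T"
  then have comp: "compactin mtopology (mtopology closure_of (T ` {f \<in> X. N f \<le> 1}))"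
    by (simp add: compact_op_def mtopology_eq)
  define h where "h k = scale_fun (1 / of_real C) (f k)" for k
  have hX: "h k \<in> X" for k unfolding h_def by (intro cfun.subspace_scale[OF sub] f)
  have Nf: "N (f k) \<le> C" for k
  proof -
    have "N (psum f (\<lambda>j. if j = k then 1 else 0) (Suc k)) \<le> C * (\<Sum>j<Suc k. norm ((if j = k then 1 else 0) :: complex) powr q) powr (1/q)"
      by (rule upper)
    also have "(\<Sum>j<Suc k. norm ((if j = k then 1 else 0) :: complex) powr q) = 1"
      using sum.delta[of "{..<Suc k}" k "\<lambda>_. 1::real"] by (simp add: if_distrib[of norm] if_distrib[of "\<lambda>x. x powr q"] cong: if_cong)
    finally show ?thesis by (simp add: psum_delta)
  qed
  have "N (h k) \<le> 1" for k
    unfolding h_def using Nf[of k] C f by (simp add: N_scale norm_divide)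
  then have "range (\<lambda>k. T (h k)) \<subseteq> T ` {f \<in> X. N f \<le> 1}" using hX by auto
  also have "\<dots> \<subseteq> mtopology closure_of (T ` {f \<in> X. N f \<le> 1})"
    by (rule closure_of_subset) (auto intro: bounded_op_in[OF T])
  finally obtain l r where lr: "strict_mono r" "limitin mtopology ((\<lambda>k. T (h k)) \<circ> r) l sequentially"
    using comp unfolding compactin_sequentially by meson
  have d: "c / C \<le> N (T (h i) - T (h j))" if "i \<noteq> j" for i j
  proof -
    have "T (h i) - T (h j) = scale_fun (1 / of_real C) (T (f i) - T (f j))"
      unfolding h_def bounded_op_scale[OF T f] cfun.scale_right_diff_distrib ..
    then have "N (T (h i) - T (h j)) = norm (1 / complex_of_real C) * N (T (f i) - T (f j))"
      using N_scale[OF cfun.subspace_diff[OF sub bounded_op_in[OF T f] bounded_op_in[OF T f]]] by (simp only:)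
    then show ?thesis using dist_T_f[OF that] C by (simp add: norm_divide divide_right_mono)
  qed
  have lX: "l \<in> X" and l0: "(\<lambda>n. N (T (h (r n)) - l)) \<longlonglongrightarrow> 0" using lr by (auto simp: limitin_iff o_def)
  have "eventually (\<lambda>n. N (T (h (r n)) - l) < c / C / 2) sequentially"
    using l0 c C by (intro order_tendstoD) auto
  then obtain m where m: "\<And>n. n \<ge> m \<Longrightarrow> N (T (h (r n)) - l) < c / C / 2"
    unfolding eventually_sequentially by blast
  have "r m \<noteq> r (Suc m)" using lr(1) by (metis strict_mono_Suc_iff less_irrefl)
  then have "c / C \<le> N (T (h (r m)) - T (h (r (Suc m))))" by (rule d)
  also have "\<dots> \<le> N (T (h (r m)) - l) + N (T (h (r (Suc m))) - l)"
    by (rule triangle') (auto intro: bounded_op_in[OF T] hX lX)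
  also have "\<dots> < c / C / 2 + c / C / 2" by (intro add_strict_mono m) auto
  finally show False by simp
qed

end

section \<open>The Volterra operator and peaking functions\<close>

lemma volterra_op_primitive:
  assumes f: "f holomorphic_on ball 0 1" and g: "g holomorphic_on ball 0 1"
  obtains \<Phi> where "\<And>z. z \<in> ball 0 1 \<Longrightarrow> (\<Phi> has_field_derivative deriv f z * g z) (at z)"
    and "\<And>z. z \<in> ball 0 1 \<Longrightarrow> volterra_op g f z = \<Phi> z - \<Phi> 0"
proof -
  have h: "(\<lambda>w. deriv f w * g w) holomorphic_on ball 0 1"
    by (intro holomorphic_intros holomorphic_deriv f g) auto
  obtain \<Phi> where \<Phi>: "\<And>z. z \<in> ball 0 1 \<Longrightarrow> (\<Phi> has_field_derivative deriv f z * g z) (at z within ball 0 1)"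
    by (rule holomorphic_convex_primitive'[OF convex_ball open_ball h]) blast
  show thesis
  proof (rule that[of \<Phi>])
    show "(\<Phi> has_field_derivative deriv f z * g z) (at z)" if "z \<in> ball 0 1" for z
      using \<Phi>[OF that] that at_within_open[OF that open_ball] by simp
    fix z :: complex assume z: "z \<in> ball 0 1"
    have "((\<lambda>w. deriv f w * g w) has_contour_integral (\<Phi> (pathfinish (linepath 0 z)) - \<Phi> (pathstart (linepath 0 z)))) (linepath 0 z)"
      using z closed_segment_subset[of 0 "ball 0 1" z] by (intro contour_integral_primitive[OF \<Phi>]) auto
    then show "volterra_op g f z = \<Phi> z - \<Phi> 0"
      using z by (simp add: volterra_op_def contour_integral_unique)
  qed
qed

lemma volterra_op_deriv:
  assumes "f holomorphic_on ball 0 1" "g holomorphic_on ball 0 1" "z \<in> ball 0 1"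
  shows "(volterra_op g f has_field_derivative deriv f z * g z) (at z)"
proof -
  obtain \<Phi> where \<Phi>: "\<And>z. z \<in> ball 0 1 \<Longrightarrow> (\<Phi> has_field_derivative deriv f z * g z) (at z)"
    "\<And>z. z \<in> ball 0 1 \<Longrightarrow> volterra_op g f z = \<Phi> z - \<Phi> 0"
    using volterra_op_primitive[OF assms(1,2)] by blast
  have "((\<lambda>z. \<Phi> z - \<Phi> 0) has_field_derivative deriv f z * g z) (at z)"
    using \<Phi>(1)[OF assms(3)] by (auto intro!: derivative_eq_intros)
  then show ?thesis
    by (rule DERIV_cong_ev[OF refl _ refl, THEN iffD2, rotated])
       (use assms(3) \<Phi>(2) in \<open>auto intro!: eventually_mono[OF eventually_nhds_in_open[of "ball 0 1"]]\<close>)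
qed

text \<open>The defining integral runs along a radius, so smallness of the derivative of
  \<open>f\<close> times \<open>g\<close> on one radius is inherited by the image there. This is why
  images of peaks are as localized as the peaks.\<close>

lemma volterra_op_bound:
  assumes f: "f holomorphic_on ball 0 1" and g: "g holomorphic_on ball 0 1"
    and xi: "norm \<xi> = 1" "0 \<le> r" "r < 1"
    and B: "\<And>t. 0 \<le> t \<Longrightarrow> t < 1 \<Longrightarrow> norm (deriv f (of_real t * \<xi>) * g (of_real t * \<xi>)) \<le> B"
  shows "norm (volterra_op g f (of_real r * \<xi>)) \<le> B"
proof -
  let ?z = "of_real r * \<xi>"
  have B0: "B \<ge> 0" using order_trans[OF norm_ge_zero B[of 0]] by simp
  have z: "?z \<in> ball 0 1" using xi by (simp add: norm_mult)
  have seg: "closed_segment 0 ?z \<subseteq> ball 0 1" using z closed_segment_subset[of 0 "ball 0 1" ?z] by auto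
  have h: "(\<lambda>w. deriv f w * g w) holomorphic_on ball 0 1"
    by (intro holomorphic_intros holomorphic_deriv f g) auto
  have "norm (contour_integral (linepath 0 ?z) (\<lambda>w. deriv f w * g w)) \<le> B * norm (?z - 0)"
  proof (rule contour_integral_bound_linepath[OF _ B0])
    show "(\<lambda>w. deriv f w * g w) contour_integrable_on linepath 0 ?z"
      by (intro contour_integrable_continuous_linepath continuous_on_subset[OF holomorphic_on_imp_continuous_on[OF h] seg])
    fix w assume "w \<in> closed_segment 0 ?z"
    then obtain u where u: "0 \<le> u" "u \<le> 1" "w = of_real (u * r) * \<xi>"
      by (auto simp: in_segment scaleR_conv_of_real mult_ac)
    have "u * r \<le> 1 * r" using u xi by (intro mult_right_mono) auto
    then show "norm (deriv f w * g w) \<le> B" unfolding u(3) using u xi by (intro B) auto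
  qed
  also have "\<dots> \<le> B" using xi B0 by (simp add: norm_mult mult_left_le)
  finally show ?thesis using z by (simp add: volterra_op_def)
qed

lemma banach_hardy_space:
  assumes p: "1 \<le> p"
  shows "banach_fun_space (hardy_space p) (hardy_norm p)"
proof
  show "cfun.subspace (hardy_space p)" by (rule subspace_hardy_space[OF p])
  show "\<exists>l\<in>hardy_space p. (\<lambda>n. hardy_norm p (u n - l)) \<longlonglongrightarrow> 0"
    if "\<And>n. u n \<in> hardy_space p" "\<And>e. e > 0 \<Longrightarrow> \<exists>M. \<forall>m\<ge>M. \<forall>n\<ge>M. hardy_norm p (u m - u n) < e" for u
    by (rule hardy_space_complete[OF p that])
qed (use p in \<open>auto simp: hardy_norm_diff_commute hardy_space_zero intro: hardy_norm_eq_0 hardy_space_add hardy_space_scale\<close>)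

text \<open>The exponents make \<open>\<bar>peak p a\<bar> powr p\<close> a function dominated on each circle by the Poisson
  kernel of a point below \<open>a\<close>.\<close>

definition peak :: "real \<Rightarrow> complex \<Rightarrow> complex \<Rightarrow> complex" where
  "peak p a z = (if norm z < 1 then of_real ((1 - norm a) powr (2 - 1/p)) / (1 - cnj a * z) ^ 2 else 0)"

lemma norm_one_minus_cnj_ge:
  assumes "norm z \<le> 1"
  shows "1 - norm a \<le> norm (1 - cnj a * z)"
proof -
  have "norm (cnj a * z) \<le> norm a" using assms by (simp add: norm_mult mult_left_le)
  then show ?thesis using norm_triangle_ineq2[of 1 "cnj a * z"] by simp
qed

text \<open>A radius whose endpoint is far from a peak stays far from it, up to the factor 2:
  \<open>norm (1 - w)\<close> is at most \<open>norm (1 - t * w) + (1 - t) * norm w\<close>, and the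
  second term is again at most \<open>norm (1 - t * w)\<close>.\<close>

lemma norm_one_minus_scaled_ge:
  fixes w :: complex
  assumes "norm w \<le> 1" "0 \<le> t" "t \<le> 1"
  shows "norm (1 - w) / 2 \<le> norm (1 - of_real t * w)"
proof -
  have tw: "t * norm w \<le> t" using assms by (intro mult_left_le) auto
  have "1 - t * norm w \<le> norm (1 - of_real t * w)"
    using norm_triangle_ineq2[of 1 "of_real t * w"] assms by (simp add: norm_mult)
  moreover have "norm (1 - w) \<le> norm (1 - of_real t * w) + (1 - t) * norm w"
  proof -
    have "1 - w = (1 - of_real t * w) - of_real (1 - t) * w" by (simp add: algebra_simps)
    then have "norm (1 - w) \<le> norm (1 - of_real t * w) + norm (of_real (1 - t) * w)"
      by (metis norm_triangle_ineq4)
    then show ?thesis using assms by (simp add: norm_mult norm_of_real del: of_real_diff)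
  qed
  moreover have "(1 - t) * norm w \<le> 1 - t" using assms by (intro mult_left_le) auto
  moreover have "1 - t \<le> 1 - t * norm w" using tw by simp
  ultimately show ?thesis by linarith
qed

lemma one_minus_cnj_nonzero:
  assumes "norm a < 1" "norm z \<le> 1"
  shows "1 - cnj a * z \<noteq> 0"
  using norm_one_minus_cnj_ge[OF assms(2), of a] assms(1) by auto

lemma peak_holomorphic:
  assumes a: "norm a < 1"
  shows "peak p a holomorphic_on ball 0 1"
proof -
  have "(\<lambda>z. of_real ((1 - norm a) powr (2 - 1/p)) / (1 - cnj a * z) ^ 2) holomorphic_on ball 0 1"
    using one_minus_cnj_nonzero[OF a] by (intro holomorphic_intros) auto
  then show ?thesis by (rule holomorphic_transform) (simp add: peak_def)
qed

lemma peak_deriv: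
  assumes a: "norm a < 1" and z: "norm z < 1"
  shows "deriv (peak p a) z = of_real ((1 - norm a) powr (2 - 1/p)) * (2 * cnj a) / (1 - cnj a * z) ^ 3"
proof -
  let ?c = "of_real ((1 - norm a) powr (2 - 1/p)) :: complex"
  have alg: "(c * (2 * (E * b))) / (E ^ 2 * E ^ 2) = c * (2 * b) / E ^ 3" if "E \<noteq> 0" for E b c :: complex
    using that by (simp add: power2_eq_square power3_eq_cube)
  have "((\<lambda>z. ?c / (1 - cnj a * z) ^ 2) has_field_derivative
      (?c * (2 * ((1 - cnj a * z) * cnj a))) / ((1 - cnj a * z) ^ 2 * (1 - cnj a * z) ^ 2)) (at z)"
    using one_minus_cnj_nonzero[OF a, of z] z
    by (auto intro!: derivative_eq_intros)
  then have "((\<lambda>z. ?c / (1 - cnj a * z) ^ 2) has_field_derivative ?c * (2 * cnj a) / (1 - cnj a * z) ^ 3) (at z)"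
    unfolding alg[OF one_minus_cnj_nonzero[OF a less_imp_le[OF z]]] .
  then have "(peak p a has_field_derivative ?c * (2 * cnj a) / (1 - cnj a * z) ^ 3) (at z)"
    by (rule DERIV_cong_ev[OF refl _ refl, THEN iffD2, rotated])
       (use z in \<open>auto simp: peak_def intro!: eventually_mono[OF eventually_nhds_in_open[of "ball 0 1"]]\<close>)
  then show ?thesis by (rule DERIV_imp_deriv)
qed

lemma peak_hardy:
  assumes p: "1 \<le> p" and a: "norm a < 1"
  shows "peak p a \<in> hardy_space p" "hardy_norm p (peak p a) \<le> 1"
proof -
  define d where "d = 1 - norm a"
  have d: "0 < d" "d \<le> 1" using a by (auto simp: d_def)
  have bound: "slice_norm p (peak p a) r \<le> 1" if r: "0 \<le> r" "r < 1" for r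
  proof -
    let ?b = "of_real r * a"
    have b: "norm ?b < 1" "norm ?b \<le> norm a"
      using r a mult_strict_mono[of r 1 "norm a" 1] by (auto simp: norm_mult mult_left_le_one_le)
    \<comment> \<open>On the unit circle the kernel is the distance from \<open>?b = r * a\<close>,
      so the Poisson integral at \<open>?b\<close> applies.\<close>
    have eq: "norm (1 - cnj a * (of_real r * \<xi>)) = norm (\<xi> - ?b)" if "norm \<xi> = 1" for \<xi>
    proof -
      have "\<xi> * cnj \<xi> = 1" using that by (metis complex_norm_square of_real_1 power_one)
      then have "cnj (1 - cnj a * (of_real r * \<xi>)) * \<xi> = \<xi> - ?b"
        by (simp add: algebra_simps)
      then show ?thesis using that by (metis complex_mod_cnj mult.right_neutral norm_mult)
    qed
    have lb: "d \<le> norm (\<xi> - ?b)" if "norm \<xi> = 1" for \<xi>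
      using norm_one_minus_cnj_ge[of "of_real r * \<xi>" a] that r by (simp add: eq[OF that] d_def norm_mult)
    have pw: "norm (peak p a (of_real r * \<xi>)) powr p \<le> d * (1 / norm (\<xi> - ?b) ^ 2)" if n: "norm \<xi> = 1" for \<xi>
    proof -
      have pos: "norm (\<xi> - ?b) > 0" using lb[OF n] d by linarith
      have "norm (peak p a (of_real r * \<xi>)) = d powr (2 - 1/p) * norm (\<xi> - ?b) powr (-2)"
        using n r by (simp add: peak_def norm_mult norm_divide norm_power eq d_def powr_minus_divide powr_numeral)
      then have "norm (peak p a (of_real r * \<xi>)) powr p = d powr ((2 - 1/p) * p) * norm (\<xi> - ?b) powr (-2 * p)"
        by (simp add: powr_mult powr_powr)
      \<comment> \<open>The exponent is split so that \<open>d powr (2 * p - 2)\<close> cancels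
        against the same power of the distance, which is at least \<open>d\<close>; the Poisson
        factor with exponent \<open>-2\<close> remains.\<close>
      also have "(2 - 1/p) * p = 1 + (2 * p - 2)" using p by (simp add: field_simps)
      also have "norm (\<xi> - ?b) powr (-2 * p) = norm (\<xi> - ?b) powr (-2) * norm (\<xi> - ?b) powr (- (2 * p - 2))"
        by (simp add: powr_add[symmetric])
      also have "d powr (1 + (2 * p - 2)) * (norm (\<xi> - ?b) powr (-2) * norm (\<xi> - ?b) powr (- (2 * p - 2)))
          = (d * norm (\<xi> - ?b) powr (-2)) * (d powr (2 * p - 2) * norm (\<xi> - ?b) powr (- (2 * p - 2)))"
        using d by (subst powr_add) simp
      also have "\<dots> \<le> (d * norm (\<xi> - ?b) powr (-2)) * 1"
      proof (rule mult_left_mono)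
        have "d powr (2 * p - 2) \<le> norm (\<xi> - ?b) powr (2 * p - 2)"
          using lb[OF n] d p by (intro powr_mono2) auto
        then show "d powr (2 * p - 2) * norm (\<xi> - ?b) powr (- (2 * p - 2)) \<le> 1"
          using pos unfolding powr_minus_divide[of _ "2 * p - 2"] by (simp add: divide_le_eq)
      qed (use d in auto)
      finally show ?thesis using pos by (simp add: powr_minus_divide powr_numeral)
    qed
    have c: "continuous_on (sphere 0 1) (\<lambda>\<xi>. peak p a (of_real r * \<xi>))"
      by (intro continuous_on_slice holomorphic_on_imp_continuous_on peak_holomorphic a r)
    have c2: "continuous_on (sphere 0 1) (\<lambda>\<xi>. d * (1 / norm (\<xi> - ?b) ^ 2))"
      using lb d by (intro continuous_intros) force
    have "hardy_mean p (peak p a) r \<le> (LINT \<xi>|circle_measure. d * (1 / norm (\<xi> - ?b) ^ 2))"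
      unfolding hardy_mean_def using p pw
      by (intro integral_mono continuous_circle_integrable continuous_on_norm_powr c c2) auto
    also have "\<dots> = d / (1 - norm ?b ^ 2)"
      unfolding integral_mult_right_zero poisson_circle_integral[OF b(1)] by simp
    also have "\<dots> \<le> 1"
    proof -
      have "norm ?b ^ 2 \<le> norm ?b" using b by (simp add: power2_eq_square mult_left_le)
      then have "d \<le> 1 - norm ?b ^ 2" using b by (simp add: d_def)
      then show ?thesis using d by simp
    qed
    finally have "hardy_mean p (peak p a) r powr (1/p) \<le> 1 powr (1/p)"
      using p by (intro powr_mono2) auto
    then show ?thesis by (simp add: slice_norm_eq)
  qed
  show "peak p a \<in> hardy_space p" "hardy_norm p (peak p a) \<le> 1"
    using hardy_spaceI[OF peak_holomorphic[OF a] _ p bound] by (auto simp: peak_def)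
qed

text \<open>At \<open>a\<close> the kernel is \<open>1 - norm a ^ 2\<close>, at most twice
  \<open>1 - norm a\<close>. Its cube costs 8, the differentiation gains 2; hence the 4.\<close>

lemma peak_deriv_at_ge:
  assumes a: "norm a < 1"
  shows "norm a / 4 * (1 - norm a) powr (- (1 + 1/p)) \<le> norm (deriv (peak p a) a)"
proof -
  define d where "d = 1 - norm a"
  have d: "0 < d" "d \<le> 1" using a by (auto simp: d_def)
  have e: "norm (1 - cnj a * a) = 1 - norm a ^ 2"
  proof -
    have "1 - cnj a * a = of_real (1 - norm a ^ 2)" by (simp add: mult.commute flip: complex_norm_square)
    moreover have "norm a ^ 2 \<le> 1" using a by (simp add: power_le_one)
    ultimately show ?thesis by (simp only: norm_of_real abs_of_nonneg diff_ge_0_iff_ge)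
  qed
  have sq: "1 - norm a ^ 2 \<le> 2 * d" "1 - norm a ^ 2 > 0"
  proof -
    have "1 - norm a ^ 2 = d * (1 + norm a)" by (simp add: d_def power2_eq_square algebra_simps)
    moreover have "d * (1 + norm a) \<le> d * 2" using d a by (intro mult_left_mono) auto
    moreover have "0 < d * (1 + norm a)" using d by (intro mult_pos_pos add_pos_nonneg) auto
    ultimately show "1 - norm a ^ 2 \<le> 2 * d" "1 - norm a ^ 2 > 0" by linarith+
  qed
  have "norm a / 4 * d powr (- (1 + 1/p)) = (d powr (2 - 1/p) * (2 * norm a)) / (2 * d) ^ 3"
  proof -
    have "d powr (- (1 + 1/p)) = d powr ((2 - 1/p) - 3)" by simp
    also have "\<dots> = d powr (2 - 1/p) / d ^ 3" using d by (subst powr_diff) (simp add: powr_numeral)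
    finally show ?thesis by (simp add: power_mult_distrib)
  qed
  also have "\<dots> \<le> (d powr (2 - 1/p) * (2 * norm a)) / (1 - norm a ^ 2) ^ 3"
    using sq d by (intro divide_left_mono power_mono mult_pos_pos) auto
  also have "\<dots> = norm (deriv (peak p a) a)"
    using peak_deriv[OF a a, of p] by (simp add: norm_mult norm_divide norm_power e d_def)
  finally show ?thesis by (simp add: d_def)
qed

text \<open>The derivative of the image at \<open>a\<close> is the derivative of the peak times
  \<open>g a\<close>. Both derivative estimates carry the power \<open>- (1 + 1/p)\<close> of
  \<open>1 - norm a\<close>, which cancels. The constant is the 4 of \<open>peak_deriv_at_ge\<close>
  times the bound 4 for \<open>2 powr (1 + 1/p)\<close>.\<close>

lemma volterra_peak_lower:
  assumes p: "1 \<le> p" and g: "g holomorphic_on ball 0 1" and a: "norm a < 1"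
    and T: "volterra_op g (peak p a) \<in> hardy_space p"
  shows "norm a * norm (g a) \<le> 16 * hardy_norm p (volterra_op g (peak p a))"
proof -
  define d where "d = 1 - norm a"
  have d: "0 < d" "d \<le> 1" using a by (auto simp: d_def)
  let ?F = "volterra_op g (peak p a)" and ?s = "1 + 1/p"
  have "(norm a / 4 * d powr (- ?s)) * norm (g a) \<le> norm (deriv (peak p a) a) * norm (g a)"
    unfolding d_def by (intro mult_right_mono peak_deriv_at_ge a) auto
  also have "\<dots> = norm (deriv ?F a)"
    using DERIV_imp_deriv[OF volterra_op_deriv[OF peak_holomorphic[OF a] g, of a]] a by (simp add: norm_mult)
  also have "\<dots> \<le> (2 / d) powr ?s * hardy_norm p ?F"
    unfolding d_def by (rule hardy_deriv_bound[OF T p a])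
  also have "(2 / d) powr ?s = 2 powr ?s * d powr (- ?s)"
    using d by (simp only: powr_divide powr_minus) (simp add: field_simps)
  also have "2 powr ?s * d powr (- ?s) * hardy_norm p ?F \<le> 4 * d powr (- ?s) * hardy_norm p ?F"
  proof (intro mult_right_mono)
    have "2 powr ?s \<le> 2 powr 2" using p by (intro powr_mono) auto
    then show "2 powr ?s \<le> 4" by simp
  qed auto
  finally have le: "(norm a / 4 * d powr (- ?s)) * norm (g a) \<le> 4 * d powr (- ?s) * hardy_norm p ?F" .
  define X where "X = d powr (- ?s)"
  have "X > 0" using d by (simp add: X_def)
  moreover have "X * (norm a * norm (g a)) \<le> X * (16 * hardy_norm p ?F)"
    using le unfolding X_def[symmetric] by (simp add: mult_ac)
  ultimately show ?thesis by simp
qed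

section \<open>Gliding humps\<close>

lemma Lnorm_sum:
  fixes f :: "nat \<Rightarrow> 'a \<Rightarrow> complex"
  assumes p: "1 \<le> p" and m: "\<And>k. k < n \<Longrightarrow> f k \<in> borel_measurable M"
    and i: "\<And>k. k < n \<Longrightarrow> integrable M (\<lambda>x. norm (f k x) powr p)"
  shows "integrable M (\<lambda>x. norm (\<Sum>k<n. f k x) powr p) \<and> Lnorm p M (\<lambda>x. \<Sum>k<n. f k x) \<le> (\<Sum>k<n. Lnorm p M (f k))"
  using m i
proof (induction n)
  case 0 then show ?case using p by (simp add: Lnorm_def)
next
  case (Suc n)
  then have IH: "integrable M (\<lambda>x. norm (\<Sum>k<n. f k x) powr p)" "Lnorm p M (\<lambda>x. \<Sum>k<n. f k x) \<le> (\<Sum>k<n. Lnorm p M (f k))"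
    and m: "(\<lambda>x. \<Sum>k<n. f k x) \<in> borel_measurable M" by auto
  show ?case
    unfolding sum.lessThan_Suc
    using powr_integrable_add[OF p m Suc.prems(1)[of n] IH(1) Suc.prems(2)[of n]]
      Lnorm_triangle[OF p m Suc.prems(1)[of n] IH(1) Suc.prems(2)[of n]] IH(2) by auto
qed

lemma Lnorm_disjoint_sum:
  fixes h :: "nat \<Rightarrow> 'a \<Rightarrow> complex"
  assumes p: "1 \<le> p"
    and i: "\<And>k. k < n \<Longrightarrow> integrable M (\<lambda>x. norm (h k x) powr p)"
    and disj: "\<And>x j k. j < n \<Longrightarrow> k < n \<Longrightarrow> j \<noteq> k \<Longrightarrow> h j x = 0 \<or> h k x = 0"
  shows "Lnorm p M (\<lambda>x. \<Sum>k<n. h k x) powr p = (\<Sum>k<n. Lnorm p M (h k) powr p)"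
proof -
  have "norm (\<Sum>k<n. h k x) powr p = (\<Sum>k<n. norm (h k x) powr p)" for x
  proof (cases "\<exists>j<n. h j x \<noteq> 0")
    case True
    then obtain j where j: "j < n" "h j x \<noteq> 0" by auto
    have z: "h k x = 0" if "k < n" "k \<noteq> j" for k using disj[of k j x] that j by auto
    have "(\<Sum>k<n. h k x) = (\<Sum>k\<in>{j}. h k x)" using j z by (intro sum.mono_neutral_right) auto
    moreover have "(\<Sum>k<n. norm (h k x) powr p) = (\<Sum>k\<in>{j}. norm (h k x) powr p)"
      using j z p by (intro sum.mono_neutral_right) auto
    ultimately show ?thesis by simp
  qed (use p in auto)
  then show ?thesis using p i by (simp add: Lnorm_powr)
qed

text \<open>Each \<open>h k\<close> splits into its restriction to \<open>A k\<close> and a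
  remainder of norm at most \<open>e k\<close>. The restrictions have disjoint supports, so the
  \<open>p\<close>-th powers of their norms add exactly, and the remainders are summed by the
  triangle inequality.\<close>

lemma
  fixes h :: "nat \<Rightarrow> 'a \<Rightarrow> complex" and A :: "nat \<Rightarrow> 'a set" and x :: "nat \<Rightarrow> complex"
  assumes p: "1 \<le> p" and hm: "\<And>k. k < n \<Longrightarrow> h k \<in> borel_measurable M"
    and hi: "\<And>k. k < n \<Longrightarrow> integrable M (\<lambda>\<xi>. norm (h k \<xi>) powr p)"
    and A: "\<And>k. k < n \<Longrightarrow> A k \<in> sets M"
    and disj: "\<And>j k. j < n \<Longrightarrow> k < n \<Longrightarrow> j \<noteq> k \<Longrightarrow> A j \<inter> A k = {}"
    and small: "\<And>k. k < n \<Longrightarrow> Lnorm p M (\<lambda>\<xi>. indicator (- A k) \<xi> * h k \<xi>) \<le> e k"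
  shows gliding_hump_upper: "Lnorm p M (\<lambda>\<xi>. \<Sum>k<n. x k * h k \<xi>) \<le>
      (\<Sum>k<n. (norm (x k) * Lnorm p M (h k)) powr p) powr (1/p) + (\<Sum>k<n. norm (x k) * e k)"
    and gliding_hump_lower: "(\<And>k. k < n \<Longrightarrow> \<gamma> + e k \<le> Lnorm p M (h k)) \<Longrightarrow> \<gamma> \<ge> 0 \<Longrightarrow>
      \<gamma> * (\<Sum>k<n. norm (x k) powr p) powr (1/p) \<le> Lnorm p M (\<lambda>\<xi>. \<Sum>k<n. x k * h k \<xi>) + (\<Sum>k<n. norm (x k) * e k)"
proof -
  define u where "u k = (\<lambda>\<xi>. indicator (A k) \<xi> * h k \<xi>)" for k
  define v where "v k = (\<lambda>\<xi>. indicator (- A k) \<xi> * h k \<xi>)" for k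
  have uv: "h k \<xi> = u k \<xi> + v k \<xi>" for k \<xi>
    by (simp add: u_def v_def indicator_def)
  have um: "u k \<in> borel_measurable M" "v k \<in> borel_measurable M" if "k < n" for k
  proof -
    note [measurable] = hm[OF that] A[OF that]
    show "u k \<in> borel_measurable M" unfolding u_def by measurable
    have "v k = (\<lambda>\<xi>. h k \<xi> - u k \<xi>)" by (simp add: uv)
    then show "v k \<in> borel_measurable M" unfolding u_def by simp
  qed
  have ui: "integrable M (\<lambda>\<xi>. norm (u k \<xi>) powr p)" "integrable M (\<lambda>\<xi>. norm (v k \<xi>) powr p)" if "k < n" for k
    using p um[OF that]
    by (intro Bochner_Integration.integrable_bound[OF hi[OF that]]; auto simp: u_def v_def indicator_def)+
  have xm: "(\<lambda>\<xi>. x k * u k \<xi>) \<in> borel_measurable M" "(\<lambda>\<xi>. x k * v k \<xi>) \<in> borel_measurable M" if "k < n" for k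
    using um[OF that] by measurable
  have xi: "integrable M (\<lambda>\<xi>. norm (x k * u k \<xi>) powr p)" "integrable M (\<lambda>\<xi>. norm (x k * v k \<xi>) powr p)" if "k < n" for k
    using ui[OF that] by (auto simp: norm_mult powr_mult)
  define D where "D = (\<lambda>\<xi>. \<Sum>k<n. x k * u k \<xi>)"
  define R where "R = (\<lambda>\<xi>. \<Sum>k<n. x k * v k \<xi>)"
  have Dm: "D \<in> borel_measurable M" "R \<in> borel_measurable M"
    unfolding D_def R_def using xm by (auto intro!: borel_measurable_sum)
  have Di: "integrable M (\<lambda>\<xi>. norm (D \<xi>) powr p)" "integrable M (\<lambda>\<xi>. norm (R \<xi>) powr p)"
    unfolding D_def R_def using Lnorm_sum[OF p xm(1) xi(1)] Lnorm_sum[OF p xm(2) xi(2)] by auto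
  have p0: "p > 0" using p by simp
  have R: "Lnorm p M R \<le> (\<Sum>k<n. norm (x k) * e k)"
  proof -
    have "Lnorm p M R \<le> (\<Sum>k<n. Lnorm p M (\<lambda>\<xi>. x k * v k \<xi>))"
      unfolding R_def using Lnorm_sum[OF p xm(2) xi(2)] by auto
    also have "\<dots> = (\<Sum>k<n. norm (x k) * Lnorm p M (v k))" using p0 by (simp add: Lnorm_cmult)
    also have "\<dots> \<le> (\<Sum>k<n. norm (x k) * e k)"
      using small by (intro sum_mono mult_left_mono) (auto simp: v_def)
    finally show ?thesis .
  qed
  have "Lnorm p M D powr p = (\<Sum>k<n. Lnorm p M (\<lambda>\<xi>. x k * u k \<xi>) powr p)"
    unfolding D_def
  proof (rule Lnorm_disjoint_sum[OF p xi(1)])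
    show "x j * u j \<xi> = 0 \<or> x k * u k \<xi> = 0" if "j < n" "k < n" "j \<noteq> k" for \<xi> j k
      using disj[OF that] by (auto simp: u_def indicator_def)
  qed
  then have "(Lnorm p M D powr p) powr (1/p) = (\<Sum>k<n. (norm (x k) * Lnorm p M (u k)) powr p) powr (1/p)"
    using p0 by (simp add: Lnorm_cmult)
  then have D: "Lnorm p M D = (\<Sum>k<n. (norm (x k) * Lnorm p M (u k)) powr p) powr (1/p)"
    using p0 by (simp add: powr_powr)
  have S: "(\<Sum>k<n. x k * h k \<xi>) = D \<xi> + R \<xi>" for \<xi>
    by (simp add: D_def R_def uv algebra_simps sum.distrib)
  have ule: "Lnorm p M (u k) \<le> Lnorm p M (h k)" if "k < n" for k
  proof -
    have "(LINT \<xi>|M. norm (u k \<xi>) powr p) \<le> (LINT \<xi>|M. norm (h k \<xi>) powr p)"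
      using p by (intro integral_mono ui[OF that] hi[OF that]) (auto simp: u_def indicator_def)
    then show ?thesis unfolding Lnorm_def using p by (intro powr_mono2) auto
  qed
  have "Lnorm p M (\<lambda>\<xi>. \<Sum>k<n. x k * h k \<xi>) \<le> Lnorm p M D + Lnorm p M R"
    unfolding S by (rule Lnorm_triangle[OF p Dm Di])
  also have "Lnorm p M D \<le> (\<Sum>k<n. (norm (x k) * Lnorm p M (h k)) powr p) powr (1/p)"
    unfolding D using p ule by (intro powr_mono2 sum_mono mult_left_mono) (auto intro: sum_nonneg)
  finally show "Lnorm p M (\<lambda>\<xi>. \<Sum>k<n. x k * h k \<xi>) \<le>
      (\<Sum>k<n. (norm (x k) * Lnorm p M (h k)) powr p) powr (1/p) + (\<Sum>k<n. norm (x k) * e k)"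
    using R by simp
  assume \<gamma>: "\<And>k. k < n \<Longrightarrow> \<gamma> + e k \<le> Lnorm p M (h k)" "\<gamma> \<ge> 0"
  have \<gamma>u: "\<gamma> \<le> Lnorm p M (u k)" if "k < n" for k
  proof -
    have "Lnorm p M (h k) \<le> Lnorm p M (u k) + Lnorm p M (v k)"
      using Lnorm_triangle[OF p um[OF that] ui[OF that]] by (simp add: uv[symmetric])
    then show ?thesis using \<gamma>(1)[OF that] small[OF that] by (simp add: v_def)
  qed
  have "\<gamma> * (\<Sum>k<n. norm (x k) powr p) powr (1/p) = (\<gamma> powr p * (\<Sum>k<n. norm (x k) powr p)) powr (1/p)"
    using p0 \<gamma>(2) by (simp add: powr_mult powr_powr)
  also have "\<gamma> powr p * (\<Sum>k<n. norm (x k) powr p) = (\<Sum>k<n. (norm (x k) * \<gamma>) powr p)"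
    by (simp add: powr_mult sum_distrib_left mult.commute)
  also have "\<dots> powr (1/p) \<le> Lnorm p M D"
    unfolding D using p \<gamma>u \<gamma>(2) by (intro powr_mono2 sum_mono mult_left_mono) (auto intro: sum_nonneg)
  also have "Lnorm p M D \<le> Lnorm p M (\<lambda>\<xi>. \<Sum>k<n. x k * h k \<xi>) + Lnorm p M R"
  proof -
    have "Lnorm p M (\<lambda>\<xi>. (D \<xi> + R \<xi>) + (- R \<xi>)) \<le> Lnorm p M (\<lambda>\<xi>. D \<xi> + R \<xi>) + Lnorm p M (\<lambda>\<xi>. - R \<xi>)"
      using Dm Di p by (intro Lnorm_triangle powr_integrable_add) auto
    moreover have "Lnorm p M (\<lambda>\<xi>. - R \<xi>) = Lnorm p M R" by (simp add: Lnorm_def)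
    ultimately show ?thesis unfolding S by simp
  qed
  finally show "\<gamma> * (\<Sum>k<n. norm (x k) powr p) powr (1/p) \<le> Lnorm p M (\<lambda>\<xi>. \<Sum>k<n. x k * h k \<xi>) + (\<Sum>k<n. norm (x k) * e k)"
    using R by simp
qed

text \<open>The inductive choice behind the humps: \<open>\<sigma>\<close> measures a function off
  its own hump, \<open>\<rho>\<close> the size of a hump, and \<open>K\<close> the height of a
  function. The height at \<open>d n\<close> is fixed before \<open>d (Suc n)\<close> is chosen, so
  the next hump can be made negligible for the function before it.\<close>

lemma hump_sequence:
  fixes \<sigma> \<rho> K :: "real \<Rightarrow> real" and e :: "nat \<Rightarrow> real"
  assumes D: "D > 0" and e: "\<And>n. e n > 0" and K: "\<And>d. d > 0 \<Longrightarrow> K d > 0"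
    and \<sigma>: "(\<sigma> \<longlongrightarrow> 0) (at_right 0)" and \<rho>: "(\<rho> \<longlongrightarrow> 0) (at_right 0)"
  shows "\<exists>d. \<forall>n. (0 < d n \<and> d n \<le> D \<and> \<sigma> (d n) \<le> e n) \<and> (d (Suc n) \<le> d n \<and> K (d n) * \<rho> (d (Suc n)) \<le> e (Suc n))"
proof (rule dependent_nat_choice)
  have \<sigma>': "eventually (\<lambda>d. \<sigma> d \<le> \<epsilon>) (at_right 0)" if "\<epsilon> > 0" for \<epsilon>
    using order_tendstoD(2)[OF \<sigma> that] by eventually_elim auto
  have \<rho>': "eventually (\<lambda>d. \<rho> d \<le> \<epsilon>) (at_right 0)" if "\<epsilon> > 0" for \<epsilon>
    using order_tendstoD(2)[OF \<rho> that] by eventually_elim auto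
  have small: "eventually (\<lambda>d. 0 < d \<and> d \<le> D') (at_right (0::real))" if "D' > 0" for D'
    using that by (intro eventually_at_rightI[of 0 D']) auto
  have "eventually (\<lambda>d. 0 < d \<and> d \<le> D \<and> \<sigma> d \<le> e 0) (at_right 0)"
    using \<sigma>'[OF e] small[OF D] by eventually_elim auto
  from eventually_happens'[OF _ this] show "\<exists>d. 0 < d \<and> d \<le> D \<and> \<sigma> d \<le> e 0" by auto
  fix d n assume d: "0 < d \<and> d \<le> D \<and> \<sigma> d \<le> e n"
  have "eventually (\<lambda>d'. (0 < d' \<and> d' \<le> D \<and> \<sigma> d' \<le> e (Suc n)) \<and> d' \<le> d \<and> \<rho> d' \<le> e (Suc n) / K d) (at_right 0)"
    using \<sigma>'[OF e, of "Suc n"] small[OF D] small[of d] \<rho>'[of "e (Suc n) / K d"] d e[of "Suc n"] K[of d]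
    by (auto simp: eventually_conj_iff)
  from eventually_happens'[OF _ this] obtain d' where
    "0 < d' \<and> d' \<le> D \<and> \<sigma> d' \<le> e (Suc n)" "d' \<le> d" "\<rho> d' \<le> e (Suc n) / K d" by auto
  then show "\<exists>y. (0 < y \<and> y \<le> D \<and> \<sigma> y \<le> e (Suc n)) \<and> y \<le> d \<and> K d * \<rho> y \<le> e (Suc n)"
    using K[of d] d by (intro exI[of _ d']) (auto simp: field_simps)
qed

definition hump_set :: "complex \<Rightarrow> real \<Rightarrow> complex set" where
  "hump_set a \<rho> = {\<xi> \<in> sphere 0 1. norm (1 - cnj a * \<xi>) < \<rho>}"

lemma hump_set_measurable: "hump_set a \<rho> \<in> sets circle_measure"
proof -
  have [measurable]: "(\<lambda>\<xi>. norm (1 - cnj a * \<xi>)) \<in> borel_measurable circle_measure"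
    by (intro continuous_circle_measurable continuous_intros)
  have "{\<xi> \<in> space circle_measure. norm (1 - cnj a * \<xi>) < \<rho>} \<in> sets circle_measure"
    by measurable
  then show ?thesis by (simp add: hump_set_def)
qed

text \<open>The set lies within distance \<open>2 \<rho>\<close> of the point \<open>b\<close> at depth \<open>\<rho>\<close> below it,
  so its indicator is dominated by a multiple of the Poisson kernel at \<open>b\<close>.\<close>

lemma measure_hump_set:
  assumes a: "a \<noteq> 0" "norm a < 1" and \<rho>: "1 - norm a \<le> \<rho>" "\<rho> < 1"
  shows "measure circle_measure (hump_set a \<rho>) \<le> 4 * \<rho>"
proof -
  define b where "b = of_real ((1 - \<rho>) / norm a) * a"
  have \<rho>0: "\<rho> > 0" using a \<rho> by linarith
  have nb: "norm b = 1 - \<rho>" using a \<rho> unfolding b_def norm_mult norm_of_real by simp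
  have ab: "norm (a - b) \<le> \<rho>"
  proof -
    have "a - b = of_real ((norm a - (1 - \<rho>)) / norm a) * a"
      using a by (simp add: b_def field_simps)
    then have "norm (a - b) = \<bar>(norm a - (1 - \<rho>)) / norm a\<bar> * norm a" by (simp only: norm_mult norm_of_real)
    then have "norm (a - b) = norm a - (1 - \<rho>)" using a \<rho> by simp
    then show ?thesis using a by simp
  qed
  have ne: "\<xi> \<noteq> b" if "norm \<xi> = 1" for \<xi> using that nb \<rho>0 by auto
  have pt: "indicator (hump_set a \<rho>) \<xi> \<le> (2 * \<rho>)\<^sup>2 * (1 / norm (\<xi> - b) ^ 2)" if n: "norm \<xi> = 1" for \<xi>
  proof (cases "\<xi> \<in> hump_set a \<rho>")
    case True
    have "\<xi> * cnj \<xi> = 1" using n by (metis complex_norm_square of_real_1 power_one)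
    then have "cnj (1 - cnj a * \<xi>) * \<xi> = \<xi> - a" by (simp add: algebra_simps)
    then have "norm (\<xi> - a) = norm (1 - cnj a * \<xi>)" using n by (metis complex_mod_cnj mult.right_neutral norm_mult)
    then have "norm (\<xi> - b) \<le> 2 * \<rho>"
      using norm_triangle_ineq[of "\<xi> - a" "a - b"] True ab by (simp add: hump_set_def)
    then have "norm (\<xi> - b) ^ 2 \<le> (2 * \<rho>)\<^sup>2" by (intro power_mono) auto
    then show ?thesis using True ne[OF n] by (simp add: field_simps)
  qed simp
  have "measure circle_measure (hump_set a \<rho>) = (LINT \<xi>|circle_measure. indicator (hump_set a \<rho>) \<xi>)"
    using hump_set_measurable[of a \<rho>] by (simp add: hump_set_def inf.absorb1[OF subset_trans[OF Collect_restrict]] Int_def conj_commute)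
  also have "\<dots> \<le> (LINT \<xi>|circle_measure. (2 * \<rho>)\<^sup>2 * (1 / norm (\<xi> - b) ^ 2))"
  proof (rule integral_mono)
    show "integrable circle_measure (indicator (hump_set a \<rho>) :: _ \<Rightarrow> real)"
      using hump_set_measurable by (intro integrable_real_indicator) (auto simp: circle.emeasure_finite less_top[symmetric])
    show "integrable circle_measure (\<lambda>\<xi>. (2 * \<rho>)\<^sup>2 * (1 / norm (\<xi> - b) ^ 2))"
      using ne by (intro continuous_circle_integrable continuous_intros) auto
  qed (use pt in auto)
  also have "\<dots> = (2 * \<rho>)\<^sup>2 * (1 / (1 - norm b ^ 2))"
    unfolding integral_mult_right_zero using nb \<rho>0 by (subst poisson_circle_integral) auto
  also have "1 - norm b ^ 2 = \<rho> * (2 - \<rho>)" by (simp add: nb power2_eq_square algebra_simps)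
  also have "(2 * \<rho>)\<^sup>2 * (1 / (\<rho> * (2 - \<rho>))) = 4 * \<rho> / (2 - \<rho>)"
    using \<rho>0 \<rho> by (simp add: field_simps power2_eq_square)
  also have "\<dots> \<le> 4 * \<rho> / 1" using \<rho>0 \<rho> by (intro divide_left_mono) auto
  finally show ?thesis by simp
qed

text \<open>A point off the trimmed set is either outside the hump of \<open>k\<close>, where the
  function is at most \<open>\<sigma>\<close>, or inside a later hump, where it is at most
  \<open>K\<close> but on a set of measure at most \<open>4 * \<rho> j\<close>. The two cases give
  the two terms of the budget \<open>e powr p\<close>.\<close>

lemma hump_off_peak:
  fixes h :: "nat \<Rightarrow> complex \<Rightarrow> complex" and a :: "nat \<Rightarrow> complex"
  assumes p: "1 \<le> p" and k: "k < n" and hc: "continuous_on (sphere 0 1) (h k)"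
    and a: "\<And>j. a j \<noteq> 0" "\<And>j. norm (a j) < 1" and \<rho>: "\<And>j. 1 - norm (a j) \<le> \<rho> j" "\<And>j. \<rho> j < 1"
    and off: "\<And>\<xi>. norm \<xi> = 1 \<Longrightarrow> \<rho> k \<le> norm (1 - cnj (a k) * \<xi>) \<Longrightarrow> norm (h k \<xi>) \<le> \<sigma>"
    and all: "\<And>\<xi>. norm \<xi> = 1 \<Longrightarrow> norm (h k \<xi>) \<le> K" and K: "K \<ge> 0" "\<sigma> \<ge> 0"
    and e: "\<sigma> powr p + K powr p * (\<Sum>j\<in>{k<..<n}. 4 * \<rho> j) \<le> e powr p" "e \<ge> 0"
  shows "Lnorm p circle_measure (\<lambda>\<xi>. indicator (- (hump_set (a k) (\<rho> k) - (\<Union>j\<in>{k<..<n}. hump_set (a j) (\<rho> j)))) \<xi> * h k \<xi>) \<le> e"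
proof -
  let ?I = "\<lambda>j. hump_set (a j) (\<rho> j)"
  let ?A = "?I k - (\<Union>j\<in>{k<..<n}. ?I j)"
  let ?v = "\<lambda>\<xi>. indicator (- ?A) \<xi> * h k \<xi>"
  have ind: "integrable circle_measure (indicator (?I j) :: _ \<Rightarrow> real)" for j
    using hump_set_measurable by (intro integrable_real_indicator) (auto simp: circle.emeasure_finite less_top[symmetric])
  have pt: "norm (?v \<xi>) powr p \<le> \<sigma> powr p + (\<Sum>j\<in>{k<..<n}. K powr p * indicator (?I j) \<xi>)" if n: "norm \<xi> = 1" for \<xi>
  proof -
    have nn: "0 \<le> (\<Sum>j\<in>{k<..<n}. K powr p * indicator (?I j) \<xi>)" by (intro sum_nonneg) auto
    consider "\<xi> \<in> ?A" | "\<xi> \<notin> ?I k" | j where "j \<in> {k<..<n}" "\<xi> \<in> ?I j" by blast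
    then show ?thesis
    proof cases
      case 1 then show ?thesis using nn p by simp
    next
      case 2
      then have "norm (h k \<xi>) \<le> \<sigma>" using n by (intro off) (auto simp: hump_set_def)
      then have "norm (?v \<xi>) \<le> \<sigma>" using K by (auto simp: indicator_def)
      then have "norm (?v \<xi>) powr p \<le> \<sigma> powr p" using p by (intro powr_mono2) auto
      then show ?thesis using nn by linarith
    next
      case 3
      have "norm (?v \<xi>) \<le> K" using all[OF n] K by (auto simp: indicator_def)
      then have "norm (?v \<xi>) powr p \<le> K powr p" using p by (intro powr_mono2) auto
      also have "\<dots> = K powr p * indicator (?I j) \<xi>" using 3 by simp
      also have "\<dots> \<le> (\<Sum>j\<in>{k<..<n}. K powr p * indicator (?I j) \<xi>)"
        using 3 by (intro member_le_sum) auto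
      finally show ?thesis using powr_ge_zero[of \<sigma> p] by linarith
    qed
  qed
  have Am: "?A \<in> sets circle_measure" using hump_set_measurable by (intro sets.Diff sets.finite_UN) auto
  have hcp: "integrable circle_measure (\<lambda>\<xi>. norm (h k \<xi>) powr p)"
    using hc p by (intro continuous_circle_integrable continuous_on_norm_powr) auto
  have vm: "?v \<in> borel_measurable circle_measure"
  proof -
    note [measurable] = continuous_circle_measurable[OF hc] Am
    have "?v = (\<lambda>\<xi>. h k \<xi> - indicator ?A \<xi> * h k \<xi>)" by (auto simp: indicator_def)
    also have "\<dots> \<in> borel_measurable circle_measure" by measurable
    finally show ?thesis .
  qed
  have vi: "integrable circle_measure (\<lambda>\<xi>. norm (?v \<xi>) powr p)"
    using p vm by (intro Bochner_Integration.integrable_bound[OF hcp]) (auto simp: indicator_def)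
  have ri1: "integrable circle_measure (\<lambda>\<xi>. \<Sum>j\<in>{k<..<n}. K powr p * indicator (?I j) \<xi>)"
    by (intro Bochner_Integration.integrable_sum integrable_mult_right ind)
  have ri: "integrable circle_measure (\<lambda>\<xi>. \<sigma> powr p + (\<Sum>j\<in>{k<..<n}. K powr p * indicator (?I j) \<xi>))"
    by (intro Bochner_Integration.integrable_add circle.integrable_const ri1)
  have "(LINT \<xi>|circle_measure. norm (?v \<xi>) powr p) \<le> (LINT \<xi>|circle_measure. \<sigma> powr p + (\<Sum>j\<in>{k<..<n}. K powr p * indicator (?I j) \<xi>))"
    using pt by (intro integral_mono vi ri) auto
  also have "\<dots> = \<sigma> powr p + (\<Sum>j\<in>{k<..<n}. K powr p * (LINT \<xi>|circle_measure. indicator (?I j) \<xi>))"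
    using ind by (subst Bochner_Integration.integral_add[OF circle.integrable_const ri1])
      (subst Bochner_Integration.integral_sum, auto intro!: integrable_mult_right)
  also have "(\<lambda>j. LINT \<xi>|circle_measure. indicator (?I j) \<xi>) = (\<lambda>j. measure circle_measure (?I j))"
    using hump_set_measurable by (intro ext) (simp add: hump_set_def inf.absorb1[OF subset_trans[OF Collect_restrict]] Int_def conj_commute)
  also have "\<sigma> powr p + (\<Sum>j\<in>{k<..<n}. K powr p * measure circle_measure (?I j)) \<le> \<sigma> powr p + (\<Sum>j\<in>{k<..<n}. K powr p * (4 * \<rho> j))"
    using a \<rho> by (intro add_left_mono sum_mono mult_left_mono measure_hump_set) auto
  also have "\<dots> = \<sigma> powr p + K powr p * (\<Sum>j\<in>{k<..<n}. 4 * \<rho> j)" by (simp add: sum_distrib_left)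
  also have "\<dots> \<le> e powr p" by (rule e)
  finally have "Lnorm p circle_measure ?v \<le> (e powr p) powr (1/p)"
    unfolding Lnorm_def using p by (intro powr_mono2) auto
  then show ?thesis using p e(2) by (simp add: powr_powr)
qed

lemma sum_fun_apply: "(\<Sum>k\<in>A. F k) z = (\<Sum>k\<in>A. (F k z :: complex))"
  by (induction A rule: infinite_finite_induct) auto

lemma psum_apply: "psum f x n z = (\<Sum>k<n. x k * f k z)"
  by (simp add: psum_def sum_fun_apply scale_fun_def)

lemma slice_norm_psum: "slice_norm p (psum f x n) r = Lnorm p circle_measure (\<lambda>\<xi>. \<Sum>k<n. x k * f k (of_real r * \<xi>))"
  by (simp add: slice_norm_def psum_apply)

lemma psum_hardy:
  assumes "1 \<le> p" "\<And>k. f k \<in> hardy_space p"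
  shows "psum f x n \<in> hardy_space p"
  unfolding psum_def
  by (intro cfun.subspace_sum cfun.subspace_scale subspace_hardy_space assms)

section \<open>Estimates for a peak at depth \<open>\<rho> ^ 4\<close> over a hump of width
  \<open>\<rho>\<close>\<close>

lemma peak_powr_le:
  assumes "1 \<le> p" "0 < d" "d \<le> (1::real)"
  shows "d powr (2 - 1/p) \<le> d"
proof -
  have "d powr (2 - 1/p) \<le> d powr 1" using assms by (intro powr_mono') (auto simp: field_simps)
  then show ?thesis using assms by simp
qed

text \<open>The derivative of a peak has the kernel cubed in its denominator, and off the hump the
  kernel is only known to be at least \<open>\<rho> / 2\<close>. With depth
  \<open>\<rho> ^ 4\<close> the quotient is still of order \<open>\<rho>\<close>, which tends to 0;
  depth \<open>\<rho> ^ 3\<close> would give only a constant.\<close>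

context
  fixes p \<rho> :: real and a :: complex
  assumes p: "1 \<le> p" and \<rho>: "0 < \<rho>" "\<rho> \<le> 1/2" and a: "norm a = 1 - \<rho> ^ 4"
begin

lemma rho4: "0 < \<rho> ^ 4" "\<rho> ^ 4 \<le> \<rho>" "\<rho> ^ 4 \<le> 1" "norm a < 1"
proof -
  show "\<rho> ^ 4 \<le> \<rho>" using \<rho> power_decreasing[of 1 4 \<rho>] by simp
  show "0 < \<rho> ^ 4" "\<rho> ^ 4 \<le> 1" using \<rho> by (auto simp: power_le_one)
  then show "norm a < 1" by (simp add: a)
qed

lemma kernel_lower:
  assumes "norm \<xi> = 1" "0 \<le> t" "t < 1"
  shows "\<rho> ^ 4 \<le> norm (1 - cnj a * (of_real t * \<xi>))"
    and "\<rho> \<le> norm (1 - cnj a * \<xi>) \<Longrightarrow> \<rho> / 2 \<le> norm (1 - cnj a * (of_real t * \<xi>))"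
proof -
  show "\<rho> ^ 4 \<le> norm (1 - cnj a * (of_real t * \<xi>))"
    using norm_one_minus_cnj_ge[of "of_real t * \<xi>" a] assms a by (simp add: norm_mult)
  assume "\<rho> \<le> norm (1 - cnj a * \<xi>)"
  moreover have "norm (1 - cnj a * \<xi>) / 2 \<le> norm (1 - of_real t * (cnj a * \<xi>))"
    using assms rho4 by (intro norm_one_minus_scaled_ge) (auto simp: norm_mult)
  ultimately show "\<rho> / 2 \<le> norm (1 - cnj a * (of_real t * \<xi>))" by (simp add: mult_ac)
qed

lemma peak_bounds:
  assumes "norm \<xi> = 1" "0 \<le> t" "t < 1"
  shows "norm (peak p a (of_real t * \<xi>)) \<le> 2 / \<rho> ^ 8"
    and "\<rho> \<le> norm (1 - cnj a * \<xi>) \<Longrightarrow> norm (peak p a (of_real t * \<xi>)) \<le> 16 * \<rho>"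
    and "norm (deriv (peak p a) (of_real t * \<xi>)) \<le> 2 / \<rho> ^ 8"
    and "\<rho> \<le> norm (1 - cnj a * \<xi>) \<Longrightarrow> norm (deriv (peak p a) (of_real t * \<xi>)) \<le> 16 * \<rho>"
proof -
  let ?k = "norm (1 - cnj a * (of_real t * \<xi>))"
  have tx: "norm (of_real t * \<xi>) < 1" using assms by (simp add: norm_mult)
  have dp: "(\<rho> ^ 4) powr (2 - 1/p) \<le> \<rho> ^ 4" using rho4 p by (intro peak_powr_le) auto
  have e1: "norm (peak p a (of_real t * \<xi>)) = (\<rho> ^ 4) powr (2 - 1/p) / ?k ^ 2"
    using tx by (simp add: peak_def a norm_divide norm_power)
  have e2: "norm (deriv (peak p a) (of_real t * \<xi>)) = (\<rho> ^ 4) powr (2 - 1/p) * (2 * norm a) / ?k ^ 3"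
    using tx peak_deriv[OF rho4(4) tx, of p] a by (simp add: norm_divide norm_power norm_mult)
  have d2: "(\<rho> ^ 4) powr (2 - 1/p) * (2 * norm a) \<le> \<rho> ^ 4 * 2"
    using dp rho4 by (intro mult_mono) auto
  note kl = kernel_lower[OF assms]
  have "norm (peak p a (of_real t * \<xi>)) \<le> \<rho> ^ 4 / (\<rho> ^ 4) ^ 2"
    unfolding e1 using kl(1) rho4 dp by (intro frac_le power_mono) auto
  also have "\<dots> = 1 / \<rho> ^ 4"
  proof -
    have "X / X\<^sup>2 = 1 / X" if "X \<noteq> 0" for X :: real using that by (simp add: power2_eq_square)
    then show ?thesis using rho4(1) by (metis less_irrefl)
  qed
  \<comment> \<open>The bound is weakened to that of the derivative, so that peaks and images can
    share one height function.\<close>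
  also have "\<dots> \<le> 2 / \<rho> ^ 8"
    using \<rho> power_decreasing[of 4 8 \<rho>] by (intro frac_le) auto
  finally show "norm (peak p a (of_real t * \<xi>)) \<le> 2 / \<rho> ^ 8" .
  have "norm (deriv (peak p a) (of_real t * \<xi>)) \<le> \<rho> ^ 4 * 2 / (\<rho> ^ 4) ^ 3"
    unfolding e2 using kl(1) rho4 d2 by (intro frac_le power_mono) auto
  also have "\<dots> = 2 / \<rho> ^ 8" using \<rho> by (simp add: field_simps flip: power_add power_mult)
  finally show "norm (deriv (peak p a) (of_real t * \<xi>)) \<le> 2 / \<rho> ^ 8" .
  assume off: "\<rho> \<le> norm (1 - cnj a * \<xi>)"
  have "norm (peak p a (of_real t * \<xi>)) \<le> \<rho> ^ 4 / (\<rho>/2) ^ 2"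
    unfolding e1 using kl(2)[OF off] \<rho> dp by (intro frac_le power_mono) auto
  also have "\<dots> = 4 * \<rho> * \<rho>" using \<rho> by (simp add: field_simps power2_eq_square power4_eq_xxxx)
  also have "\<dots> \<le> 16 * \<rho>" using \<rho> by simp
  finally show "norm (peak p a (of_real t * \<xi>)) \<le> 16 * \<rho>" .
  have "norm (deriv (peak p a) (of_real t * \<xi>)) \<le> \<rho> ^ 4 * 2 / (\<rho>/2) ^ 3"
    unfolding e2 using kl(2)[OF off] \<rho> d2 by (intro frac_le power_mono) auto
  also have "\<dots> = 16 * \<rho>" using \<rho> by (simp add: field_simps power3_eq_cube power4_eq_xxxx)
  finally show "norm (deriv (peak p a) (of_real t * \<xi>)) \<le> 16 * \<rho>" .
qed

lemma volterra_peak_bounds: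
  assumes g: "g holomorphic_on ball 0 1" and B: "\<And>z. norm z < 1 \<Longrightarrow> norm (g z) \<le> B"
    and x: "norm \<xi> = 1" "0 \<le> r" "r < 1"
  shows "norm (volterra_op g (peak p a) (of_real r * \<xi>)) \<le> B * (2 / \<rho> ^ 8)"
    and "\<rho> \<le> norm (1 - cnj a * \<xi>) \<Longrightarrow> norm (volterra_op g (peak p a) (of_real r * \<xi>)) \<le> B * (16 * \<rho>)"
proof -
  have B0: "B \<ge> 0" using order_trans[OF norm_ge_zero B[of 0]] by simp
  note h = peak_holomorphic[OF rho4(4), of p]
  show "norm (volterra_op g (peak p a) (of_real r * \<xi>)) \<le> B * (2 / \<rho> ^ 8)"
  proof (rule volterra_op_bound[OF h g x])
    fix t :: real assume t: "0 \<le> t" "t < 1"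
    have "norm (deriv (peak p a) (of_real t * \<xi>)) * norm (g (of_real t * \<xi>)) \<le> 2 / \<rho> ^ 8 * B"
      using peak_bounds(3)[OF x(1) t] t x \<rho> by (intro mult_mono B) (auto simp: norm_mult)
    then show "norm (deriv (peak p a) (of_real t * \<xi>) * g (of_real t * \<xi>)) \<le> B * (2 / \<rho> ^ 8)"
      by (simp add: norm_mult mult_ac)
  qed
  assume off: "\<rho> \<le> norm (1 - cnj a * \<xi>)"
  show "norm (volterra_op g (peak p a) (of_real r * \<xi>)) \<le> B * (16 * \<rho>)"
  proof (rule volterra_op_bound[OF h g x])
    fix t :: real assume t: "0 \<le> t" "t < 1"
    have "norm (deriv (peak p a) (of_real t * \<xi>)) * norm (g (of_real t * \<xi>)) \<le> 16 * \<rho> * B"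
      using peak_bounds(4)[OF x(1) t off] t x \<rho> by (intro mult_mono B) (auto simp: norm_mult)
    then show "norm (deriv (peak p a) (of_real t * \<xi>) * g (of_real t * \<xi>)) \<le> B * (16 * \<rho>)"
      by (simp add: norm_mult mult_ac)
  qed
qed

end

lemma sum_half_powers_le: "(\<Sum>k<n. (1/2) ^ Suc k) \<le> (1::real)"
proof -
  have "(\<Sum>k<n. (1/2) ^ Suc k) = 1 - (1/2 :: real) ^ n" by (induction n) auto
  then show ?thesis by simp
qed

lemma sum_half_powers_tail_le: "(\<Sum>j\<in>{k<..<n}. (1/2) ^ Suc j) \<le> (1/2::real)"
proof -
  have "(\<Sum>j\<in>{k<..<n}. (1/2) ^ Suc j) \<le> (\<Sum>j\<in>{1..<n}. (1/2::real) ^ Suc j)"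
    by (intro sum_mono2) auto
  also have "\<dots> \<le> 1/2"
  proof (cases n)
    case (Suc m)
    have "(\<Sum>j\<in>{1..<Suc m}. (1/2::real) ^ Suc j) = (\<Sum>j<m. (1/2) ^ Suc (Suc j))"
      by (rule sum.reindex_bij_witness[of _ Suc "\<lambda>j. j - 1"]) auto
    also have "\<dots> = 1/2 * (\<Sum>j<m. (1/2) ^ Suc j)" by (simp add: sum_distrib_left)
    also have "\<dots> \<le> 1/2" using sum_half_powers_le[of m] by simp
    finally show ?thesis using Suc by simp
  qed simp
  finally show ?thesis .
qed

section \<open>The copy of the \<open>p\<close>-summable sequences\<close>

locale hardy_volterra =
  fixes p :: real and g :: "complex \<Rightarrow> complex" and z0 :: complex
  assumes p: "1 \<le> p" and g: "g holomorphic_on ball 0 1"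
    and T: "bounded_op (hardy_space p) (hardy_norm p) (hardy_space p) (hardy_norm p) (volterra_op g)"
    and z0: "norm z0 < 1" "g z0 \<noteq> 0"
begin

lemma op_bound:
  obtains K where "K > 0" "\<And>f. f \<in> hardy_space p \<Longrightarrow> hardy_norm p (volterra_op g f) \<le> K * hardy_norm p f"
  using bounded_op_bound[OF T hardy_norm_nonneg] by blast

text \<open>Testing the operator on the peak at \<open>a\<close> bounds \<open>g a\<close> by
  \<open>16 * K / norm a\<close>. The factor \<open>norm a\<close> is harmless for
  \<open>norm a \<ge> 1/2\<close>, giving \<open>32 * K\<close>; on the inner disk compactness is
  used. The normalization \<open>B \<ge> 1\<close> lets bounds for images cover the peaks
  too.\<close>

lemma g_bounded:
  obtains B where "B \<ge> 1" "\<And>z. norm z < 1 \<Longrightarrow> norm (g z) \<le> B"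
proof -
  obtain K where K: "K > 0" "\<And>f. f \<in> hardy_space p \<Longrightarrow> hardy_norm p (volterra_op g f) \<le> K * hardy_norm p f"
    using op_bound by blast
  have outer: "norm (g a) \<le> 32 * K" if a: "norm a < 1" "1/2 \<le> norm a" for a
  proof -
    note pk = peak_hardy[OF p a(1)]
    have "1/2 * norm (g a) \<le> norm a * norm (g a)" using a by (intro mult_right_mono) auto
    also have "\<dots> \<le> 16 * hardy_norm p (volterra_op g (peak p a))"
      by (rule volterra_peak_lower[OF p g a(1) bounded_op_in[OF T pk(1)]])
    also have "\<dots> \<le> 16 * (K * 1)"
      using K(2)[OF pk(1)] mult_left_mono[OF pk(2), of K] K(1) by (intro mult_left_mono) linarith+
    finally show ?thesis by simp
  qed
  have "compact (g ` cball 0 (1/2))"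
    by (intro compact_continuous_image continuous_on_subset[OF holomorphic_on_imp_continuous_on[OF g]]) auto
  then obtain C where C: "\<And>z. z \<in> cball 0 (1/2) \<Longrightarrow> norm (g z) \<le> C"
    by (metis bounded_iff compact_imp_bounded imageI)
  show thesis
  proof (rule that[of "max 1 (max (32 * K) C)"])
    fix z :: complex assume "norm z < 1"
    then show "norm (g z) \<le> max 1 (max (32 * K) C)"
      using outer[of z] C[of z] by (cases "1/2 \<le> norm z") auto
  qed auto
qed

text \<open>By the maximum principle every larger circle has a point at which \<open>g\<close> is at
  least as large as at \<open>z0\<close>. Peaks can therefore be centred at any depth near the
  boundary with one common lower bound.\<close>

lemma large_on_circles:
  assumes "norm z0 < r" "r < 1"
  shows "\<exists>a. norm a = r \<and> norm (g z0) \<le> norm (g a)"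
proof -
  have r: "r > 0" using assms(1) norm_ge_zero[of z0] by linarith
  have c: "continuous_on (cball 0 r) g"
    using assms by (intro continuous_on_subset[OF holomorphic_on_imp_continuous_on[OF g]]) auto
  have ne: "sphere 0 r \<noteq> ({} :: complex set)" using r by simp
  have "continuous_on (sphere 0 r) (\<lambda>z. norm (g z))"
    by (intro continuous_intros continuous_on_subset[OF c]) auto
  from continuous_attains_sup[OF compact_sphere ne this]
  obtain a where a: "a \<in> sphere 0 r" "\<forall>z\<in>sphere 0 r. norm (g z) \<le> norm (g a)" by (elim bexE)
  have "norm (g z0) \<le> norm (g a)"
  proof (rule maximum_modulus_frontier[where S="ball 0 r" and f=g])
    show "g holomorphic_on interior (ball 0 r)" using assms by (auto intro: holomorphic_on_subset[OF g])
    show "continuous_on (closure (ball 0 r)) g" using c r by simp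
  qed (use a assms r in \<open>auto simp: frontier_ball\<close>)
  then show ?thesis using a by auto
qed

lemma lp_embedding_peaks: "\<exists>f C c. lp_embedding (hardy_space p) (hardy_norm p) (volterra_op g) f p C c"
proof -
  let ?T = "volterra_op g"
  obtain B where B: "B \<ge> 1" "\<And>z. norm z < 1 \<Longrightarrow> norm (g z) \<le> B" using g_bounded by blast
  \<comment> \<open>From \<open>volterra_peak_lower\<close> with \<open>norm a \<ge> 1/2\<close>:
    half of \<open>norm (g z0)\<close> is at most 16 times the norm of an image.\<close>
  define c where "c = norm (g z0) / 32"
  have c: "c > 0" using z0 by (simp add: c_def)
  \<comment> \<open>The errors add up to at most \<open>\<epsilon>\<close> times the sequence norm.
    The bound 1 makes the upper constant \<open>1 + 1 = 2\<close>; the bound \<open>c/4\<close>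
    leaves \<open>c/2 - c/4\<close> below.\<close>
  define \<epsilon> where "\<epsilon> = min 1 (c/4)"
  have \<epsilon>: "\<epsilon> > 0" "\<epsilon> \<le> 1" "\<epsilon> \<le> c/4" using c by (auto simp: \<epsilon>_def)
  define e where "e k = \<epsilon> * (1/2) ^ Suc k" for k
  have e: "e k > 0" "e k \<le> c/4" for k
  proof -
    have "(1/2::real) ^ Suc k \<le> 1" by (rule power_le_one) auto
    then have "\<epsilon> * (1/2) ^ Suc k \<le> \<epsilon> * 1" using \<epsilon> by (intro mult_left_mono) auto
    then show "e k \<le> c/4" using \<epsilon> unfolding e_def by linarith
    show "e k > 0" using \<epsilon> unfolding e_def by simp
  qed
  have e_mono: "e j \<le> e k" if "k \<le> j" for j k
    unfolding e_def using \<epsilon> that by (intro mult_left_mono power_decreasing) auto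
  \<comment> \<open>Since \<open>\<rho> ^ 4 \<le> \<rho> \<le> D < 1 - norm z0\<close>, all centres
    lie on circles around \<open>z0\<close> to which \<open>large_on_circles\<close> applies;
    \<open>1/2\<close> keeps them away from 0.\<close>
  define D where "D = min (1/2) ((1 - norm z0) / 2)"
  have D: "D > 0" "D \<le> 1/2" "D < 1 - norm z0" using z0 by (auto simp: D_def)
  \<comment> \<open>Height of an image for a hump of width \<open>d\<close>. As
    \<open>B \<ge> 1\<close> it also exceeds the height of the peak, so both families use the same
    humps.\<close>
  define K where "K d = B * (2 / d ^ 8)" for d :: real
  have "\<exists>\<rho>. \<forall>n. (0 < \<rho> n \<and> \<rho> n \<le> D \<and> (B * (16 * \<rho> n)) powr p \<le> e n powr p * (1/2) ^ Suc n) \<and>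
      (\<rho> (Suc n) \<le> \<rho> n \<and> K (\<rho> n) powr p * (4 * \<rho> (Suc n)) \<le> e (Suc n) powr p * (1/2) ^ Suc (Suc n))"
  proof (rule hump_sequence[OF D(1)])
    show "e n powr p * (1/2) ^ Suc n > 0" for n using e(1)[of n] by simp
    show "K d powr p > 0" if "d > 0" for d using that B by (simp add: K_def)
    have "((\<lambda>d. B * (16 * d)) \<longlongrightarrow> B * (16 * 0)) (at_right 0)" by (intro tendsto_intros)
    then have "((\<lambda>d. (B * (16 * d)) powr p) \<longlongrightarrow> (B * (16 * 0)) powr p) (at_right 0)"
    proof (rule tendsto_powr'[OF _ tendsto_const])
      have "eventually (\<lambda>d. (0::real) < d) (at_right 0)" by (rule eventually_at_right_less)
      then have "eventually (\<lambda>d. 0 \<le> B * (16 * d)) (at_right 0)"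
        by eventually_elim (use B in auto)
      then show "B * (16 * 0) \<noteq> 0 \<or> 0 < p \<and> (\<forall>\<^sub>F d in at_right 0. 0 \<le> B * (16 * d))" using p by auto
    qed
    then show "((\<lambda>d. (B * (16 * d)) powr p) \<longlongrightarrow> 0) (at_right 0)" using p by simp
    have "((\<lambda>d. 4 * d) \<longlongrightarrow> 4 * (0::real)) (at_right 0)" by (intro tendsto_intros)
    then show "((\<lambda>d. 4 * d) \<longlongrightarrow> (0::real)) (at_right 0)" by simp
  qed
  then obtain \<rho> where \<rho>: "\<And>n. 0 < \<rho> n" "\<And>n. \<rho> n \<le> D"
    "\<And>n. (B * (16 * \<rho> n)) powr p \<le> e n powr p * (1/2) ^ Suc n"
    "\<And>n. \<rho> (Suc n) \<le> \<rho> n" "\<And>n. K (\<rho> n) powr p * (4 * \<rho> (Suc n)) \<le> e (Suc n) powr p * (1/2) ^ Suc (Suc n)"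
    by blast
  have \<rho>half: "\<rho> n \<le> 1/2" for n using \<rho>(2)[of n] D by linarith
  have \<rho>4: "0 < \<rho> n ^ 4" "\<rho> n ^ 4 \<le> \<rho> n" for n
    using \<rho>(1)[of n] \<rho>half[of n] power_decreasing[of 1 4 "\<rho> n"] by auto
  have "\<exists>a. norm a = 1 - \<rho> n ^ 4 \<and> norm (g z0) \<le> norm (g a)" for n
    using \<rho>4[of n] \<rho>(2)[of n] D by (intro large_on_circles) auto
  then obtain a where a: "\<And>n. norm (a n) = 1 - \<rho> n ^ 4" "\<And>n. norm (g z0) \<le> norm (g (a n))" by metis
  have a1: "norm (a n) < 1" "1/2 \<le> norm (a n)" "a n \<noteq> 0" for n
  proof -
    show "norm (a n) < 1" "1/2 \<le> norm (a n)" using \<rho>4[of n] \<rho>half[of n] a(1)[of n] by auto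
    then show "a n \<noteq> 0" by auto
  qed
  let ?f = "\<lambda>k. peak p (a k)" and ?F = "\<lambda>k. ?T (peak p (a k))"
  have f: "?f k \<in> hardy_space p" "hardy_norm p (?f k) \<le> 1" for k using peak_hardy[OF p a1(1)] by auto
  have F: "?F k \<in> hardy_space p" for k by (rule bounded_op_in[OF T f(1)])
  have cF: "c \<le> hardy_norm p (?F k)" for k
  proof -
    have "1/2 * norm (g z0) \<le> norm (a k) * norm (g (a k))" using a1[of k] a(2)[of k] by (intro mult_mono) auto
    also have "\<dots> \<le> 16 * hardy_norm p (?F k)" by (rule volterra_peak_lower[OF p g a1(1) F])
    finally show ?thesis by (simp add: c_def)
  qed
  have Kmono: "K (\<rho> k) \<le> K (\<rho> j)" if "k \<le> j" for j k
  proof -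
    have "\<rho> j \<le> \<rho> k" using that by (rule lift_Suc_antimono_le[of \<rho>, OF \<rho>(4)])
    then show ?thesis unfolding K_def using \<rho>(1)[of j] B
      by (intro mult_left_mono divide_left_mono power_mono mult_pos_pos zero_less_power) (auto intro: \<rho>(1))
  qed
  \<comment> \<open>Half of \<open>e k powr p\<close> pays for the values off the own hump and half
    for all later humps. Only neighbouring indices were controlled by the choice; monotonicity of
    \<open>K (\<rho> k)\<close> reduces a later hump \<open>j\<close> to its predecessor.\<close>
  have total: "(B * (16 * \<rho> k)) powr p + K (\<rho> k) powr p * (\<Sum>j\<in>{k<..<n}. 4 * \<rho> j) \<le> e k powr p" for k n
  proof -
    have "(B * (16 * \<rho> k)) powr p \<le> e k powr p * (1/2)"
      using power_decreasing[of 1 "Suc k" "1/2::real"] by (intro order_trans[OF \<rho>(3)] mult_left_mono) auto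
    moreover have "K (\<rho> k) powr p * (\<Sum>j\<in>{k<..<n}. 4 * \<rho> j) \<le> e k powr p * (1/2)"
    proof -
      have "K (\<rho> k) powr p * (4 * \<rho> j) \<le> e k powr p * (1/2) ^ Suc j" if j: "j \<in> {k<..<n}" for j
      proof -
        obtain i where i: "j = Suc i" "k \<le> i" using j by (cases j) auto
        have "K (\<rho> k) powr p * (4 * \<rho> j) \<le> K (\<rho> i) powr p * (4 * \<rho> j)"
          using Kmono[OF i(2)] p \<rho>(1)[of j] \<rho>(1)[of k] B by (intro mult_right_mono powr_mono2) (auto simp: K_def)
        also have "\<dots> \<le> e j powr p * (1/2) ^ Suc j" using \<rho>(5)[of i] i by simp
        also have "\<dots> \<le> e k powr p * (1/2) ^ Suc j"
          using e_mono[of k j] e(1)[of j] p j by (intro mult_right_mono powr_mono2) auto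
        finally show ?thesis .
      qed
      then have "(\<Sum>j\<in>{k<..<n}. K (\<rho> k) powr p * (4 * \<rho> j)) \<le> (\<Sum>j\<in>{k<..<n}. e k powr p * (1/2) ^ Suc j)"
        by (rule sum_mono)
      also have "\<dots> = e k powr p * (\<Sum>j\<in>{k<..<n}. (1/2) ^ Suc j)" by (simp only: sum_distrib_left)
      also have "\<dots> \<le> e k powr p * (1/2)" by (intro mult_left_mono sum_half_powers_tail_le) auto
      finally show ?thesis by (simp only: sum_distrib_left)
    qed
    ultimately show ?thesis by linarith
  qed
  \<comment> \<open>The later humps are cut out of the earlier ones: they are negligible for the
    earlier functions, and the cut makes the sets disjoint.\<close>
  define A where "A n k = hump_set (a k) (\<rho> k) - (\<Union>j\<in>{k<..<n}. hump_set (a j) (\<rho> j))" for n k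
  have Am: "A n k \<in> sets circle_measure" for n k
    unfolding A_def using hump_set_measurable by (intro sets.Diff sets.finite_UN) auto
  have Adisj: "A n j \<inter> A n k = {}" if "j < n" "k < n" "j \<noteq> k" for n j k
    using that unfolding A_def by (cases "j < k") auto
  have \<rho>a: "1 - norm (a j) \<le> \<rho> j" "\<rho> j < 1" for j using \<rho>4[of j] \<rho>half[of j] a(1)[of j] by auto
  have cont: "continuous_on (sphere 0 1) (\<lambda>\<xi>. h (of_real r * \<xi>))" if "h \<in> hardy_space p" "0 \<le> r" "r < 1" for h r
    using that by (intro continuous_on_slice hardy_space_continuous) auto
  have hum: "Lnorm p circle_measure (\<lambda>\<xi>. indicator (- A n k) \<xi> * h k (of_real r * \<xi>)) \<le> e k"
    if h: "\<And>k. h k \<in> hardy_space p" and r: "0 \<le> r" "r < 1" and k: "k < n"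
    and off: "\<And>k \<xi>. norm \<xi> = 1 \<Longrightarrow> \<rho> k \<le> norm (1 - cnj (a k) * \<xi>) \<Longrightarrow> norm (h k (of_real r * \<xi>)) \<le> B * (16 * \<rho> k)"
    and all: "\<And>k \<xi>. norm \<xi> = 1 \<Longrightarrow> norm (h k (of_real r * \<xi>)) \<le> K (\<rho> k)"
    for h :: "nat \<Rightarrow> complex \<Rightarrow> complex" and r n k
    unfolding A_def
    using \<rho>(1)[of k] B e(1)[of k]
    by (intro hump_off_peak[where h="\<lambda>k \<xi>. h k (of_real r * \<xi>)" and \<sigma>="B * (16 * \<rho> k)" and K="K (\<rho> k)"]
        p k cont h r a1 \<rho>a off all total) (auto simp: K_def)
  have Lsum: "(\<Sum>k<n. norm (x k) * e k) \<le> \<epsilon> * (\<Sum>k<n. norm (x k) powr p) powr (1/p)" for x :: "nat \<Rightarrow> complex" and n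
  proof -
    let ?N = "(\<Sum>k<n. norm (x k) powr p) powr (1/p)"
    have "norm (x k) \<le> ?N" if "k < n" for k
    proof -
      have "norm (x k) powr p \<le> (\<Sum>k<n. norm (x k) powr p)" using that by (intro member_le_sum) auto
      then have "(norm (x k) powr p) powr (1/p) \<le> ?N" using p by (intro powr_mono2) auto
      then show ?thesis using p by (simp add: powr_powr)
    qed
    then have "(\<Sum>k<n. norm (x k) * e k) \<le> (\<Sum>k<n. ?N * e k)"
      using e(1) by (intro sum_mono mult_right_mono) (auto intro: less_imp_le)
    also have "\<dots> = ?N * \<epsilon> * (\<Sum>k<n. (1/2) ^ Suc k)" unfolding e_def by (simp add: sum_distrib_left mult_ac)
    also have "\<dots> \<le> ?N * \<epsilon> * 1" using \<epsilon> by (intro mult_left_mono sum_half_powers_le) auto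
    finally show ?thesis by (simp add: mult.commute)
  qed
  have int: "integrable circle_measure (\<lambda>\<xi>. norm (h (of_real r * \<xi>)) powr p)"
    if "h \<in> hardy_space p" "0 \<le> r" "r < 1" for h r
    using p that by (intro continuous_circle_integrable continuous_on_norm_powr cont) auto
  have meas: "(\<lambda>\<xi>. h (of_real r * \<xi>)) \<in> borel_measurable circle_measure"
    if "h \<in> hardy_space p" "0 \<le> r" "r < 1" for h r
    using that by (intro continuous_circle_measurable cont) auto
  interpret banach_fun_space "hardy_space p" "hardy_norm p" by (rule banach_hardy_space[OF p])
  have "lp_embedding (hardy_space p) (hardy_norm p) ?T ?f p 2 (c/4)"
  proof
    show "bounded_op (hardy_space p) (hardy_norm p) (hardy_space p) (hardy_norm p) ?T" by (rule T)
    show "1 \<le> p" "(0::real) < 2" "0 < c/4" using p c by auto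
    show "?f k \<in> hardy_space p" for k by (rule f)
    fix x :: "nat \<Rightarrow> complex" and n :: nat
    let ?N = "(\<Sum>k<n. norm (x k) powr p) powr (1/p)"
    have ps: "psum ?f x n \<in> hardy_space p" by (rule psum_hardy[OF p f(1)])
    have sl: "slice_norm p (psum ?f x n) r \<le> 2 * ?N" if r: "0 \<le> r" "r < 1" for r
    proof -
      have "slice_norm p (psum ?f x n) r \<le> (\<Sum>k<n. (norm (x k) * Lnorm p circle_measure (\<lambda>\<xi>. ?f k (of_real r * \<xi>))) powr p) powr (1/p)
          + (\<Sum>k<n. norm (x k) * e k)"
        unfolding slice_norm_psum
      proof (rule gliding_hump_upper[OF p _ _ Am Adisj])
        fix k assume k: "k < n"
        show "Lnorm p circle_measure (\<lambda>\<xi>. indicator (- A n k) \<xi> * ?f k (of_real r * \<xi>)) \<le> e k"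
        proof (rule hum[where h="?f", OF f(1) r k])
          fix k \<xi> assume n1: "norm (\<xi>::complex) = 1"
          note pb = peak_bounds[OF p \<rho>(1) \<rho>half a(1) n1 r]
          have "2 / \<rho> k ^ 8 \<le> K (\<rho> k)" unfolding K_def using B(1) \<rho>(1)[of k] mult_right_mono[of 1 B "2 / \<rho> k ^ 8"] by simp
          then show "norm (?f k (of_real r * \<xi>)) \<le> K (\<rho> k)" using pb(1)[of k] by linarith
          assume off: "\<rho> k \<le> norm (1 - cnj (a k) * \<xi>)"
          have "16 * \<rho> k \<le> B * (16 * \<rho> k)" using B(1) \<rho>(1)[of k] mult_right_mono[of 1 B "16 * \<rho> k"] by simp
          then show "norm (?f k (of_real r * \<xi>)) \<le> B * (16 * \<rho> k)" using pb(2)[OF off] by linarith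
        qed
      qed (auto intro: int[OF f(1) r] meas[OF f(1) r, simplified])
      also have "(\<Sum>k<n. (norm (x k) * Lnorm p circle_measure (\<lambda>\<xi>. ?f k (of_real r * \<xi>))) powr p) powr (1/p) \<le> ?N"
      proof (intro powr_mono2 sum_mono)
        show "norm (x k) * Lnorm p circle_measure (\<lambda>\<xi>. ?f k (of_real r * \<xi>)) \<le> norm (x k)" for k
          using slice_norm_le[OF f(1) p r, of k] f(2)[of k] unfolding slice_norm_def
          by (intro mult_left_le) auto
      qed (use p in \<open>auto intro: sum_nonneg\<close>)
      also have "(\<Sum>k<n. norm (x k) * e k) \<le> 1 * ?N"
        using \<epsilon> by (intro order_trans[OF Lsum] mult_right_mono) auto
      finally show ?thesis by simp
    qed
    show "hardy_norm p (psum ?f x n) \<le> 2 * ?N"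
      by (rule hardy_spaceI(2)[OF hardy_spaceD[OF ps] p sl])
    \<comment> \<open>One radius has to show all \<open>n\<close> images with nearly their full
      norms. It may depend on \<open>n\<close>, because the slice norm of the sum on this circle is
      anyway at most its Hardy norm.\<close>
    have "eventually (\<lambda>r. \<forall>k\<in>{..<n}. 3*c/4 < slice_norm p (?F k) r) (at_left 1)"
    proof (rule eventually_ball_finite)
      show "\<forall>k\<in>{..<n}. \<forall>\<^sub>F r in at_left 1. 3*c/4 < slice_norm p (?F k) r"
      proof
        fix k
        have "3*c/4 < hardy_norm p (?F k)" using cF[of k] c by linarith
        then show "\<forall>\<^sub>F r in at_left 1. 3*c/4 < slice_norm p (?F k) r"
          using p by (intro order_tendstoD(1)[OF slice_norm_tendsto[OF F]]) auto
      qed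
    qed simp
    moreover have "eventually (\<lambda>r. r \<in> {0<..<1}) (at_left (1::real))" by (rule eventually_at_leftI[of 0]) auto
    ultimately have "eventually (\<lambda>r. r \<in> {0<..<1} \<and> (\<forall>k\<in>{..<n}. 3*c/4 < slice_norm p (?F k) r)) (at_left 1)"
      by eventually_elim auto
    from eventually_happens'[OF _ this] obtain r where
      "r \<in> {0<..<1} \<and> (\<forall>k\<in>{..<n}. 3*c/4 < slice_norm p (?F k) r)" by auto
    then have r: "0 \<le> r" "r < 1" "\<And>k. k < n \<Longrightarrow> 3*c/4 < slice_norm p (?F k) r" by auto
    \<comment> \<open>The slice norms exceed \<open>3*c/4\<close> and each remainder is at most
      \<open>c/4\<close>, so \<open>gliding_hump_lower\<close> applies with
      \<open>\<gamma> = c/2\<close>.\<close>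
    have "c/2 * ?N \<le> Lnorm p circle_measure (\<lambda>\<xi>. \<Sum>k<n. x k * ?F k (of_real r * \<xi>)) + (\<Sum>k<n. norm (x k) * e k)"
    proof (rule gliding_hump_lower[OF p _ _ Am Adisj])
      fix k assume k: "k < n"
      show "c/2 + e k \<le> Lnorm p circle_measure (\<lambda>\<xi>. ?F k (of_real r * \<xi>))"
        using r(3)[OF k] e(2)[of k] by (simp add: slice_norm_def)
      show "Lnorm p circle_measure (\<lambda>\<xi>. indicator (- A n k) \<xi> * ?F k (of_real r * \<xi>)) \<le> e k"
      proof (rule hum[where h="?F", OF F r(1,2) k])
        fix k \<xi> assume n1: "norm (\<xi>::complex) = 1"
        note vb = volterra_peak_bounds[OF p \<rho>(1) \<rho>half a(1) g B(2) n1 r(1,2)]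
        show "norm (?F k (of_real r * \<xi>)) \<le> K (\<rho> k)" unfolding K_def by (rule vb(1))
        show "norm (?F k (of_real r * \<xi>)) \<le> B * (16 * \<rho> k)" if "\<rho> k \<le> norm (1 - cnj (a k) * \<xi>)"
          by (rule vb(2)[OF _ that])
      qed
    qed (use c in \<open>auto intro: int[OF F r(1,2)] meas[OF F r(1,2), simplified]\<close>)
    also have "Lnorm p circle_measure (\<lambda>\<xi>. \<Sum>k<n. x k * ?F k (of_real r * \<xi>)) = slice_norm p (?T (psum ?f x n)) r"
    proof -
      have "?T (psum ?f x n) = psum ?F x n"
        unfolding psum_def by (rule bounded_op_sum[OF T sub f(1)])
      then show ?thesis by (simp add: slice_norm_psum)
    qed
    also have "\<dots> \<le> hardy_norm p (?T (psum ?f x n))"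
      by (rule slice_norm_le[OF bounded_op_in[OF T psum_hardy[OF p f(1)]] p r(1,2)])
    also have "(\<Sum>k<n. norm (x k) * e k) \<le> c/4 * ?N"
      using \<epsilon> by (intro order_trans[OF Lsum] mult_right_mono) auto
    finally show "c/4 * ?N \<le> hardy_norm p (?T (psum ?f x n))" by simp
  qed
  then show ?thesis by blast
qed

end

section \<open>Lacunary series\<close>

text \<open>Spectrum in \<open>S\<close> and coefficient sum, the Wiener norm, at most
  \<open>A\<close>. The representation is required on the unit circle only, where conjugation is
  inversion, and values elsewhere are free.\<close>

definition trig :: "int set \<Rightarrow> real \<Rightarrow> (complex \<Rightarrow> complex) \<Rightarrow> bool" where
  "trig S A h \<longleftrightarrow> (\<exists>c. (\<forall>\<xi>. norm \<xi> = 1 \<longrightarrow> h \<xi> = (\<Sum>j\<in>S. c j * \<xi> powi j)) \<and> (\<Sum>j\<in>S. norm (c j)) \<le> A)"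

lemma trig_zero: "0 \<le> A \<Longrightarrow> trig S A (\<lambda>\<xi>. 0)"
  unfolding trig_def by (intro exI[of _ "\<lambda>_. 0"]) auto

lemma trig_monom:
  assumes "finite S" "j \<in> S" "norm c \<le> A"
  shows "trig S A (\<lambda>\<xi>. c * \<xi> powi j)"
  unfolding trig_def
proof (intro exI[of _ "\<lambda>i. if i = j then c else 0"] conjI allI impI)
  show "c * \<xi> powi j = (\<Sum>i\<in>S. (if i = j then c else 0) * \<xi> powi i)" for \<xi> :: complex
    using assms sum.delta[of S j "\<lambda>i. c * \<xi> powi i"] by (simp add: if_distrib[of "\<lambda>x. x * _"] cong: if_cong)
  show "(\<Sum>i\<in>S. norm (if i = j then c else 0)) \<le> A"
    using assms sum.delta[of S j "\<lambda>i. norm c"] by (simp add: if_distrib[of norm] cong: if_cong)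
qed

lemma trig_add:
  assumes "trig S A h" "trig S A' h'"
  shows "trig S (A + A') (\<lambda>\<xi>. h \<xi> + h' \<xi>)"
proof -
  obtain c where c: "\<And>\<xi>. norm \<xi> = 1 \<Longrightarrow> h \<xi> = (\<Sum>j\<in>S. c j * \<xi> powi j)" "(\<Sum>j\<in>S. norm (c j)) \<le> A"
    using assms(1) unfolding trig_def by blast
  obtain c' where c': "\<And>\<xi>. norm \<xi> = 1 \<Longrightarrow> h' \<xi> = (\<Sum>j\<in>S. c' j * \<xi> powi j)" "(\<Sum>j\<in>S. norm (c' j)) \<le> A'"
    using assms(2) unfolding trig_def by blast
  show ?thesis
    unfolding trig_def
  proof (intro exI[of _ "\<lambda>j. c j + c' j"] conjI allI impI)
    show "h \<xi> + h' \<xi> = (\<Sum>j\<in>S. (c j + c' j) * \<xi> powi j)" if "norm \<xi> = 1" for \<xi>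
      using that by (simp add: c c' distrib_right sum.distrib)
    have "(\<Sum>j\<in>S. norm (c j + c' j)) \<le> (\<Sum>j\<in>S. norm (c j) + norm (c' j))"
      by (intro sum_mono norm_triangle_ineq)
    then show "(\<Sum>j\<in>S. norm (c j + c' j)) \<le> A + A'" using c(2) c'(2) by (simp add: sum.distrib)
  qed
qed

lemma trig_cmult:
  assumes "trig S A h"
  shows "trig S (norm a * A) (\<lambda>\<xi>. a * h \<xi>)"
proof -
  obtain c where c: "\<And>\<xi>. norm \<xi> = 1 \<Longrightarrow> h \<xi> = (\<Sum>j\<in>S. c j * \<xi> powi j)" "(\<Sum>j\<in>S. norm (c j)) \<le> A"
    using assms unfolding trig_def by blast
  show ?thesis
    unfolding trig_def
  proof (intro exI[of _ "\<lambda>j. a * c j"] conjI allI impI)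
    show "a * h \<xi> = (\<Sum>j\<in>S. a * c j * \<xi> powi j)" if "norm \<xi> = 1" for \<xi>
      using that by (simp add: c sum_distrib_left mult.assoc)
    show "(\<Sum>j\<in>S. norm (a * c j)) \<le> norm a * A"
      using mult_left_mono[OF c(2), of "norm a"] by (simp add: norm_mult sum_distrib_left)
  qed
qed

lemma trig_mono:
  assumes "trig S A h" "finite S'" "S \<subseteq> S'" "A \<le> A'"
  shows "trig S' A' h"
proof -
  obtain c where c: "\<And>\<xi>. norm \<xi> = 1 \<Longrightarrow> h \<xi> = (\<Sum>j\<in>S. c j * \<xi> powi j)" "(\<Sum>j\<in>S. norm (c j)) \<le> A"
    using assms unfolding trig_def by blast
  let ?c = "\<lambda>j. if j \<in> S then c j else 0"
  show ?thesis
    unfolding trig_def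
  proof (intro exI[of _ ?c] conjI allI impI)
    show "h \<xi> = (\<Sum>j\<in>S'. ?c j * \<xi> powi j)" if "norm \<xi> = 1" for \<xi>
      unfolding c(1)[OF that] using assms by (intro sum.mono_neutral_cong_left) auto
    have "(\<Sum>j\<in>S'. norm (?c j)) = (\<Sum>j\<in>S. norm (c j))"
      using assms by (intro sum.mono_neutral_cong_right) auto
    then show "(\<Sum>j\<in>S'. norm (?c j)) \<le> A'" using c(2) assms by simp
  qed
qed

lemma trig_shift:
  assumes "trig S A h"
  shows "trig ((+) n ` S) A (\<lambda>\<xi>. \<xi> powi n * h \<xi>)"
proof -
  obtain c where c: "\<And>\<xi>. norm \<xi> = 1 \<Longrightarrow> h \<xi> = (\<Sum>j\<in>S. c j * \<xi> powi j)" "(\<Sum>j\<in>S. norm (c j)) \<le> A"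
    using assms unfolding trig_def by blast
  have inj: "inj_on ((+) n) S" by simp
  show ?thesis
    unfolding trig_def
  proof (intro exI[of _ "\<lambda>j. c (j - n)"] conjI allI impI)
    show "\<xi> powi n * h \<xi> = (\<Sum>j\<in>(+) n ` S. c (j - n) * \<xi> powi j)" if n1: "norm \<xi> = 1" for \<xi>
    proof -
      have "\<xi> \<noteq> 0" using n1 by auto
      then show ?thesis by (simp add: c n1 sum.reindex[OF inj] sum_distrib_left power_int_add mult_ac)
    qed
    show "(\<Sum>j\<in>(+) n ` S. norm (c (j - n))) \<le> A"
      using c(2) by (simp add: sum.reindex[OF inj])
  qed
qed

lemma trig_sum:
  assumes "finite I" "\<And>i. i \<in> I \<Longrightarrow> trig S (A i) (h i)"
  shows "trig S (\<Sum>i\<in>I. A i) (\<lambda>\<xi>. \<Sum>i\<in>I. h i \<xi>)"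
  using assms by (induction I rule: finite_induct) (auto intro: trig_zero trig_add)

lemma trig_cong: "trig S A h \<Longrightarrow> (\<And>\<xi>. norm \<xi> = 1 \<Longrightarrow> h \<xi> = h' \<xi>) \<Longrightarrow> trig S A h'"
  unfolding trig_def by fastforce

text \<open>In products only the spectrum is needed later, so the coefficient sum is left
  unspecified.\<close>

lemma trig_mult:
  assumes h: "trig {a..b} A h" and h': "trig {a'..b'} A' h'"
  shows "\<exists>C. trig {a + a'..b + b'} C (\<lambda>\<xi>. h \<xi> * h' \<xi>)"
proof -
  obtain c where c: "\<And>\<xi>. norm \<xi> = 1 \<Longrightarrow> h \<xi> = (\<Sum>j\<in>{a..b}. c j * \<xi> powi j)"
    using h unfolding trig_def by blast
  have "trig {a + a'..b + b'} (norm (c j) * A') (\<lambda>\<xi>. c j * (\<xi> powi j * h' \<xi>))" if "j \<in> {a..b}" for j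
    by (intro trig_cmult trig_mono[OF trig_shift[OF h', of j]]) (use that in auto)
  then have "trig {a + a'..b + b'} (\<Sum>j\<in>{a..b}. norm (c j) * A') (\<lambda>\<xi>. \<Sum>j\<in>{a..b}. c j * (\<xi> powi j * h' \<xi>))"
    by (intro trig_sum) auto
  then have "trig {a + a'..b + b'} (\<Sum>j\<in>{a..b}. norm (c j) * A') (\<lambda>\<xi>. h \<xi> * h' \<xi>)"
    by (rule trig_cong) (simp add: c sum_distrib_right mult.assoc)
  then show ?thesis by blast
qed

lemma trig_power:
  assumes h: "trig {0..D} A h"
  shows "\<exists>C. trig {0..int k * D} C (\<lambda>\<xi>. h \<xi> ^ k)"
proof (induction k)
  case 0
  have "trig {0..int 0 * D} 1 (\<lambda>\<xi>. 1 * \<xi> powi 0)" by (intro trig_monom) auto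
  then show ?case by auto
next
  case (Suc k)
  then obtain C where "trig {0..int k * D} C (\<lambda>\<xi>. h \<xi> ^ k)" by blast
  from trig_mult[OF h this] show ?case by (simp add: algebra_simps)
qed

lemma trig_continuous:
  assumes "trig S A h"
  shows "continuous_on (sphere 0 1) h"
proof -
  obtain c where c: "\<And>\<xi>. norm \<xi> = 1 \<Longrightarrow> h \<xi> = (\<Sum>j\<in>S. c j * \<xi> powi j)"
    using assms unfolding trig_def by blast
  have "continuous_on (sphere 0 1) (\<lambda>\<xi>::complex. \<Sum>j\<in>S. c j * \<xi> powi j)"
    by (intro continuous_intros) auto
  then show ?thesis by (rule continuous_on_eq) (simp add: c)
qed

text \<open>The pairing expands into Fourier coefficients of \<open>F\<close> at the negated
  frequencies of \<open>h\<close>. With \<open>\<tau> = 0\<close> it gives orthogonality; with small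
  \<open>\<tau>\<close> it bounds the errors in the Paley-type argument.\<close>

lemma trig_pairing:
  assumes h: "trig S A h" and F: "continuous_on (sphere 0 1) F"
    and \<tau>: "\<And>j. j \<in> S \<Longrightarrow> norm (LINT \<xi>|circle_measure. F \<xi> * \<xi> powi j) \<le> \<tau>" "\<tau> \<ge> 0"
  shows "norm (LINT \<xi>|circle_measure. F \<xi> * h \<xi>) \<le> A * \<tau>"
proof -
  obtain c where c: "\<And>\<xi>. norm \<xi> = 1 \<Longrightarrow> h \<xi> = (\<Sum>j\<in>S. c j * \<xi> powi j)" "(\<Sum>j\<in>S. norm (c j)) \<le> A"
    using h unfolding trig_def by blast
  have i: "integrable circle_measure (\<lambda>\<xi>. c j * (F \<xi> * \<xi> powi j))" for j
    by (intro continuous_circle_integrable continuous_intros F) auto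
  have "(LINT \<xi>|circle_measure. F \<xi> * h \<xi>) = (LINT \<xi>|circle_measure. (\<Sum>j\<in>S. c j * (F \<xi> * \<xi> powi j)))"
    by (intro Bochner_Integration.integral_cong) (auto simp: c sum_distrib_left mult_ac)
  also have "\<dots> = (\<Sum>j\<in>S. c j * (LINT \<xi>|circle_measure. F \<xi> * \<xi> powi j))"
    by (subst Bochner_Integration.integral_sum[OF i]) simp
  also have "norm \<dots> \<le> (\<Sum>j\<in>S. norm (c j) * \<tau>)"
    using \<tau> by (intro order_trans[OF norm_sum] sum_mono) (auto simp: norm_mult intro: mult_left_mono)
  also have "\<dots> \<le> A * \<tau>" using c(2) \<tau> by (simp add: sum_distrib_right[symmetric] mult_right_mono)
  finally show ?thesis .
qed

lemma cnj_powi_unit: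
  fixes \<xi> :: complex
  assumes "norm \<xi> = 1"
  shows "cnj \<xi> powi j = \<xi> powi (- j)"
proof -
  have "\<xi> * cnj \<xi> = 1" using assms by (metis complex_norm_square of_real_1 power_one)
  then have "cnj \<xi> = inverse \<xi>" by (rule inverse_unique[symmetric])
  then show ?thesis by (simp add: power_int_inverse power_int_minus)
qed

lemma trig_orthogonal:
  assumes h: "trig S A h" and h': "trig S' A' h'" and fin: "finite S'" "S \<inter> S' = {}"
  shows "(LINT \<xi>|circle_measure. h \<xi> * cnj (h' \<xi>)) = 0"
proof -
  obtain c where c: "\<And>\<xi>. norm \<xi> = 1 \<Longrightarrow> h' \<xi> = (\<Sum>j\<in>S'. c j * \<xi> powi j)"
    using h' unfolding trig_def by blast
  have z: "(LINT \<xi>|circle_measure. \<xi> powi (-k) * h \<xi>) = 0" if k: "k \<in> S'" for k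
  proof -
    have "norm (LINT \<xi>|circle_measure. \<xi> powi (-k) * h \<xi>) \<le> A * 0"
    proof (rule trig_pairing[OF h])
      show "continuous_on (sphere 0 1) (\<lambda>\<xi>::complex. \<xi> powi (-k))" by (intro continuous_intros) auto
      fix j assume "j \<in> S"
      then have "j \<noteq> k" using k fin by auto
      have "(LINT \<xi>|circle_measure. \<xi> powi (-k) * \<xi> powi j) = (LINT \<xi>|circle_measure. \<xi> powi (j - k))"
      proof (intro Bochner_Integration.integral_cong refl)
        fix \<xi> assume "\<xi> \<in> space circle_measure"
        then have "\<xi> \<noteq> 0" by auto
        then show "\<xi> powi (-k) * \<xi> powi j = \<xi> powi (j - k)" by (simp flip: power_int_add)
      qed
      then show "norm (LINT \<xi>|circle_measure. \<xi> powi (-k) * \<xi> powi j) \<le> 0"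
        using \<open>j \<noteq> k\<close> by (simp add: circle_integral_powi)
    qed simp
    then show ?thesis by simp
  qed
  have i: "integrable circle_measure (\<lambda>\<xi>. cnj (c k) * (\<xi> powi (-k) * h \<xi>))" for k
    by (intro continuous_circle_integrable continuous_intros trig_continuous[OF h]) auto
  have "(LINT \<xi>|circle_measure. h \<xi> * cnj (h' \<xi>)) = (LINT \<xi>|circle_measure. (\<Sum>k\<in>S'. cnj (c k) * (\<xi> powi (-k) * h \<xi>)))"
    by (intro Bochner_Integration.integral_cong) (auto simp: c cnj_powi_unit sum_distrib_left mult_ac)
  also have "\<dots> = (\<Sum>k\<in>S'. cnj (c k) * (LINT \<xi>|circle_measure. \<xi> powi (-k) * h \<xi>))"
    by (subst Bochner_Integration.integral_sum[OF i]) simp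
  finally show ?thesis using z by simp
qed

lemma circle_pythagoras:
  fixes u :: "nat \<Rightarrow> complex \<Rightarrow> complex"
  assumes fin: "finite I" and c: "\<And>i. i \<in> I \<Longrightarrow> continuous_on (sphere 0 1) (u i)"
    and orth: "\<And>i j. i \<in> I \<Longrightarrow> j \<in> I \<Longrightarrow> i \<noteq> j \<Longrightarrow> (LINT \<xi>|circle_measure. u i \<xi> * cnj (u j \<xi>)) = 0"
  shows "(LINT \<xi>|circle_measure. norm (\<Sum>i\<in>I. u i \<xi>) ^ 2) = (\<Sum>i\<in>I. LINT \<xi>|circle_measure. norm (u i \<xi>) ^ 2)"
proof -
  have i: "integrable circle_measure (\<lambda>\<xi>. u i \<xi> * cnj (u j \<xi>))" if "i \<in> I" "j \<in> I" for i j
    by (intro continuous_circle_integrable continuous_intros continuous_on_cnj c that)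
  have "complex_of_real (LINT \<xi>|circle_measure. norm (\<Sum>i\<in>I. u i \<xi>) ^ 2) =
      (LINT \<xi>|circle_measure. (\<Sum>i\<in>I. \<Sum>j\<in>I. u i \<xi> * cnj (u j \<xi>)))"
    unfolding integral_complex_of_real[symmetric]
    by (intro Bochner_Integration.integral_cong refl) (simp only: complex_norm_square cnj_sum sum_product)
  also have "\<dots> = (\<Sum>i\<in>I. \<Sum>j\<in>I. LINT \<xi>|circle_measure. u i \<xi> * cnj (u j \<xi>))"
    using i by (subst Bochner_Integration.integral_sum, auto)
  also have "\<dots> = (\<Sum>i\<in>I. LINT \<xi>|circle_measure. u i \<xi> * cnj (u i \<xi>))"
  proof (rule sum.cong[OF refl])
    fix i assume i: "i \<in> I"
    have "(\<Sum>j\<in>I. LINT \<xi>|circle_measure. u i \<xi> * cnj (u j \<xi>)) = (\<Sum>j\<in>{i}. LINT \<xi>|circle_measure. u i \<xi> * cnj (u j \<xi>))"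
      using i fin orth by (intro sum.mono_neutral_right) auto
    then show "(\<Sum>j\<in>I. LINT \<xi>|circle_measure. u i \<xi> * cnj (u j \<xi>)) = (LINT \<xi>|circle_measure. u i \<xi> * cnj (u i \<xi>))" by simp
  qed
  also have "\<dots> = (\<Sum>i\<in>I. complex_of_real (LINT \<xi>|circle_measure. norm (u i \<xi>) ^ 2))"
    unfolding integral_complex_of_real[symmetric]
    by (intro sum.cong Bochner_Integration.integral_cong refl) (simp only: complex_norm_square)
  finally show ?thesis by (simp only: of_real_sum[symmetric] of_real_eq_iff)
qed

text \<open>Expanding \<open>(S n + y n * \<xi> ^ N n) ^ j\<close> binomially, the terms have spectra in disjoint blocks
  of length \<open>N n\<close>, hence are orthogonal.\<close>

lemma lacunary_moment:
  fixes y :: "nat \<Rightarrow> complex" and N :: "nat \<Rightarrow> nat" and m :: nat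
  assumes N: "\<And>k. m * N k < N (Suc k)" "N 0 > 0" "m > 0"
  defines "S \<equiv> \<lambda>n \<xi>. \<Sum>k<n. y k * \<xi> ^ N k"
  shows "j \<le> m \<Longrightarrow> (LINT \<xi>|circle_measure. norm (S n \<xi> ^ j) ^ 2) \<le> fact j * (\<Sum>k<n. norm (y k) ^ 2) ^ j"
proof (induction n arbitrary: j)
  case 0
  then show ?case by (cases "j = 0") (auto simp: S_def power_0_left)
next
  case (Suc n)
  \<comment> \<open>The largest exponent in \<open>S n\<close>, with default 0 for the empty
    sum.\<close>
  define D where "D = (case n of 0 \<Rightarrow> 0 | Suc i \<Rightarrow> int (N i))"
  have mono: "N i < N (Suc i)" for i using N(1)[of i] N(3) by (intro le_less_trans[OF _ N(1)]) simp
  have ND: "int m * D < int (N n)" 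
  proof (cases n)
    case (Suc i)
    then show ?thesis using N(1)[of i] by (simp add: D_def flip: of_nat_mult)
  qed (use N in \<open>auto simp: D_def\<close>)
  have D0: "D \<ge> 0" by (simp add: D_def split: nat.splits)
  have Strig: "trig {0..D} (\<Sum>k<n. norm (y k)) (S n)"
    unfolding S_def
  proof (rule trig_sum)
    fix k assume "k \<in> {..<n}"
    moreover have "N k \<le> N i" if "k \<le> i" for i
      using lift_Suc_mono_le[of N k i] mono that by (auto intro: less_imp_le)
    ultimately have "int (N k) \<in> {0..D}" unfolding D_def by (auto split: nat.splits)
    then have "trig {0..D} (norm (y k)) (\<lambda>\<xi>. y k * \<xi> powi int (N k))" by (intro trig_monom) auto
    then show "trig {0..D} (norm (y k)) (\<lambda>\<xi>. y k * \<xi> ^ N k)" by simp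
  qed auto
  let ?A = "\<Sum>k<n. norm (y k) ^ 2"
  let ?u = "\<lambda>i \<xi>. of_nat (j choose i) * (y n * \<xi> ^ N n) ^ i * S n \<xi> ^ (j - i)"
  have utrig: "\<exists>C. trig {int i * int (N n)..<int (Suc i) * int (N n)} C (?u i)" if i: "i \<le> j" for i
  proof -
    obtain C where "trig {0..int (j - i) * D} C (\<lambda>\<xi>. S n \<xi> ^ (j - i))" using trig_power[OF Strig] by blast
    from trig_cmult[OF trig_shift[OF this, of "int i * int (N n)"], of "of_nat (j choose i) * y n ^ i"]
    have *: "trig ((+) (int i * int (N n)) ` {0..int (j - i) * D}) (norm (of_nat (j choose i) * y n ^ i :: complex) * C) (?u i)"
      by (rule trig_cong) (simp add: power_mult_distrib power_int_of_nat power_mult[symmetric] mult_ac flip: of_nat_mult)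
    have "int (j - i) * D \<le> int m * D" using Suc.prems D0 by (intro mult_right_mono) auto
    then have "(+) (int i * int (N n)) ` {0..int (j - i) * D} \<subseteq> {int i * int (N n)..<int (Suc i) * int (N n)}"
      using ND by (auto simp: algebra_simps)
    from trig_mono[OF * _ this order_refl] show ?thesis by auto
  qed
  have uc: "continuous_on (sphere 0 1) (?u i)" for i
    unfolding S_def by (intro continuous_intros)
  have orth: "(LINT \<xi>|circle_measure. ?u i \<xi> * cnj (?u l \<xi>)) = 0" if il: "i \<in> {..j}" "l \<in> {..j}" "i \<noteq> l" for i l
  proof -
    obtain C C' where C: "trig {int i * int (N n)..<int (Suc i) * int (N n)} C (?u i)"
      "trig {int l * int (N n)..<int (Suc l) * int (N n)} C' (?u l)"
      using utrig[of i] utrig[of l] il by auto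
    have "{int i * int (N n)..<int (Suc i) * int (N n)} \<inter> {int l * int (N n)..<int (Suc l) * int (N n)} = {}"
    proof -
      have "int (Suc i) * int (N n) \<le> int l * int (N n) \<or> int (Suc l) * int (N n) \<le> int i * int (N n)"
      proof (cases "i < l")
        case True then show ?thesis by (intro disjI1 mult_right_mono) auto
      next
        case False then show ?thesis using il(3) by (intro disjI2 mult_right_mono) auto
      qed
      then show ?thesis by auto
    qed
    from trig_orthogonal[OF C _ this] show ?thesis by simp
  qed
  have "(LINT \<xi>|circle_measure. norm (S (Suc n) \<xi> ^ j) ^ 2) = (LINT \<xi>|circle_measure. norm (\<Sum>i\<le>j. ?u i \<xi>) ^ 2)"
    by (simp add: S_def add.commute[of "\<Sum>k<n. _ k"] binomial_ring)
  also have "\<dots> = (\<Sum>i\<le>j. LINT \<xi>|circle_measure. norm (?u i \<xi>) ^ 2)"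
    by (intro circle_pythagoras uc orth) auto
  also have "\<dots> \<le> (\<Sum>i\<le>j. fact j * (of_nat (j choose i) * (norm (y n) ^ 2) ^ i * ?A ^ (j - i)))"
  proof (rule sum_mono)
    fix i assume "i \<in> {..j}"
    then have i: "i \<le> j" by simp
    have "(LINT \<xi>|circle_measure. norm (?u i \<xi>) ^ 2) = (LINT \<xi>|circle_measure. (of_nat (j choose i))\<^sup>2 * (norm (y n) ^ 2) ^ i * norm (S n \<xi> ^ (j - i)) ^ 2)"
      by (intro Bochner_Integration.integral_cong refl)
         (simp add: norm_mult norm_power power_mult_distrib mult_ac flip: power_mult)
    also have "\<dots> = (of_nat (j choose i))\<^sup>2 * (norm (y n) ^ 2) ^ i * (LINT \<xi>|circle_measure. norm (S n \<xi> ^ (j - i)) ^ 2)"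
      by simp
    also have "\<dots> \<le> (of_nat (j choose i))\<^sup>2 * (norm (y n) ^ 2) ^ i * (fact (j - i) * ?A ^ (j - i))"
      using Suc.prems by (intro mult_left_mono Suc.IH) auto
    also have "\<dots> = (of_nat (j choose i) * fact (j - i)) * (of_nat (j choose i) * (norm (y n) ^ 2) ^ i * ?A ^ (j - i))"
      by (simp add: power2_eq_square mult_ac)
    \<comment> \<open>Since \<open>(j choose i) * fact (j - i) = fact j / fact i\<close>, one of the
      two binomial coefficients is absorbed, and the other one rebuilds the binomial formula for the
      squares.\<close>
    also have "\<dots> \<le> fact j * (of_nat (j choose i) * (norm (y n) ^ 2) ^ i * ?A ^ (j - i))"
    proof (rule mult_right_mono)
      have "fact i * fact (j - i) * (j choose i) = (fact j :: nat)" by (rule binomial_fact_lemma[OF i])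
      then have "fact j = fact i * ((j choose i) * fact (j - i))" by (simp only: mult_ac)
      moreover have "1 * ((j choose i) * fact (j - i)) \<le> fact i * ((j choose i) * (fact (j - i) :: nat))"
        by (intro mult_right_mono fact_ge_1) auto
      ultimately have "(j choose i) * fact (j - i) \<le> (fact j :: nat)" by linarith
      then have "real ((j choose i) * fact (j - i)) \<le> real (fact j)" by (simp only: of_nat_le_iff)
      then show "of_nat (j choose i) * fact (j - i) \<le> (fact j :: real)" by simp
      show "0 \<le> of_nat (j choose i) * (norm (y n) ^ 2) ^ i * ?A ^ (j - i)"
        by (intro mult_nonneg_nonneg zero_le_power sum_nonneg) auto
    qed
    finally show "(LINT \<xi>|circle_measure. norm (?u i \<xi>) ^ 2) \<le> fact j * (of_nat (j choose i) * (norm (y n) ^ 2) ^ i * ?A ^ (j - i))" .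
  qed
  also have "\<dots> = fact j * (norm (y n) ^ 2 + ?A) ^ j"
    by (simp add: binomial_ring sum_distrib_left)
  finally show ?case by (simp add: add.commute)
qed

text \<open>For \<open>t = norm (?S \<xi>) / sqrt ?A\<close> one has
  \<open>t powr p \<le> 1 + t ^ (2 * m)\<close>, so a single even moment controls every exponent up
  to \<open>2 * m\<close>. Normalizing by \<open>sqrt ?A\<close> makes both terms scale
  alike.\<close>

lemma lacunary_powr_mean:
  fixes y :: "nat \<Rightarrow> complex" and N :: "nat \<Rightarrow> nat" and m :: nat
  assumes N: "\<And>k. m * N k < N (Suc k)" "N 0 > 0" "m > 0" and p: "1 \<le> p" "p \<le> 2 * real m"
  shows "(LINT \<xi>|circle_measure. norm (\<Sum>k<n. y k * \<xi> ^ N k) powr p) \<le>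
    (1 + fact m) * (\<Sum>k<n. norm (y k) ^ 2) powr (p/2)"
proof -
  let ?A = "\<Sum>k<n. norm (y k) ^ 2" and ?S = "\<lambda>\<xi>. \<Sum>k<n. y k * \<xi> ^ N k"
  show ?thesis
  proof (cases "?A = 0")
    case True
    then have "y k = 0" if "k < n" for k using that by (subst (asm) sum_nonneg_eq_0_iff) auto
    then show ?thesis using True p by simp
  next
    case False
    then have A: "?A > 0" using sum_nonneg[of "{..<n}" "\<lambda>k. norm (y k) ^ 2"] by simp
    have pt: "norm (?S \<xi>) powr p \<le> ?A powr (p/2) * (1 + norm (?S \<xi> ^ m) ^ 2 / ?A ^ m)" for \<xi>
    proof -
      define t where "t = norm (?S \<xi>) / sqrt ?A"
      have t: "t \<ge> 0" unfolding t_def using A by simp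
      have "t powr p \<le> 1 + t ^ (2 * m)"
      proof (cases "t \<le> 1")
        case True
        then have "t powr p \<le> 1 powr p" using t p by (intro powr_mono2) auto
        then show ?thesis using t by (simp add: add_increasing2)
      next
        case False
        then have "t powr p \<le> t powr (2 * real m)" using p by (intro powr_mono) auto
        also have "\<dots> = t ^ (2 * m)" using False powr_realpow[of t "2 * m"] by simp
        finally show ?thesis by simp
      qed
      then have "sqrt ?A powr p * t powr p \<le> sqrt ?A powr p * (1 + t ^ (2 * m))" by (intro mult_left_mono) auto
      moreover have "sqrt ?A powr p * t powr p = norm (?S \<xi>) powr p"
        using A by (simp add: t_def flip: powr_mult)
      moreover have "sqrt ?A powr p = ?A powr (p/2)" using A by (simp add: powr_half_sqrt[symmetric] powr_powr)
      moreover have "t ^ (2 * m) = norm (?S \<xi> ^ m) ^ 2 / ?A ^ m"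
      proof -
        have "t ^ (2 * m) = (t\<^sup>2) ^ m" by (rule power_mult)
        also have "t\<^sup>2 = (norm (?S \<xi>))\<^sup>2 / ?A" using A by (simp add: t_def power_divide)
        also have "((norm (?S \<xi>))\<^sup>2 / ?A) ^ m = ((norm (?S \<xi>))\<^sup>2) ^ m / ?A ^ m" by (rule power_divide)
        also have "((norm (?S \<xi>))\<^sup>2) ^ m = norm (?S \<xi> ^ m) ^ 2"
          by (simp only: norm_power power_mult[symmetric] mult.commute)
        finally show ?thesis .
      qed
      ultimately show ?thesis by simp
    qed
    have "(LINT \<xi>|circle_measure. norm (?S \<xi>) powr p) \<le> (LINT \<xi>|circle_measure. ?A powr (p/2) * (1 + norm (?S \<xi> ^ m) ^ 2 / ?A ^ m))"
      using p A by (intro integral_mono pt continuous_circle_integrable continuous_on_norm_powr continuous_intros) auto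
    also have "\<dots> = ?A powr (p/2) * (1 + (LINT \<xi>|circle_measure. norm (?S \<xi> ^ m) ^ 2) / ?A ^ m)"
    proof -
      have "integrable circle_measure (\<lambda>\<xi>. norm (?S \<xi> ^ m) ^ 2 / ?A ^ m)"
        using A by (intro continuous_circle_integrable continuous_intros) auto
      then show ?thesis by simp
    qed
    also have "\<dots> \<le> ?A powr (p/2) * (1 + (fact m * ?A ^ m) / ?A ^ m)"
      using lacunary_moment[OF N order_refl, where y=y and n=n] A
      by (intro mult_left_mono add_left_mono divide_right_mono) auto
    finally show ?thesis using A by (simp add: mult.commute)
  qed
qed

section \<open>Lower bounds by Rudin--Shapiro polynomials\<close>

definition disk_monom :: "nat \<Rightarrow> complex \<Rightarrow> complex" where
  "disk_monom N z = (if norm z < 1 then z ^ N else 0)"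

lemma disk_monom_holomorphic: "disk_monom N holomorphic_on ball 0 1"
proof -
  have "(\<lambda>z::complex. z ^ N) holomorphic_on ball 0 1" by (intro holomorphic_intros)
  then show ?thesis by (rule holomorphic_transform) (simp add: disk_monom_def)
qed

lemma disk_monom_hardy:
  assumes p: "1 \<le> p"
  shows "disk_monom N \<in> hardy_space p"
proof (rule hardy_spaceI(1)[OF disk_monom_holomorphic _ p, of N 1])
  fix r :: real assume r: "0 \<le> r" "r < 1"
  have "hardy_mean p (disk_monom N) r = (LINT \<xi>|circle_measure. (r ^ N) powr p)"
    unfolding hardy_mean_def
    by (intro Bochner_Integration.integral_cong) (use r in \<open>auto simp: disk_monom_def norm_mult norm_power power_mult_distrib\<close>)
  also have "\<dots> = (r ^ N) powr p" by simp
  finally have "slice_norm p (disk_monom N) r = r ^ N" using p r by (simp add: slice_norm_eq powr_powr)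
  then show "slice_norm p (disk_monom N) r \<le> 1" using r by (simp add: power_le_one)
qed (simp add: disk_monom_def)

definition coef :: "(complex \<Rightarrow> complex) \<Rightarrow> nat \<Rightarrow> complex" where
  "coef F j = (deriv ^^ j) F 0 / fact j"

lemma fourier_coef:
  assumes F: "F holomorphic_on ball 0 1" and r: "0 < r" "r < 1"
  shows "(LINT \<xi>|circle_measure. F (of_real r * \<xi>) * \<xi> powi (- int j)) = coef F j * of_real r ^ j"
proof -
  have "(LINT \<xi>|circle_measure. F (of_real r * \<xi>) * \<xi> powi (- int j)) =
      (LINT \<xi>|circle_measure. of_real r ^ j * (F (of_real r * \<xi>) * (of_real r * \<xi>) / (of_real r * \<xi> - 0) ^ Suc j))"
  proof (intro Bochner_Integration.integral_cong refl)
    fix \<xi> assume "\<xi> \<in> space circle_measure"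
    then have "\<xi> \<noteq> 0" by auto
    then show "F (of_real r * \<xi>) * \<xi> powi (- int j) = of_real r ^ j * (F (of_real r * \<xi>) * (of_real r * \<xi>) / (of_real r * \<xi> - 0) ^ Suc j)"
      using r by (simp add: power_mult_distrib power_int_minus divide_simps)
  qed
  also have "\<dots> = of_real r ^ j * coef F j"
    unfolding integral_mult_right_zero coef_def using r
    by (subst cauchy_circle_integral_disk[OF F r]) auto
  finally show ?thesis by (simp add: mult.commute)
qed

lemma coef_has_fps_expansion:
  assumes "F holomorphic_on ball 0 1"
  shows "F has_fps_expansion Abs_fps (coef F)"
proof -
  have "F analytic_on {0}" using assms by (subst analytic_at) (auto intro!: exI[of _ "ball 0 1"])
  from analytic_at_imp_has_fps_expansion_0[OF this] show ?thesis
    by (simp add: fps_expansion_def coef_def[abs_def])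
qed

text \<open>The image has derivative \<open>N * z ^ (N - 1) * g z\<close>; comparing power series
  gives the factor \<open>N / j\<close>. It stays bounded below for \<open>j\<close> a fixed
  distance beyond \<open>N\<close> and is small for \<open>j\<close> much larger than
  \<open>N\<close>, which decouples lacunary images.\<close>

lemma volterra_monom_coef:
  assumes g: "g holomorphic_on ball 0 1" and N: "N \<ge> 1"
  shows "coef (volterra_op g (disk_monom N)) j = (if j < N then 0 else of_nat N / of_nat j * coef g (j - N))"
proof -
  let ?F = "volterra_op g (disk_monom N)"
  have d: "(?F has_field_derivative of_nat N * z ^ (N - 1) * g z) (at z)" if z: "z \<in> ball 0 1" for z
  proof -
    have "((\<lambda>z. z ^ N) has_field_derivative of_nat N * z ^ (N - 1)) (at z)"
      by (auto intro!: derivative_eq_intros)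
    then have "(disk_monom N has_field_derivative of_nat N * z ^ (N - 1)) (at z)"
      by (rule DERIV_cong_ev[OF refl _ refl, THEN iffD2, rotated])
         (use z in \<open>auto simp: disk_monom_def intro!: eventually_mono[OF eventually_nhds_in_open[of "ball 0 1"]]\<close>)
    then have "deriv (disk_monom N) z = of_nat N * z ^ (N - 1)" by (rule DERIV_imp_deriv)
    then show ?thesis using volterra_op_deriv[OF disk_monom_holomorphic g z, of N] by simp
  qed
  have F: "?F holomorphic_on ball 0 1"
    by (rule holomorphic_on_open[OF open_ball, THEN iffD2]) (use d in blast)
  have 1: "deriv ?F has_fps_expansion fps_deriv (Abs_fps (coef ?F))"
    by (intro has_fps_expansion_deriv coef_has_fps_expansion F)
  have 2: "(\<lambda>z. of_nat N * (z ^ (N - 1) * g z)) has_fps_expansion fps_const (of_nat N) * (fps_X ^ (N - 1) * Abs_fps (coef g))"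
    by (intro fps_expansion_intros coef_has_fps_expansion g)
  have 3: "eventually (\<lambda>z. deriv ?F z = of_nat N * (z ^ (N - 1) * g z)) (nhds 0)"
  proof (rule eventually_mono[OF eventually_nhds_in_open[of "ball 0 1" "0::complex"]])
    show "deriv ?F z = of_nat N * (z ^ (N - 1) * g z)" if "z \<in> ball 0 1" for z
      using DERIV_imp_deriv[OF d[OF that]] by (simp add: mult.assoc)
  qed auto
  have "fps_deriv (Abs_fps (coef ?F)) = fps_const (of_nat N) * (fps_X ^ (N - 1) * Abs_fps (coef g))"
    by (rule fps_expansion_unique_complex[OF 1 has_fps_expansion_cong[OF 3 refl, THEN iffD2, OF 2]])
  then have nth: "of_nat (Suc i) * coef ?F (Suc i) = of_nat N * (if i < N - 1 then 0 else coef g (i - (N - 1)))" for i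
    by (auto simp: fps_eq_iff fps_X_power_mult_nth dest!: spec[of _ i])
  show ?thesis
  proof (cases j)
    case 0
    then show ?thesis using N by (simp add: coef_def volterra_op_def)
  next
    case (Suc i)
    have "i < N - 1 \<longleftrightarrow> j < N" "i - (N - 1) = j - N" using N Suc by auto
    then have "of_nat j * coef ?F j = of_nat N * (if j < N then 0 else coef g (j - N))"
      using nth[of i] Suc by simp
    moreover have "(of_nat j :: complex) \<noteq> 0" using Suc by (simp del: of_nat_Suc)
    ultimately show ?thesis by (cases "j < N") (auto simp: eq_divide_eq mult.commute)
  qed
qed

text \<open>Rudin-Shapiro recursion with lacunary frequencies \<open>n k\<close> and arbitrary
  coefficients \<open>y k\<close> in place of signs. The start \<open>(0, 1)\<close> makes
  \<open>y k\<close> the coefficient with which frequency \<open>- n k\<close> enters the first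
  component. That component is the test polynomial; the second is its companion in the norm
  identity.\<close>

primrec rudin_shapiro :: "(nat \<Rightarrow> complex) \<Rightarrow> (nat \<Rightarrow> nat) \<Rightarrow> nat \<Rightarrow> complex \<Rightarrow> complex \<times> complex" where
  "rudin_shapiro y n 0 = (\<lambda>\<xi>. (0, 1))"
| "rudin_shapiro y n (Suc k) = (\<lambda>\<xi>. case rudin_shapiro y n k \<xi> of (P, Q) \<Rightarrow>
     (P + y k * (\<xi> powi (- int (n k)) * Q), Q - cnj (y k) * (\<xi> powi int (n k) * P)))"

abbreviation "rsP y n k \<xi> \<equiv> fst (rudin_shapiro y n k \<xi>)"
abbreviation "rsQ y n k \<xi> \<equiv> snd (rudin_shapiro y n k \<xi>)"

lemma rs_Suc:
  "rsP y n (Suc k) \<xi> = rsP y n k \<xi> + y k * (\<xi> powi (- int (n k)) * rsQ y n k \<xi>)"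
  "rsQ y n (Suc k) \<xi> = rsQ y n k \<xi> - cnj (y k) * (\<xi> powi int (n k) * rsP y n k \<xi>)"
  by (auto split: prod.splits)

text \<open>The matrix with rows \<open>(1, a)\<close> and \<open>(- cnj a, 1)\<close> is unitary up
  to the factor \<open>sqrt (1 + norm a ^ 2)\<close>.\<close>

lemma parallelogram_rotation:
  "norm (P + a * Q) ^ 2 + norm (Q - cnj a * P) ^ 2 = (1 + norm a ^ 2) * (norm P ^ 2 + norm Q ^ 2)"
  unfolding cmod_power2 by (simp add: power2_eq_square algebra_simps)

lemma rs_norm:
  assumes "norm \<xi> = 1"
  shows "norm (rsP y n k \<xi>) ^ 2 + norm (rsQ y n k \<xi>) ^ 2 = (\<Prod>i<k. 1 + norm (y i) ^ 2)"
proof (induction k)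
  case (Suc k)
  let ?a = "y k * \<xi> powi (- int (n k))"
  have eq: "cnj ?a = cnj (y k) * \<xi> powi int (n k)"
    using cnj_powi_unit[OF assms, of "- int (n k)"] by simp
  have "norm ?a = norm (y k)" using assms by (simp add: norm_mult norm_power_int)
  then show ?case
    using parallelogram_rotation[of "rsP y n k \<xi>" ?a "rsQ y n k \<xi>"] Suc.IH
    unfolding rs_Suc mult.assoc[symmetric] eq prod.lessThan_Suc by (simp add: mult.commute)
qed simp

text \<open>Splits a pairing with the test polynomial into blocks, the \<open>i\<close>-th
  consisting of frequency \<open>- n i\<close> and of the perturbation caused by
  \<open>rsQ y n i - 1\<close>.\<close>

lemma rsP_sum: "rsP y n k \<xi> = (\<Sum>i<k. y i * (\<xi> powi (- int (n i)) * rsQ y n i \<xi>))"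
  by (induction k) (simp_all add: rs_Suc del: rudin_shapiro.simps(2))

text \<open>The default 0 fits the initial pair, where \<open>rsQ\<close> is the constant 1 and the
  interval \<open>{1..prev n 0}\<close> is empty.\<close>

definition prev :: "(nat \<Rightarrow> nat) \<Rightarrow> nat \<Rightarrow> nat" where
  "prev n k = (case k of 0 \<Rightarrow> 0 | Suc i \<Rightarrow> n i)"

text \<open>As \<open>prev n k < n k\<close>, the shift by \<open>- n k\<close> carries
  \<open>{1..prev n k}\<close> into negative frequencies, and the shift by \<open>n k\<close>
  carries \<open>{- prev n k..-1}\<close> into positive ones. So signs never mix, and the constant
  term of \<open>rsQ\<close> stays 1.\<close>

lemma rs_spectrum:
  assumes n: "\<And>k. prev n k < n k" and y: "\<And>k. norm (y k) \<le> 1"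
  shows "\<exists>A B. 0 \<le> A \<and> 0 \<le> B \<and> A + B + 1 \<le> 2 ^ k \<and>
    trig {- int (prev n k)..-1} A (rsP y n k) \<and> trig {1..int (prev n k)} B (\<lambda>\<xi>. rsQ y n k \<xi> - 1)"
proof (induction k)
  case 0
  show ?case by (intro exI[of _ 0]) (auto intro: trig_zero)
next
  case (Suc k)
  then obtain A B where AB: "0 \<le> A" "0 \<le> B" "A + B + 1 \<le> 2 ^ k"
    "trig {- int (prev n k)..-1} A (rsP y n k)" "trig {1..int (prev n k)} B (\<lambda>\<xi>. rsQ y n k \<xi> - 1)" by blast
  have pS: "prev n (Suc k) = n k" by (simp add: prev_def)
  have nk: "n k \<ge> 1" "int (prev n k) < int (n k)" using n[of k] by auto
  let ?S = "{- int (n k)..-1}" and ?S' = "{1..int (n k)}"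
  have le: "norm (y k) * x \<le> x" if "x \<ge> 0" for x using y[of k] that by (intro mult_left_le_one_le) auto
  have P1: "trig ?S A (rsP y n k)" by (rule trig_mono[OF AB(4)]) (use nk in auto)
  have P2: "trig ?S 1 (\<lambda>\<xi>. y k * \<xi> powi (- int (n k)))" by (rule trig_monom) (use nk y in auto)
  have P3: "trig ?S B (\<lambda>\<xi>. y k * (\<xi> powi (- int (n k)) * (rsQ y n k \<xi> - 1)))"
    by (rule trig_mono[OF trig_cmult[OF trig_shift[OF AB(5)]]]) (use nk le AB in auto)
  have P: "trig ?S (A + (1 + B)) (rsP y n (Suc k))"
    by (rule trig_cong[OF trig_add[OF P1 trig_add[OF P2 P3]]]) (simp add: rs_Suc algebra_simps del: rudin_shapiro.simps)
  have Q1: "trig ?S' B (\<lambda>\<xi>. rsQ y n k \<xi> - 1)" by (rule trig_mono[OF AB(5)]) (use nk in auto)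
  have Q2: "trig ?S' A (\<lambda>\<xi>. - cnj (y k) * (\<xi> powi int (n k) * rsP y n k \<xi>))"
    by (rule trig_mono[OF trig_cmult[OF trig_shift[OF AB(4)]]]) (use nk le AB in auto)
  have Q: "trig ?S' (B + A) (\<lambda>\<xi>. rsQ y n (Suc k) \<xi> - 1)"
    by (rule trig_cong[OF trig_add[OF Q1 Q2]]) (simp add: rs_Suc algebra_simps del: rudin_shapiro.simps)
  \<comment> \<open>The left side is \<open>2 * (A + B + 1)\<close>: the total of the coefficient
    sums, the constant 1 included, at most doubles in each step.\<close>
  have "(A + (1 + B)) + (B + A) + 1 \<le> 2 ^ Suc k" using AB by simp
  then show ?case unfolding pS using P Q AB by (intro exI[of _ "A + (1 + B)"] exI[of _ "B + A"]) auto
qed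

lemma rsQ_continuous:
  assumes "\<And>k. prev n k < n k" "\<And>k. norm (y k) \<le> 1"
  shows "continuous_on (sphere 0 1) (rsQ y n k)" "continuous_on (sphere 0 1) (rsP y n k)"
proof -
  obtain A B where AB: "trig {- int (prev n k)..-1} A (rsP y n k)" "trig {1..int (prev n k)} B (\<lambda>\<xi>. rsQ y n k \<xi> - 1)"
    using rs_spectrum[where y=y and n=n and k=k] assms by blast
  show "continuous_on (sphere 0 1) (rsP y n k)" by (rule trig_continuous[OF AB(1)])
  have "continuous_on (sphere 0 1) (\<lambda>\<xi>. (rsQ y n k \<xi> - 1) + 1)"
    by (intro continuous_on_add trig_continuous[OF AB(2)] continuous_on_const)
  then show "continuous_on (sphere 0 1) (rsQ y n k)" by simp
qed

text \<open>The product in \<open>rs_norm\<close> is at most the exponential of the sum of squares,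
  so the bound is \<open>exp 1 \<le> 4\<close> for the square of the modulus.\<close>

lemma rsP_norm_le_2:
  assumes "norm \<xi> = 1" "(\<Sum>i<k. norm (y i) ^ 2) \<le> 1"
  shows "norm (rsP y n k \<xi>) \<le> 2"
proof -
  have "norm (rsP y n k \<xi>) ^ 2 \<le> (\<Prod>i<k. 1 + norm (y i) ^ 2)"
    using rs_norm[OF assms(1), of y n k] by (metis le_add_same_cancel1 zero_le_power2)
  also have "\<dots> \<le> (\<Prod>i<k. exp (norm (y i) ^ 2))"
    by (intro prod_mono) (auto intro: exp_ge_add_one_self add_nonneg_nonneg)
  also have "\<dots> = exp (\<Sum>i<k. norm (y i) ^ 2)" by (simp add: exp_sum)
  also have "\<dots> \<le> exp 1" using assms by simp
  also have "\<dots> \<le> 2 ^ 2" using exp_le by simp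
  finally show ?thesis by (rule power2_le_imp_le) simp
qed

lemma powr_2_eq: "(0::real) \<le> u \<Longrightarrow> u powr 2 = u ^ 2"
  by (cases "u = 0") (auto simp: powr_numeral)

lemma lp_2_norm_eq: "(\<Sum>k<n. norm (x k) powr 2) powr (1/2) = sqrt (\<Sum>k<n. norm (x k :: complex) ^ 2)"
  by (simp add: powr_2_eq powr_half_sqrt sum_nonneg)

section \<open>The copy of the square-summable sequences\<close>

context hardy_volterra
begin

text \<open>If \<open>g\<close> vanishes at 0 to order \<open>k0\<close>, the image of the
  \<open>N\<close>-th monomial starts at frequency \<open>N + k0\<close> instead of
  \<open>N\<close>; the test polynomials must be centred there.\<close>

lemma first_coef:
  obtains k0 where "coef g k0 \<noteq> 0" "\<And>i. i < k0 \<Longrightarrow> coef g i = 0"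
proof -
  have "\<exists>i. coef g i \<noteq> 0"
  proof (rule ccontr)
    assume "\<nexists>i. coef g i \<noteq> 0"
    then have "(deriv ^^ i) g 0 = 0" for i by (simp add: coef_def)
    then have "g z0 = 0" using z0 by (intro holomorphic_fun_eq_0_on_ball[OF g]) auto
    then show False using z0 by simp
  qed
  then have "coef g (LEAST i. coef g i \<noteq> 0) \<noteq> 0" by (rule LeastI_ex)
  moreover have "coef g i = 0" if "i < (LEAST i. coef g i \<noteq> 0)" for i using not_less_Least[OF that] by simp
  ultimately show thesis by (rule that)
qed

lemma coef_bounded:
  assumes B: "\<And>z. norm z < 1 \<Longrightarrow> norm (g z) \<le> B"
  shows "norm (coef g j) \<le> B"
proof -
  have le: "norm (coef g j) * r ^ j \<le> B" if r: "0 < r" "r < 1" for r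
  proof -
    have cg: "continuous_on (sphere 0 1) (\<lambda>\<xi>. g (of_real r * \<xi>))"
      using r by (intro continuous_on_slice holomorphic_on_imp_continuous_on g) auto
    have "norm (coef g j) * r ^ j = norm (LINT \<xi>|circle_measure. g (of_real r * \<xi>) * \<xi> powi (- int j))"
      using r by (simp add: fourier_coef[OF g r] norm_mult norm_power)
    also have "\<dots> \<le> (LINT \<xi>|circle_measure. norm (g (of_real r * \<xi>) * \<xi> powi (- int j)))"
      by (rule integral_norm_bound)
    also have "\<dots> \<le> (LINT \<xi>|circle_measure. B)"
    proof (rule integral_mono)
      show "integrable circle_measure (\<lambda>\<xi>. norm (g (of_real r * \<xi>) * \<xi> powi (- int j)))"
        by (intro continuous_circle_integrable continuous_intros cg) auto
      show "norm (g (of_real r * \<xi>) * \<xi> powi (- int j)) \<le> B" if "\<xi> \<in> space circle_measure" for \<xi>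
        using that B[of "of_real r * \<xi>"] r by (simp add: norm_mult norm_power_int)
    qed simp
    finally show ?thesis by simp
  qed
  have "((\<lambda>r. norm (coef g j) * r ^ j) \<longlongrightarrow> norm (coef g j) * 1 ^ j) (at_left (1::real))"
    by (intro tendsto_intros)
  moreover have "eventually (\<lambda>r. r \<in> {0<..<1}) (at_left (1::real))" by (rule eventually_at_leftI[of 0]) auto
  then have "eventually (\<lambda>r. norm (coef g j) * r ^ j \<le> B) (at_left 1)"
    by eventually_elim (use le in auto)
  ultimately have "norm (coef g j) * 1 ^ j \<le> B" by (rule tendsto_upperbound) simp
  then show ?thesis by simp
qed

text \<open>The images are paired with the Rudin--Shapiro polynomial whose coefficients at the leading
  frequencies \<open>N k + k0\<close> are dual to \<open>x\<close>. Its further frequencies in the \<open>k\<close>-th block lie below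
  \<open>N k + k0\<close>, where the images with index at least \<open>k\<close> have no coefficients and the earlier ones
  are small because of the gap condition.\<close>

lemma paley_lower:
  fixes N :: "nat \<Rightarrow> nat" and x :: "nat \<Rightarrow> complex"
  assumes B: "\<And>j. norm (coef g j) \<le> B" and b: "coef g k0 \<noteq> 0" "\<And>i. i < k0 \<Longrightarrow> coef g i = 0"
    and \<beta>: "\<beta> = norm (coef g k0) / (1 + real k0)"
    and N: "\<And>k. N k \<ge> 1" "\<And>k. N k < N (Suc k)"
    and gap: "\<And>i. real (Suc i) * 2 ^ Suc i * (B * (real (N i) / (real (N (Suc i)) - real (N i)))) \<le> \<beta> * (1/2) ^ (i + 3)"
  shows "\<beta> / 4 * sqrt (\<Sum>k<K. norm (x k) ^ 2) \<le> hardy_norm p (psum (\<lambda>k. volterra_op g (disk_monom (N k))) x K)"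
proof -
  let ?F = "\<lambda>k. volterra_op g (disk_monom (N k))"
  define G where "G = psum ?F x K"
  define X where "X = sqrt (\<Sum>k<K. norm (x k) ^ 2)"
  define n where "n k = N k + k0" for k
  have B0: "B \<ge> 0" using order_trans[OF norm_ge_zero B[of 0]] .
  have \<beta>0: "\<beta> > 0" using b \<beta> by simp
  have F: "?F k \<in> hardy_space p" for k by (rule bounded_op_in[OF T disk_monom_hardy[OF p]])
  have G: "G \<in> hardy_space p" unfolding G_def by (intro psum_hardy p F)
  have X0: "X \<ge> 0" by (simp add: X_def sum_nonneg)
  have X2: "X ^ 2 = (\<Sum>k<K. norm (x k) ^ 2)" by (simp add: X_def sum_nonneg)
  have xX: "norm (x k) \<le> X" if "k < K" for k
  proof -
    have "norm (x k) ^ 2 \<le> X ^ 2" unfolding X2 using that by (intro member_le_sum) auto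
    then show ?thesis using X0 by (rule power2_le_imp_le)
  qed
  show ?thesis
  proof (cases "X = 0")
    case True
    then show ?thesis by (simp add: X_def[symmetric])
  next
    case False
    then have Xpos: "X > 0" using X0 by simp
    have mono: "N i < N j" if "i < j" for i j by (rule lift_Suc_mono_less[of N, OF N(2) that])
    have prev_n: "prev n k < n k" for k using N(1)[of 0] N(2) by (auto simp: prev_def n_def split: nat.splits)
    \<comment> \<open>Conjugate phases make every \<open>y k * x k * coef g k0\<close> nonnegative,
      so the main terms add without cancellation; division by \<open>X\<close> gives
      \<open>y\<close> the \<open>\<ell>\<^sup>2\<close> norm one that \<open>rsP_norm_le_2\<close>
      needs.\<close>
    define y where "y k = (if k < K then cnj (x k * coef g k0) / of_real (norm (coef g k0) * X) else 0)" for k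
    have ynorm: "norm (y k) = (if k < K then norm (x k) / X else 0)" for k
      using b Xpos by (simp add: y_def norm_divide norm_mult)
    have y1: "norm (y k) \<le> 1" for k using xX[of k] Xpos by (simp add: ynorm)
    have ysum: "(\<Sum>i<K. norm (y i) ^ 2) = 1"
    proof -
      have "(\<Sum>i<K. norm (y i) ^ 2) = (\<Sum>i<K. norm (x i) ^ 2) / X ^ 2"
        by (simp add: ynorm power_divide sum_divide_distrib)
      then show ?thesis using Xpos by (simp add: X2[symmetric])
    qed
    let ?Q = "rsQ y n" and ?P = "rsP y n K"
    define c where "c k = of_nat (N k) / of_nat (n k) * coef g k0" for k
    have coefF: "coef (?F k) j = (if j < n k then 0 else of_nat (N k) / of_nat j * coef g (j - N k))" for k j
      using volterra_monom_coef[OF g N(1)[of k], of j] b(2)[of "j - N k"] by (auto simp: n_def)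
    have main: "norm ((LINT \<xi>|circle_measure. G (of_real r * \<xi>) * (\<xi> powi (- int (n k)) * ?Q k \<xi>)) - x k * c k * of_real r ^ n k)
        \<le> X * (\<beta> / 2) * (1/2) ^ Suc k" if r: "0 < r" "r < 1" and k: "k < K" for r k
    proof -
      \<comment> \<open>Each of the \<open>k\<close> earlier images contributes at most
        \<open>X * B\<close> times the factor of \<open>volterra_monom_coef\<close> in the
        \<open>k\<close>-th block; the index just before \<open>k\<close> gives the worst case. For
        \<open>k = 0\<close> nothing precedes.\<close>
      define \<tau> where "\<tau> = (case k of 0 \<Rightarrow> 0 | Suc i \<Rightarrow> real k * X * (B * (real (N i) / (real (N k) - real (N i)))))"
      have \<tau>0: "\<tau> \<ge> 0"
      proof (cases k)
        case (Suc i)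
        have "0 \<le> real k * X * (B * (real (N i) / (real (N k) - real (N i))))"
          using X0 B0 N(2)[of i] Suc by (intro mult_nonneg_nonneg divide_nonneg_nonneg) auto
        then show ?thesis by (simp add: \<tau>_def Suc)
      qed (simp add: \<tau>_def)
      \<comment> \<open>The slice of \<open>G\<close> without its main term at frequency
        \<open>n k\<close>.\<close>
      define E where "E = (\<lambda>\<xi>. G (of_real r * \<xi>) - x k * c k * of_real r ^ n k * \<xi> powi int (n k))"
      have Gc: "continuous_on (sphere 0 1) (\<lambda>\<xi>. G (of_real r * \<xi>))"
        using r by (intro continuous_on_slice hardy_space_continuous[OF G]) auto
      have Ec: "continuous_on (sphere 0 1) E"
        unfolding E_def by (intro continuous_intros Gc) auto
      have Gfour: "(LINT \<xi>|circle_measure. G (of_real r * \<xi>) * \<xi> powi (- int j)) = (\<Sum>m<K. x m * coef (?F m) j) * of_real r ^ j" for j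
      proof -
        have Fc: "continuous_on (sphere 0 1) (\<lambda>\<xi>. ?F m (of_real r * \<xi>))" for m
          using r by (intro continuous_on_slice hardy_space_continuous[OF F]) auto
        have "(LINT \<xi>|circle_measure. G (of_real r * \<xi>) * \<xi> powi (- int j)) = (LINT \<xi>|circle_measure. (\<Sum>m<K. x m * (?F m (of_real r * \<xi>) * \<xi> powi (- int j))))"
          by (simp add: G_def psum_apply sum_distrib_right mult.assoc)
        also have "\<dots> = (\<Sum>m<K. LINT \<xi>|circle_measure. x m * (?F m (of_real r * \<xi>) * \<xi> powi (- int j)))"
          by (intro Bochner_Integration.integral_sum continuous_circle_integrable continuous_intros Fc) auto
        also have "\<dots> = (\<Sum>m<K. x m * (coef (?F m) j * of_real r ^ j))"
          unfolding integral_mult_right_zero fourier_coef[OF hardy_spaceD(1)[OF F] r] ..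
        finally show ?thesis by (simp add: sum_distrib_right mult.assoc)
      qed
      \<comment> \<open>These \<open>j\<close> are the negated frequencies of
        \<open>\<xi> powi (- int (n k)) * ?Q k \<xi>\<close>.\<close>
      have Efour: "norm (LINT \<xi>|circle_measure. E \<xi> * \<xi> powi (- int j)) \<le> \<tau>" if j: "n k - prev n k \<le> j" "j \<le> n k" for j
      proof -
        have "(LINT \<xi>|circle_measure. E \<xi> * \<xi> powi (- int j)) =
            (LINT \<xi>|circle_measure. G (of_real r * \<xi>) * \<xi> powi (- int j) - x k * c k * of_real r ^ n k * \<xi> powi (int (n k) - int j))"
        proof (intro Bochner_Integration.integral_cong refl)
          fix \<xi> assume "\<xi> \<in> space circle_measure"
          then have "\<xi> \<noteq> 0" by auto
          then have "\<xi> powi int (n k) * \<xi> powi (- int j) = \<xi> powi (int (n k) - int j)" by (simp only: power_int_add[symmetric] diff_conv_add_uminus simp_thms)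
          then show "E \<xi> * \<xi> powi (- int j) = G (of_real r * \<xi>) * \<xi> powi (- int j) - x k * c k * of_real r ^ n k * \<xi> powi (int (n k) - int j)"
            unfolding E_def left_diff_distrib mult.assoc by simp
        qed
        also have "\<dots> = (LINT \<xi>|circle_measure. G (of_real r * \<xi>) * \<xi> powi (- int j)) - (LINT \<xi>|circle_measure. x k * c k * of_real r ^ n k * \<xi> powi (int (n k) - int j))"
          by (intro Bochner_Integration.integral_diff continuous_circle_integrable continuous_intros Gc) auto
        also have "\<dots> = (\<Sum>m<K. x m * coef (?F m) j) * of_real r ^ j - (if j = n k then x k * c k * of_real r ^ n k else 0)"
          unfolding integral_mult_right_zero Gfour circle_integral_powi by simp
        also have "\<dots> = (\<Sum>m<k. x m * coef (?F m) j) * of_real r ^ j"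
        proof -
          \<comment> \<open>The range \<open>j \<le> n k\<close> lies below the first frequencies of
            all later images. The image with index \<open>k\<close> itself meets it only at
            \<open>j = n k\<close>, and that term has been subtracted.\<close>
          have zero: "coef (?F m) j = 0" if "k < m" for m
            using j mono[OF that] by (simp add: coefF n_def)
          have "(\<Sum>m<K. x m * coef (?F m) j) = (\<Sum>m<Suc k. x m * coef (?F m) j)"
            using k zero by (intro sum.mono_neutral_right) auto
          moreover have "coef (?F k) j = (if j = n k then c k else 0)"
            using j by (simp add: coefF c_def n_def)
          ultimately show ?thesis by (simp add: algebra_simps)
        qed
        also have "norm \<dots> \<le> norm (\<Sum>m<k. x m * coef (?F m) j) * 1"
          unfolding norm_mult norm_power using r by (intro mult_left_mono) (auto simp: power_le_one)
        also have "\<dots> \<le> \<tau>"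
        proof (cases k)
          case 0 then show ?thesis by (simp add: \<tau>_def)
        next
          case (Suc i)
          \<comment> \<open>The shift \<open>k0\<close> cancels:
            \<open>j \<ge> n k - n i = N k - N i\<close>.\<close>
          have ji: "real (N k) - real (N i) \<le> real j" "0 < real (N k) - real (N i)" "j > 0"
            using j N(2)[of i] Suc by (auto simp: prev_def n_def)
          have "norm (x m * coef (?F m) j) \<le> X * (B * (real (N i) / (real (N k) - real (N i))))" if m: "m < k" for m
          proof -
            have mi: "N m \<le> N i" using mono[of m i] m Suc by (cases "m = i") auto
            have "norm (coef (?F m) j) \<le> real (N m) / real j * B"
              using B B0 by (auto simp: coefF norm_mult norm_divide intro!: mult_left_mono divide_right_mono)
            also have "\<dots> \<le> real (N i) / (real (N k) - real (N i)) * B"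
              using mi ji B0 by (intro mult_right_mono frac_le) auto
            finally show ?thesis unfolding norm_mult using xX[of m] m k X0 by (intro mult_mono) (auto simp: mult.commute)
          qed
          then have "(\<Sum>m<k. norm (x m * coef (?F m) j)) \<le> of_nat (card {..<k}) * (X * (B * (real (N i) / (real (N k) - real (N i)))))"
            by (intro sum_bounded_above) auto
          then show ?thesis using norm_sum[of "\<lambda>m. x m * coef (?F m) j" "{..<k}"] Suc by (simp add: \<tau>_def mult.assoc)
        qed
        finally show ?thesis .
      qed
      obtain A C where AC: "0 \<le> A" "0 \<le> C" "A + C + 1 \<le> 2 ^ k" "trig {1..int (prev n k)} C (\<lambda>\<xi>. ?Q k \<xi> - 1)"
        using rs_spectrum[where y=y and n=n and k=k, OF prev_n y1] by blast
      let ?R = "{- int (n k)..int (prev n k) - int (n k)}"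
      have t1: "trig ?R 1 (\<lambda>\<xi>. 1 * \<xi> powi (- int (n k)))" by (rule trig_monom) auto
      have t2: "trig ?R C (\<lambda>\<xi>. \<xi> powi (- int (n k)) * (?Q k \<xi> - 1))"
        by (rule trig_mono[OF trig_shift[OF AC(4)]]) auto
      have t: "trig ?R (1 + C) (\<lambda>\<xi>. \<xi> powi (- int (n k)) * ?Q k \<xi>)"
        by (rule trig_cong[OF trig_add[OF t1 t2]]) (simp add: algebra_simps)
      have "norm (LINT \<xi>|circle_measure. E \<xi> * (\<xi> powi (- int (n k)) * ?Q k \<xi>)) \<le> (1 + C) * \<tau>"
      proof (rule trig_pairing[OF t Ec _ \<tau>0])
        fix i assume i: "i \<in> ?R"
        then have "i \<le> 0" using prev_n[of k] by auto
        then obtain j where j: "i = - int j" by (metis nonpos_int_cases)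
        show "norm (LINT \<xi>|circle_measure. E \<xi> * \<xi> powi i) \<le> \<tau>"
          unfolding j using i j by (intro Efour) auto
      qed
      also have "\<dots> \<le> 2 ^ k * \<tau>" using AC \<tau>0 by (intro mult_right_mono) auto
      \<comment> \<open>The coefficient sum \<open>2 ^ k\<close> of the block is paid for by the gap
        condition, whose \<open>(1/2) ^ (i + 3)\<close> is half of \<open>(1/2) ^ Suc k\<close> for
        \<open>k = Suc i\<close>.\<close>
      also have "\<dots> \<le> X * (\<beta> / 2) * (1/2) ^ Suc k"
      proof (cases k)
        case 0 then show ?thesis using X0 \<beta>0 by (simp add: \<tau>_def)
      next
        case (Suc i)
        have "2 ^ k * \<tau> = X * (real (Suc i) * 2 ^ Suc i * (B * (real (N i) / (real (N (Suc i)) - real (N i)))))"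
          by (simp add: \<tau>_def Suc)
        also have "\<dots> \<le> X * (\<beta> * (1/2) ^ (i + 3))" using X0 by (intro mult_left_mono gap)
        also have "\<dots> = X * (\<beta> / 2) * (1/2) ^ Suc k" by (simp add: Suc power_add power3_eq_cube)
        finally show ?thesis .
      qed
      finally have fin: "norm (LINT \<xi>|circle_measure. E \<xi> * (\<xi> powi (- int (n k)) * ?Q k \<xi>)) \<le> X * (\<beta> / 2) * (1/2) ^ Suc k" .
      \<comment> \<open>\<open>?Q k - 1\<close> has positive frequencies only, so the main term
        passes through the pairing unchanged.\<close>
      have Qint: "(LINT \<xi>|circle_measure. ?Q k \<xi>) = 1"
      proof -
        have "norm (LINT \<xi>|circle_measure. 1 * (?Q k \<xi> - 1)) \<le> C * 0"
          by (rule trig_pairing[OF AC(4)]) (auto simp: circle_integral_powi)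
        then have "(LINT \<xi>|circle_measure. ?Q k \<xi> - 1) = 0" by simp
        then show ?thesis
          by (subst (asm) Bochner_Integration.integral_diff)
             (auto intro!: continuous_circle_integrable rsQ_continuous prev_n y1)
      qed
      have "(LINT \<xi>|circle_measure. E \<xi> * (\<xi> powi (- int (n k)) * ?Q k \<xi>)) =
          (LINT \<xi>|circle_measure. G (of_real r * \<xi>) * (\<xi> powi (- int (n k)) * ?Q k \<xi>) - x k * c k * of_real r ^ n k * ?Q k \<xi>)"
      proof (intro Bochner_Integration.integral_cong refl)
        fix \<xi> assume "\<xi> \<in> space circle_measure"
        then have "\<xi> \<noteq> 0" by auto
        then have "\<xi> powi int (n k) * \<xi> powi (- int (n k)) = 1" by (simp only: power_int_add[symmetric] simp_thms) simp
        then have "\<xi> powi int (n k) * (\<xi> powi (- int (n k)) * ?Q k \<xi>) = ?Q k \<xi>" by (simp only: mult.assoc[symmetric] mult_1_left)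
        then show "E \<xi> * (\<xi> powi (- int (n k)) * ?Q k \<xi>) = G (of_real r * \<xi>) * (\<xi> powi (- int (n k)) * ?Q k \<xi>) - x k * c k * of_real r ^ n k * ?Q k \<xi>"
          unfolding E_def left_diff_distrib mult.assoc by simp
      qed
      also have "\<dots> = (LINT \<xi>|circle_measure. G (of_real r * \<xi>) * (\<xi> powi (- int (n k)) * ?Q k \<xi>)) - (LINT \<xi>|circle_measure. x k * c k * of_real r ^ n k * ?Q k \<xi>)"
        by (intro Bochner_Integration.integral_diff continuous_circle_integrable continuous_intros Gc rsQ_continuous prev_n y1) auto
      finally show ?thesis using fin unfolding integral_mult_right_zero Qint by simp
    qed
    \<comment> \<open>One exponent above all \<open>n k\<close> with \<open>k < K\<close>, so that
      \<open>r ^ L\<close> bounds all damping factors from below and tends to 1 with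
      \<open>r\<close>.\<close>
    define L where "L = n K"
    \<comment> \<open>The 2 is the bound for the test polynomial, and \<open>\<beta> / 2\<close>
      collects the block errors, summed with the weights \<open>(1/2) ^ Suc k\<close>.\<close>
    have ineq: "\<beta> * r ^ L * X \<le> 2 * hardy_norm p G + \<beta> / 2 * X" if r: "0 < r" "r < 1" for r
    proof -
      let ?Z = "\<lambda>k. LINT \<xi>|circle_measure. G (of_real r * \<xi>) * (\<xi> powi (- int (n k)) * ?Q k \<xi>)"
      let ?D = "\<lambda>k. x k * c k * of_real r ^ n k"
      have Gc: "continuous_on (sphere 0 1) (\<lambda>\<xi>. G (of_real r * \<xi>))"
        using r by (intro continuous_on_slice hardy_space_continuous[OF G]) auto
      have sumP: "(LINT \<xi>|circle_measure. G (of_real r * \<xi>) * ?P \<xi>) = (\<Sum>k<K. y k * ?Z k)"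
      proof -
        have "(LINT \<xi>|circle_measure. G (of_real r * \<xi>) * ?P \<xi>) = (LINT \<xi>|circle_measure. (\<Sum>k<K. y k * (G (of_real r * \<xi>) * (\<xi> powi (- int (n k)) * ?Q k \<xi>))))"
          unfolding rsP_sum by (simp only: sum_distrib_left mult.left_commute)
        also have "\<dots> = (\<Sum>k<K. LINT \<xi>|circle_measure. y k * (G (of_real r * \<xi>) * (\<xi> powi (- int (n k)) * ?Q k \<xi>)))"
          by (intro Bochner_Integration.integral_sum continuous_circle_integrable continuous_intros Gc rsQ_continuous prev_n y1) auto
        finally show ?thesis by simp
      qed
      have up: "norm (\<Sum>k<K. y k * ?Z k) \<le> 2 * hardy_norm p G"
      proof -
        have "norm (\<Sum>k<K. y k * ?Z k) \<le> (LINT \<xi>|circle_measure. norm (G (of_real r * \<xi>) * ?P \<xi>))"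
          unfolding sumP[symmetric] by (rule integral_norm_bound)
        also have "\<dots> \<le> (LINT \<xi>|circle_measure. 2 * norm (G (of_real r * \<xi>)))"
        proof (rule integral_mono)
          show "integrable circle_measure (\<lambda>\<xi>. norm (G (of_real r * \<xi>) * ?P \<xi>))"
            by (intro continuous_circle_integrable continuous_intros Gc rsQ_continuous prev_n y1)
          show "integrable circle_measure (\<lambda>\<xi>. 2 * norm (G (of_real r * \<xi>)))"
            by (intro continuous_circle_integrable continuous_intros Gc)
          show "norm (G (of_real r * \<xi>) * ?P \<xi>) \<le> 2 * norm (G (of_real r * \<xi>))" if "\<xi> \<in> space circle_measure" for \<xi>
            unfolding norm_mult using mult_left_mono[OF rsP_norm_le_2[where \<xi>=\<xi> and k=K and y=y and n=n], of "norm (G (of_real r * \<xi>))"] that ysum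
            by (simp add: mult.commute)
        qed
        also have "\<dots> = 2 * (LINT \<xi>|circle_measure. norm (G (of_real r * \<xi>)))" by simp
        also have "\<dots> \<le> 2 * hardy_norm p G"
          using slice_mean_le[OF hardy_space_continuous[OF G] p, of r] slice_norm_le[OF G p, of r] r by simp
        finally show ?thesis .
      qed
      have err: "norm ((\<Sum>k<K. y k * ?Z k) - (\<Sum>k<K. y k * ?D k)) \<le> \<beta> / 2 * X"
      proof -
        have "norm ((\<Sum>k<K. y k * ?Z k) - (\<Sum>k<K. y k * ?D k)) = norm (\<Sum>k<K. y k * (?Z k - ?D k))"
          by (simp only: sum_subtractf right_diff_distrib)
        also have "\<dots> \<le> (\<Sum>k<K. 1 * (X * (\<beta> / 2) * (1/2) ^ Suc k))"
        proof (intro order_trans[OF norm_sum] sum_mono)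
          fix k assume "k \<in> {..<K}"
          then show "norm (y k * (?Z k - ?D k)) \<le> 1 * (X * (\<beta> / 2) * (1/2) ^ Suc k)"
            unfolding norm_mult by (intro mult_mono y1 main r) auto
        qed
        also have "\<dots> = X * (\<beta> / 2) * (\<Sum>k<K. (1/2) ^ Suc k)" by (simp only: sum_distrib_left mult_1_left)
        also have "\<dots> \<le> X * (\<beta> / 2) * 1" using X0 \<beta>0 by (intro mult_left_mono sum_half_powers_le) auto
        finally show ?thesis by (simp add: mult.commute)
      qed
      have low: "\<beta> * r ^ L * X \<le> norm (\<Sum>k<K. y k * ?D k)"
      proof -
        have yD: "y k * ?D k = of_real (norm (x k) ^ 2 * norm (coef g k0) * (real (N k) / real (n k)) * r ^ n k / X)" if "k < K" for k
        proof -
          have cc: "cnj w * w = of_real (norm w ^ 2)" for w by (simp only: complex_norm_square mult.commute)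
          have "y k * ?D k = (cnj (x k) * x k) * (cnj (coef g k0) * coef g k0) * of_real (real (N k) / real (n k)) * of_real (r ^ n k) / of_real (norm (coef g k0) * X)"
            using that by (simp add: y_def c_def mult_ac)
          also have "\<dots> = of_real (norm (x k) ^ 2 * norm (coef g k0) ^ 2 * (real (N k) / real (n k)) * r ^ n k / (norm (coef g k0) * X))"
            unfolding cc by simp
          also have "norm (x k) ^ 2 * norm (coef g k0) ^ 2 * (real (N k) / real (n k)) * r ^ n k / (norm (coef g k0) * X) =
              norm (x k) ^ 2 * norm (coef g k0) * (real (N k) / real (n k)) * r ^ n k / X"
            using b by (simp add: power2_eq_square)
          finally show ?thesis .
        qed
        have "(\<Sum>k<K. norm (x k) ^ 2 * \<beta> * r ^ L / X) \<le> (\<Sum>k<K. norm (x k) ^ 2 * norm (coef g k0) * (real (N k) / real (n k)) * r ^ n k / X)"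
        proof (rule sum_mono)
          fix k assume k: "k \<in> {..<K}"
          have "1 / (1 + real k0) \<le> real (N k) / real (n k)"
          proof -
            have "real k0 * 1 \<le> real k0 * real (N k)" using N(1)[of k] by (intro mult_left_mono) auto
            then have "real (n k) \<le> real (N k) * (1 + real k0)" by (simp add: n_def algebra_simps)
            then show ?thesis using N(1)[of k] by (simp add: n_def divide_simps)
          qed
          then have "\<beta> \<le> norm (coef g k0) * (real (N k) / real (n k))"
            using mult_left_mono[of "1 / (1 + real k0)" "real (N k) / real (n k)" "norm (coef g k0)"] by (simp add: \<beta>)
          moreover have "r ^ L \<le> r ^ n k"
            using r k mono[of k K] by (intro power_decreasing) (auto simp: L_def n_def)
          ultimately have "norm (x k) ^ 2 * (\<beta> * r ^ L) / X \<le> norm (x k) ^ 2 * ((norm (coef g k0) * (real (N k) / real (n k))) * r ^ n k) / X"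
            using r \<beta>0 Xpos by (intro divide_right_mono mult_left_mono mult_mono) auto
          then show "norm (x k) ^ 2 * \<beta> * r ^ L / X \<le> norm (x k) ^ 2 * norm (coef g k0) * (real (N k) / real (n k)) * r ^ n k / X"
            by (simp only: mult.assoc)
        qed
        also have "(\<Sum>k<K. norm (x k) ^ 2 * \<beta> * r ^ L / X) = X ^ 2 * \<beta> * r ^ L / X"
          unfolding X2 by (simp only: sum_divide_distrib sum_distrib_right)
        also have "X ^ 2 * \<beta> * r ^ L / X = \<beta> * r ^ L * X" using Xpos by (simp add: power2_eq_square)
        finally have 1: "\<beta> * r ^ L * X \<le> (\<Sum>k<K. norm (x k) ^ 2 * norm (coef g k0) * (real (N k) / real (n k)) * r ^ n k / X)" .
        have "(\<Sum>k<K. y k * ?D k) = of_real (\<Sum>k<K. norm (x k) ^ 2 * norm (coef g k0) * (real (N k) / real (n k)) * r ^ n k / X)"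
          unfolding of_real_sum using yD by (intro sum.cong) auto
        then have "norm (\<Sum>k<K. y k * ?D k) = \<bar>\<Sum>k<K. norm (x k) ^ 2 * norm (coef g k0) * (real (N k) / real (n k)) * r ^ n k / X\<bar>"
          by (simp only: norm_of_real)
        then show ?thesis using 1 by linarith
      qed
      have "norm (\<Sum>k<K. y k * ?D k) \<le> norm (\<Sum>k<K. y k * ?Z k) + norm ((\<Sum>k<K. y k * ?Z k) - (\<Sum>k<K. y k * ?D k))"
        using norm_triangle_sub[of "\<Sum>k<K. y k * ?D k" "\<Sum>k<K. y k * ?Z k"] by (simp only: norm_minus_commute)
      then show ?thesis using low up err by linarith
    qed
    have "((\<lambda>r. \<beta> * r ^ L * X) \<longlongrightarrow> \<beta> * 1 ^ L * X) (at_left (1::real))" by (intro tendsto_intros)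
    moreover have "eventually (\<lambda>r. r \<in> {0<..<1}) (at_left (1::real))" by (rule eventually_at_leftI[of 0]) auto
    then have "eventually (\<lambda>r. \<beta> * r ^ L * X \<le> 2 * hardy_norm p G + \<beta> / 2 * X) (at_left 1)"
      by eventually_elim (use ineq in auto)
    ultimately have "\<beta> * 1 ^ L * X \<le> 2 * hardy_norm p G + \<beta> / 2 * X" by (rule tendsto_upperbound) simp
    \<comment> \<open>The error takes half of the main term and the bound 2 halves the rest.\<close>
    then have "\<beta> / 4 * X \<le> hardy_norm p G" by simp
    then show ?thesis by (simp only: X_def G_def)
  qed
qed

lemma lacunary_upper:
  fixes N :: "nat \<Rightarrow> nat" and m :: nat
  assumes N: "\<And>k. m * N k < N (Suc k)" "N 0 > 0" "m > 0" and m: "p \<le> 2 * real m"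
  shows "hardy_norm p (psum (\<lambda>k. disk_monom (N k)) x n) \<le> (1 + fact m) * sqrt (\<Sum>k<n. norm (x k) ^ 2)"
proof -
  let ?f = "psum (\<lambda>k. disk_monom (N k)) x n" and ?A = "\<Sum>k<n. norm (x k) ^ 2"
  have f: "?f \<in> hardy_space p" by (intro psum_hardy disk_monom_hardy p)
  show ?thesis
  proof (rule hardy_spaceI(2)[OF hardy_spaceD[OF f] p])
    fix r :: real assume r: "0 \<le> r" "r < 1"
    have "hardy_mean p ?f r = (LINT \<xi>|circle_measure. norm (\<Sum>k<n. (x k * of_real r ^ N k) * \<xi> ^ N k) powr p)"
      unfolding hardy_mean_def
      by (intro Bochner_Integration.integral_cong refl) (use r in \<open>simp add: psum_apply disk_monom_def norm_mult power_mult_distrib mult.assoc\<close>)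
    also have "\<dots> \<le> (1 + fact m) * (\<Sum>k<n. norm (x k * of_real r ^ N k) ^ 2) powr (p/2)"
      by (rule lacunary_powr_mean[OF N p m])
    also have "\<dots> \<le> (1 + fact m) * ?A powr (p/2)"
    proof (intro mult_left_mono powr_mono2 sum_mono power_mono)
      show "norm (x k * of_real r ^ N k) \<le> norm (x k)" for k
        using r by (simp add: norm_mult norm_power mult_left_le power_le_one)
    qed (use p in \<open>auto intro: sum_nonneg\<close>)
    finally have "hardy_mean p ?f r powr (1/p) \<le> ((1 + fact m) * ?A powr (p/2)) powr (1/p)"
      using p by (intro powr_mono2) auto
    also have "\<dots> = (1 + fact m) powr (1/p) * sqrt ?A"
      using p by (simp add: powr_mult powr_powr powr_half_sqrt sum_nonneg)
    also have "\<dots> \<le> (1 + fact m) * sqrt ?A"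
    proof (rule mult_right_mono)
      have "(1 + fact m) powr (1/p) \<le> (1 + fact m) powr (1::real)" using p by (intro powr_mono) auto
      then show "(1 + fact m) powr (1/p) \<le> (1 + fact m :: real)" by simp
    qed (auto intro: sum_nonneg)
    finally show "slice_norm p ?f r \<le> (1 + fact m) * sqrt ?A" by (simp add: slice_norm_eq)
  qed
qed

lemma lp_embedding_lacunary: "\<exists>f C c. lp_embedding (hardy_space p) (hardy_norm p) (volterra_op g) f 2 C c"
proof -
  let ?T = "volterra_op g"
  obtain k0 where b: "coef g k0 \<noteq> 0" "\<And>i. i < k0 \<Longrightarrow> coef g i = 0" using first_coef by blast
  obtain B where B: "B \<ge> 1" "\<And>z. norm z < 1 \<Longrightarrow> norm (g z) \<le> B" using g_bounded by blast
  note cB = coef_bounded[OF B(2)]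
  define \<beta> where "\<beta> = norm (coef g k0) / (1 + real k0)"
  have \<beta>: "\<beta> > 0" using b by (simp add: \<beta>_def)
  \<comment> \<open>Any \<open>m\<close> with \<open>2 * m \<ge> p\<close> would do for the even
    moment.\<close>
  define m where "m = nat \<lceil>p\<rceil>"
  have m: "m > 0" "p \<le> 2 * real m" using p unfolding m_def by linarith+
  \<comment> \<open>The ratio of consecutive exponents. The summand \<open>m\<close> separates the
    binomial blocks. In the last one, \<open>Suc k\<close> counts the earlier images, and
    \<open>4 ^ (k + 2) = 2 ^ Suc k * 2 ^ (k + 3)\<close> pays for the coefficient sum of the block
    and for its share of the error.\<close>
  define L where "L k = m + 2 + nat \<lceil>real (Suc k) * 4 ^ (k + 2) * B / \<beta>\<rceil>" for k
  define N where "N k = (\<Prod>i<k. L i)" for k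
  have N0: "N 0 = 1" and NS: "N (Suc k) = N k * L k" for k by (auto simp: N_def)
  have N1: "N k \<ge> 1" for k
  proof -
    have "N k > 0" unfolding N_def by (rule prod_pos) (auto simp: L_def)
    then show ?thesis by simp
  qed
  have Nm: "m * N k < N (Suc k)" for k
  proof -
    have "m < L k" by (simp add: L_def)
    then show ?thesis using N1[of k] by (simp add: NS mult.commute)
  qed
  have Nlt: "N k < N (Suc k)" for k using N1[of k] unfolding NS by (simp add: L_def)
  have gap: "real (Suc i) * 2 ^ Suc i * (B * (real (N i) / (real (N (Suc i)) - real (N i)))) \<le> \<beta> * (1/2) ^ (i + 3)" for i
  proof -
    define Y where "Y = real (Suc i) * 4 ^ (i + 2) * B"
    have Y: "Y > 0" using B unfolding Y_def by simp
    have LY: "Y / \<beta> \<le> real (L i) - 1"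
      using real_nat_ceiling_ge[of "Y / \<beta>"] by (simp add: L_def Y_def)
    have "real (N (Suc i)) - real (N i) = real (N i) * (real (L i) - 1)"
      by (simp add: NS algebra_simps)
    then have "real (N i) / (real (N (Suc i)) - real (N i)) = 1 / (real (L i) - 1)"
      using N1[of i] by simp
    also have "\<dots> \<le> 1 / (Y / \<beta>)" using LY Y \<beta> by (intro frac_le) auto
    also have "\<dots> = \<beta> / Y" by simp
    finally have "B * (real (N i) / (real (N (Suc i)) - real (N i))) \<le> B * (\<beta> / Y)"
      using B(1) by (intro mult_left_mono) auto
    then have "real (Suc i) * 2 ^ Suc i * (B * (real (N i) / (real (N (Suc i)) - real (N i)))) \<le> real (Suc i) * 2 ^ Suc i * (B * (\<beta> / Y))"
      by (rule mult_left_mono) simp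
    also have "\<dots> = \<beta> * (2 ^ Suc i / 4 ^ (i + 2))"
      using B unfolding Y_def by (simp add: divide_simps)
    also have "2 ^ Suc i / 4 ^ (i + 2) = (1/2 :: real) ^ (i + 3)"
    proof -
      have "(4::real) ^ (i + 2) = (2 ^ 2) ^ (i + 2)" by simp
      also have "\<dots> = 2 ^ (2 * (i + 2))" by (rule power_mult[symmetric])
      also have "2 * (i + 2) = Suc i + (i + 3)" by simp
      also have "(2::real) ^ (Suc i + (i + 3)) = 2 ^ Suc i * 2 ^ (i + 3)" by (rule power_add)
      finally have "(4::real) ^ (i + 2) = 2 ^ Suc i * 2 ^ (i + 3)" .
      then have "2 ^ Suc i / 4 ^ (i + 2) = 1 / (2::real) ^ (i + 3)" by (simp only: nonzero_divide_mult_cancel_left power_not_zero zero_neq_numeral[symmetric] not_False_eq_True)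
      then show ?thesis by (simp only: power_one_over)
    qed
    finally show ?thesis .
  qed
  let ?f = "\<lambda>k. disk_monom (N k)"
  interpret banach_fun_space "hardy_space p" "hardy_norm p" by (rule banach_hardy_space[OF p])
  have "lp_embedding (hardy_space p) (hardy_norm p) ?T ?f 2 (1 + fact m) (\<beta>/4)"
  proof
    show "bounded_op (hardy_space p) (hardy_norm p) (hardy_space p) (hardy_norm p) ?T" by (rule T)
    show "(1::real) \<le> 2" "0 < 1 + (fact m :: real)" "0 < \<beta>/4" using \<beta> by (auto intro: add_pos_pos)
    show f: "?f k \<in> hardy_space p" for k by (rule disk_monom_hardy[OF p])
    fix x :: "nat \<Rightarrow> complex" and n :: nat
    show "hardy_norm p (psum ?f x n) \<le> (1 + fact m) * (\<Sum>k<n. norm (x k) powr 2) powr (1/2)"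
      unfolding lp_2_norm_eq using N0 m by (intro lacunary_upper Nm) auto
    have "?T (psum ?f x n) = psum (\<lambda>k. ?T (?f k)) x n"
      unfolding psum_def by (rule bounded_op_sum[OF T sub f])
    then show "\<beta>/4 * (\<Sum>k<n. norm (x k) powr 2) powr (1/2) \<le> hardy_norm p (?T (psum ?f x n))"
      unfolding lp_2_norm_eq using paley_lower[OF cB b \<beta>_def N1 Nlt gap, of x n] by simp
  qed
  then show ?thesis by blast
qed

end

section \<open>The main theorem\<close>

lemma compact_op_zero:
  assumes "banach_fun_space X N" and T: "bounded_op X N X N T" and T0: "\<And>f. f \<in> X \<Longrightarrow> T f = 0"
  shows "compact_op X N X N T"
proof -
  interpret banach_fun_space X N by (rule assms)
  have "0 \<in> X" using sub by (rule cfun.subspace_0)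
  have "T ` {f \<in> X. N f \<le> 1} = {0}"
  proof
    show "T ` {f \<in> X. N f \<le> 1} \<subseteq> {0}" using T0 by blast
    show "{0} \<subseteq> T ` {f \<in> X. N f \<le> 1}" using T0[OF \<open>0 \<in> X\<close>] \<open>0 \<in> X\<close> N_zero by (auto intro!: image_eqI[of _ _ 0])
  qed
  moreover have "mtopology closure_of {0} = {0}"
    using \<open>0 \<in> X\<close> by (intro closure_of_closedin closedin_Hausdorff_singleton Hausdorff_space_mtopology) auto
  ultimately show ?thesis
    using T \<open>0 \<in> X\<close> by (simp add: compact_op_def mtopology_eq finite_imp_compactin)
qed

text \<open>On a subspace where the zero operator is injective only 0 is left, and this is spanned
  by the empty set.\<close>

lemma strictly_singular_zero:
  assumes T: "bounded_op X NX Y NY T" and zero: "\<And>f. f \<in> X \<Longrightarrow> T f = 0"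
  shows "strictly_singular X NX Y NY T"
  unfolding strictly_singular_def
proof (intro conjI allI impI notI T)
  fix M assume M: "closed_subspace X NX M \<and> infinite_dimensional M" and iso: "isomorphism M NX (T ` M) NY T"
  have sub: "M \<subseteq> X" "0 \<in> M" using M by (auto simp: closed_subspace_def cfun.subspace_0)
  have "inj_on T M" using iso by (auto simp: isomorphism_def bij_betw_def)
  then have "f = 0" if "f \<in> M" for f
  proof (rule inj_onD)
    have "f \<in> X" "0 \<in> X" using that sub by auto
    then show "T f = T 0" by (simp only: zero)
  qed (use that sub in auto)
  then have "M \<subseteq> cfun.span {}" by auto
  then show False using M unfolding infinite_dimensional_def by blast
qed

lemma volterra_op_zero:
  assumes "\<And>z. norm z < 1 \<Longrightarrow> g z = 0"
  shows "volterra_op g f = 0"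
proof
  fix z
  show "volterra_op g f z = 0 z"
  proof (cases "norm z < 1")
    case True
    then have "path_image (linepath 0 z) \<subseteq> ball 0 1"
      using closed_segment_subset[of 0 "ball 0 1" z] by simp
    then have "contour_integral (linepath 0 z) (\<lambda>w. deriv f w * g w) = contour_integral (linepath 0 z) (\<lambda>w. 0)"
      using assms by (intro contour_integral_eq) auto
    then show ?thesis by (simp add: volterra_op_def)
  qed (simp add: volterra_op_def)
qed

theorem theorem1:
  fixes p :: real and g :: "complex \<Rightarrow> complex"
  assumes "1 \<le> p"
    and "g holomorphic_on ball 0 1"
    and "bounded_op (hardy_space p) (hardy_norm p) (hardy_space p) (hardy_norm p) (volterra_op g)"
  shows "(\<not> compact_op (hardy_space p) (hardy_norm p) (hardy_space p) (hardy_norm p) (volterra_op g) \<longrightarrow>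
            fixes_copy (hardy_space p) (hardy_norm p) (hardy_space p) (hardy_norm p) (volterra_op g)
              (lp_space p) (lp_norm p) \<and>
            fixes_copy (hardy_space p) (hardy_norm p) (hardy_space p) (hardy_norm p) (volterra_op g)
              (lp_space 2) (lp_norm 2) \<and>
            \<not> strictly_singular (hardy_space p) (hardy_norm p) (hardy_space p) (hardy_norm p) (volterra_op g)) \<and>
         (strictly_singular (hardy_space p) (hardy_norm p) (hardy_space p) (hardy_norm p) (volterra_op g) \<longleftrightarrow>
            compact_op (hardy_space p) (hardy_norm p) (hardy_space p) (hardy_norm p) (volterra_op g))"
proof (cases "\<exists>z0. norm z0 < 1 \<and> g z0 \<noteq> 0")
  case True
  then obtain z0 where "norm z0 < 1" "g z0 \<noteq> 0" by blast
  then interpret hardy_volterra p g z0 by unfold_locales (use assms in auto)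
  obtain f C c where "lp_embedding (hardy_space p) (hardy_norm p) (volterra_op g) f p C c"
    using lp_embedding_peaks by blast
  then interpret peaks: lp_embedding "hardy_space p" "hardy_norm p" "volterra_op g" f p C c .
  obtain f' C' c' where "lp_embedding (hardy_space p) (hardy_norm p) (volterra_op g) f' 2 C' c'"
    using lp_embedding_lacunary by blast
  then interpret lacunary: lp_embedding "hardy_space p" "hardy_norm p" "volterra_op g" f' 2 C' c' .
  \<comment> \<open>The equivalence holds here because both of its sides fail: the peaks refute
    strict singularity and compactness alike.\<close>
  show ?thesis
    using peaks.fixes_lp_copy lacunary.fixes_lp_copy peaks.not_strictly_singular peaks.not_compact by blast
next
  case False
  then have "volterra_op g f = 0" for f by (intro volterra_op_zero) auto
  then show ?thesis
    using compact_op_zero[OF banach_hardy_space[OF assms(1)] assms(3)] strictly_singular_zero[OF assms(3)] by blast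
qed

end
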